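(* Let $\Bbbk$ be an algebraically closed field of characteristic $0$, let $\hbar\in\Bbbk$ with $\hbar\ne0$, and let $\lambda\in\Bbbk$. Then the Hopf algebra $\mathfrak U^{\mathtt{jordan}}_\lambda$ is isomorphic to the Hopf subalgebra of $U_\hbar$ generated by $x=KT^{-1}$, $y=YT^{-1}$ and $g=T^{-2}$.
   Context: For a Hopf algebra $L$ with group of group-likes $G(L)$ and $g,h\in G(L)$, $\mathcal P_{g,h}(L)=\{\ell\in L:\Delta(\ell)=\ell\otimes h+g\otimes\ell\}$. $U_\hbar$ is the (Ohn) Hopf algebra generated over $\Bbbk$ by $K,Y,T^{\pm1}$ with relations $TT^{-1}=T^{-1}T=1$, $[K,T]=T^2-1$, $[Y,T]=-\tfrac{\hbar}{2}(KT+TK)$, $[K,Y]=-\tfrac12(YT+TY+YT^{-1}+T^{-1}Y)$, with $T\in G(U_\hbar)$ and $K,Y\in\mathcal P_{T^{-1},T}(U_\hbar)$. $\widetilde{\mathfrak U}^{\mathtt{jordan}}$ is the Hopf algebra generated by $a_1,a_2,g,g^{-1}$ with relations $gg^{-1}=g^{-1}g=1$, $ga_1=a_1g+(g-g^2)$, $ga_2=a_2g+a_1g$, where $g$ is group-like and $a_1,a_2\in\mathcal P_{g,1}$. Put $z=a_1a_2-a_2a_1-\tfrac12a_1^2+a_2+\tfrac12a_1$. For $\lambda\in\Bbbk$, $\mathfrak U^{\mathtt{jordan}}_\lambda:=\widetilde{\mathfrak U}^{\mathtt{jordan}}/\langle z-\lambda(1-g^2)\rangle$, which is a quotient Hopf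 algebra. *)

theory Defs
  imports "HOL-Algebra.QuotRing" "HOL-Algebra.Subrings" "HOL-Algebra.Module"
    "HOL-Computational_Algebra.Polynomial" "HOL-Library.Poly_Mapping"
begin

section \<open>Algebras over a field\<close>

definition base_alg :: "('k::field, 'k) module" where
  "base_alg = \<lparr>carrier = UNIV, monoid.mult = (*), one = 1, ring.zero = 0, add = (+), module.smult = (*)\<rparr>"

locale k_algebra = Module.module "base_alg :: ('k::field, 'k) module" A + A?: ring A
  for A :: "('k::field, 'a, 'm) module_scheme" (structure) +
  assumes smult_mult_left: "\<And>c a b. a \<in> carrier A \<Longrightarrow> b \<in> carrier A \<Longrightarrow>
      (c \<odot>\<^bsub>A\<^esub> a) \<otimes>\<^bsub>A\<^esub> b = c \<odot>\<^bsub>A\<^esub> (a \<otimes>\<^bsub>A\<^esub> b)"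
    and smult_mult_right: "\<And>c a b. a \<in> carrier A \<Longrightarrow> b \<in> carrier A \<Longrightarrow>
      a \<otimes>\<^bsub>A\<^esub> (c \<odot>\<^bsub>A\<^esub> b) = c \<odot>\<^bsub>A\<^esub> (a \<otimes>\<^bsub>A\<^esub> b)"

definition linear_maps ::
    "('k, 'a, 'm) module_scheme \<Rightarrow> ('k, 'b, 'n) module_scheme \<Rightarrow> ('a \<Rightarrow> 'b) set" where
  "linear_maps A B = {f \<in> carrier A \<rightarrow> carrier B.
     (\<forall>a\<in>carrier A. \<forall>b\<in>carrier A. f (a \<oplus>\<^bsub>A\<^esub> b) = f a \<oplus>\<^bsub>B\<^esub> f b) \<and>
     (\<forall>c. \<forall>a\<in>carrier A. f (c \<odot>\<^bsub>A\<^esub> a) = c \<odot>\<^bsub>B\<^esub> f a)}"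

definition alg_hom ::
    "('k, 'a, 'm) module_scheme \<Rightarrow> ('k, 'b, 'n) module_scheme \<Rightarrow> ('a \<Rightarrow> 'b) set" where
  "alg_hom A B = ring_hom A B \<inter> linear_maps A B"

text \<open>The quotient ring \<^term>\<open>A Quot I\<close> with the induced scalar multiplication.\<close>

definition alg_quot :: "('k, 'a, 'm) module_scheme \<Rightarrow> 'a set \<Rightarrow> ('k, 'a set) module" where
  "alg_quot A I = \<lparr>carrier = carrier (A Quot I), monoid.mult = monoid.mult (A Quot I),
     one = one (A Quot I), ring.zero = ring.zero (A Quot I), add = add (A Quot I),
     module.smult = (\<lambda>c C. \<Union>x\<in>C. I +>\<^bsub>A\<^esub> (c \<odot>\<^bsub>A\<^esub> x))\<rparr>"

definition op_alg :: "('k, 'a) module \<Rightarrow> ('k, 'a) module" where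
  "op_alg A = A\<lparr>monoid.mult := (\<lambda>a b. b \<otimes>\<^bsub>A\<^esub> a)\<rparr>"


section \<open>Tensor products\<close>

text \<open>
  The monoid algebra of the multiplicative monoid of pairs \<open>(a, b)\<close> with \<open>a \<in> A\<close>, \<open>b \<in> B\<close>. As a
  vector space it is the free vector space on these pairs; its quotient by the bilinearity
  relations is the tensor product.
\<close>

definition pair_alg :: "('k::field, 'a, 'm) module_scheme \<Rightarrow> ('k, 'b, 'n) module_scheme \<Rightarrow>
    ('k, ('a \<times> 'b) \<Rightarrow>\<^sub>0 'k) module" where
  "pair_alg A B =
    \<lparr>carrier = {p. Poly_Mapping.keys p \<subseteq> carrier A \<times> carrier B},
     monoid.mult = (\<lambda>p q. \<Sum>u\<in>Poly_Mapping.keys p. \<Sum>v\<in>Poly_Mapping.keys q.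
       Poly_Mapping.single (fst u \<otimes>\<^bsub>A\<^esub> fst v, snd u \<otimes>\<^bsub>B\<^esub> snd v)
         (Poly_Mapping.lookup p u * Poly_Mapping.lookup q v)),
     one = Poly_Mapping.single (\<one>\<^bsub>A\<^esub>, \<one>\<^bsub>B\<^esub>) 1,
     ring.zero = 0, add = (+), module.smult = (\<lambda>c. Poly_Mapping.map ((*) c))\<rparr>"

definition tensor_rels :: "('k::field, 'a, 'm) module_scheme \<Rightarrow> ('k, 'b, 'n) module_scheme \<Rightarrow>
    (('a \<times> 'b) \<Rightarrow>\<^sub>0 'k) set" where
  "tensor_rels A B =
     {Poly_Mapping.single (a \<oplus>\<^bsub>A\<^esub> a', b) 1 - Poly_Mapping.single (a, b) 1 - Poly_Mapping.single (a', b) 1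
        | a a' b. a \<in> carrier A \<and> a' \<in> carrier A \<and> b \<in> carrier B} \<union>
     {Poly_Mapping.single (a, b \<oplus>\<^bsub>B\<^esub> b') 1 - Poly_Mapping.single (a, b) 1 - Poly_Mapping.single (a, b') 1
        | a b b'. a \<in> carrier A \<and> b \<in> carrier B \<and> b' \<in> carrier B} \<union>
     {Poly_Mapping.single (c \<odot>\<^bsub>A\<^esub> a, b) 1 - Poly_Mapping.single (a, b) c
        | c a b. a \<in> carrier A \<and> b \<in> carrier B} \<union>
     {Poly_Mapping.single (a, c \<odot>\<^bsub>B\<^esub> b) 1 - Poly_Mapping.single (a, b) c
        | c a b. a \<in> carrier A \<and> b \<in> carrier B}"

definition tensor_null :: "('k::field, 'a, 'm) module_scheme \<Rightarrow> ('k, 'b, 'n) module_scheme \<Rightarrow>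
    (('a \<times> 'b) \<Rightarrow>\<^sub>0 'k) set" where
  "tensor_null A B = Modules.module.span (\<lambda>c. Poly_Mapping.map ((*) c)) (tensor_rels A B)"

definition tensor :: "('k::field, 'a, 'm) module_scheme \<Rightarrow> ('k, 'b, 'n) module_scheme \<Rightarrow>
    ('k, (('a \<times> 'b) \<Rightarrow>\<^sub>0 'k) set) module" where
  "tensor A B = alg_quot (pair_alg A B) (tensor_null A B)"

definition tens :: "('k::field, 'a, 'm) module_scheme \<Rightarrow> ('k, 'b, 'n) module_scheme \<Rightarrow>
    'a \<Rightarrow> 'b \<Rightarrow> (('a \<times> 'b) \<Rightarrow>\<^sub>0 'k) set" where
  "tens A B a b = tensor_null A B +>\<^bsub>pair_alg A B\<^esub> Poly_Mapping.single (a, b) 1"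

text \<open>
  The linear map out of a tensor product, with values in \<open>V\<close>, induced by a bilinear map \<open>\<beta>\<close>.
  In this and in the other maps on cosets below, \<open>THE\<close> picks the common value that all
  representatives of the coset are sent to.
\<close>

definition tensor_lift :: "('k::field, 'v, 'n) module_scheme \<Rightarrow> ('a \<Rightarrow> 'b \<Rightarrow> 'v) \<Rightarrow>
    (('a \<times> 'b) \<Rightarrow>\<^sub>0 'k) set \<Rightarrow> 'v" where
  "tensor_lift V \<beta> C = (THE v. \<forall>p\<in>C. v =
     (\<Oplus>\<^bsub>V\<^esub>u\<in>Poly_Mapping.keys p. Poly_Mapping.lookup p u \<odot>\<^bsub>V\<^esub> \<beta> (fst u) (snd u)))"

text \<open>\<open>f \<otimes> g\<close>, where \<open>A\<close> and \<open>B\<close> are the codomains of \<open>f\<close> and \<open>g\<close>.\<close>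

definition tensor_map :: "('k::field, 'a, 'm) module_scheme \<Rightarrow> ('k, 'b, 'n) module_scheme \<Rightarrow>
    ('c \<Rightarrow> 'a) \<Rightarrow> ('d \<Rightarrow> 'b) \<Rightarrow> (('c \<times> 'd) \<Rightarrow>\<^sub>0 'k) set \<Rightarrow> (('a \<times> 'b) \<Rightarrow>\<^sub>0 'k) set" where
  "tensor_map A B f g = tensor_lift (tensor A B) (\<lambda>c d. tens A B (f c) (g d))"

definition tensor_assoc :: "('k::field, 'a, 'm) module_scheme \<Rightarrow> ('k, 'b, 'n) module_scheme \<Rightarrow>
    ('k, 'c, 'l) module_scheme \<Rightarrow> (('a \<times> (('b \<times> 'c) \<Rightarrow>\<^sub>0 'k) set) \<Rightarrow>\<^sub>0 'k) set \<Rightarrow>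
    (((('a \<times> 'b) \<Rightarrow>\<^sub>0 'k) set \<times> 'c) \<Rightarrow>\<^sub>0 'k) set" where
  "tensor_assoc A B C = tensor_lift (tensor (tensor A B) C) (\<lambda>a.
     tensor_lift (tensor (tensor A B) C) (\<lambda>b c. tens (tensor A B) C (tens A B a b) c))"


section \<open>Hopf algebras\<close>

record (overloaded) ('k, 'a) hopf = "('k, 'a) module" +
  comult :: "'a \<Rightarrow> (('a \<times> 'a) \<Rightarrow>\<^sub>0 'k) set"
  counit :: "'a \<Rightarrow> 'k"
  antipode :: "'a \<Rightarrow> 'a"

locale hopf_algebra = k_algebra H for H :: "('k::field, 'a) hopf" (structure) +
  assumes comult_hom: "comult H \<in> alg_hom H (tensor H H)"
    and counit_hom: "counit H \<in> alg_hom H base_alg"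
    and antipode_linear: "antipode H \<in> linear_maps H H"
    and coassoc: "\<And>a. a \<in> carrier H \<Longrightarrow>
      tensor_map (tensor H H) H (comult H) (\<lambda>x. x) (comult H a) =
      tensor_assoc H H H (tensor_map H (tensor H H) (\<lambda>x. x) (comult H) (comult H a))"
    and counit_left: "\<And>a. a \<in> carrier H \<Longrightarrow>
      tensor_lift H (\<lambda>x y. counit H x \<odot>\<^bsub>H\<^esub> y) (comult H a) = a"
    and counit_right: "\<And>a. a \<in> carrier H \<Longrightarrow>
      tensor_lift H (\<lambda>x y. counit H y \<odot>\<^bsub>H\<^esub> x) (comult H a) = a"
    and antipode_left: "\<And>a. a \<in> carrier H \<Longrightarrow>
      tensor_lift H (\<lambda>x y. antipode H x \<otimes>\<^bsub>H\<^esub> y) (comult H a) = counit H a \<odot>\<^bsub>H\<^esub> \<one>\<^bsub>H\<^esub>"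
    and antipode_right: "\<And>a. a \<in> carrier H \<Longrightarrow>
      tensor_lift H (\<lambda>x y. x \<otimes>\<^bsub>H\<^esub> antipode H y) (comult H a) = counit H a \<odot>\<^bsub>H\<^esub> \<one>\<^bsub>H\<^esub>"

definition hopf_iso :: "('k::field, 'a) hopf \<Rightarrow> ('k, 'b) hopf \<Rightarrow> ('a \<Rightarrow> 'b) set" where
  "hopf_iso H L = {f \<in> alg_hom H L. bij_betw f (carrier H) (carrier L) \<and>
     (\<forall>a\<in>carrier H. comult L (f a) = tensor_map L L f f (comult H a) \<and>
        counit L (f a) = counit H a \<and> antipode L (f a) = f (antipode H a))}"

definition hopf_isomorphic :: "('k::field, 'a) hopf \<Rightarrow> ('k, 'b) hopf \<Rightarrow> bool" where
  "hopf_isomorphic H L \<longleftrightarrow> hopf_algebra H \<and> hopf_algebra L \<and> hopf_iso H L \<noteq> {}"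

definition hopf_subalgebra :: "'a set \<Rightarrow> ('k::field, 'a) hopf \<Rightarrow> bool" where
  "hopf_subalgebra B H \<longleftrightarrow> hopf_algebra H \<and> subring B H \<and>
     (\<forall>c. \<forall>b\<in>B. c \<odot>\<^bsub>H\<^esub> b \<in> B) \<and>
     comult H ` B \<subseteq> tensor_map H H (\<lambda>x. x) (\<lambda>x. x) `
       carrier (tensor (H\<lparr>carrier := B\<rparr>) (H\<lparr>carrier := B\<rparr>)) \<and>
     antipode H ` B \<subseteq> B"

text \<open>
  A Hopf subalgebra as a Hopf algebra. Its comultiplication takes values in \<open>B \<otimes> B\<close>, which is
  identified with its image in \<open>H \<otimes> H\<close> under the (injective) map induced by the inclusion.
\<close>

definition hopf_restrict :: "('k::field, 'a) hopf \<Rightarrow> 'a set \<Rightarrow> ('k, 'a) hopf" where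
  "hopf_restrict H B = H\<lparr>carrier := B, comult := (\<lambda>b. THE t.
     t \<in> carrier (tensor (H\<lparr>carrier := B\<rparr>) (H\<lparr>carrier := B\<rparr>)) \<and>
     tensor_map H H (\<lambda>x. x) (\<lambda>x. x) t = comult H b)\<rparr>"

definition hopf_generated :: "('k::field, 'a) hopf \<Rightarrow> 'a set \<Rightarrow> ('k, 'a) hopf" where
  "hopf_generated H S = hopf_restrict H ((\<lambda>B. hopf_subalgebra B H) hull S)"

definition hopf_ideal :: "'a set \<Rightarrow> ('k::field, 'a) hopf \<Rightarrow> bool" where
  "hopf_ideal I H \<longleftrightarrow> hopf_algebra H \<and> ideal I H \<and>
     comult H ` I \<subseteq> generate (add_monoid (tensor H H))
       ({tens H H i a | i a. i \<in> I \<and> a \<in> carrier H} \<union> {tens H H a i | i a. i \<in> I \<and> a \<in> carrier H}) \<and>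
     counit H ` I \<subseteq> {0} \<and> antipode H ` I \<subseteq> I"

definition hopf_quot :: "('k::field, 'a) hopf \<Rightarrow> 'a set \<Rightarrow> ('k, 'a set) hopf" where
  "hopf_quot H I = (let Q = alg_quot H I; \<pi> = (\<lambda>a. I +>\<^bsub>H\<^esub> a) in
     module.extend Q \<lparr>comult = (\<lambda>C. THE t. \<forall>a\<in>C. t = tensor_map Q Q \<pi> \<pi> (comult H a)),
       counit = (\<lambda>C. THE c. \<forall>a\<in>C. c = counit H a),
       antipode = (\<lambda>C. THE s. \<forall>a\<in>C. s = \<pi> (antipode H a))\<rparr>)"


section \<open>Presentations by generators and relations\<close>

text \<open>The free monoid; the free algebra on \<^typ>\<open>'g\<close> is its monoid algebra \<^typ>\<open>'g list \<Rightarrow>\<^sub>0 'k\<close>.\<close>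

instantiation list :: (type) monoid_add
begin

definition zero_list :: "'a list" where "zero_list = []"

definition plus_list :: "'a list \<Rightarrow> 'a list \<Rightarrow> 'a list" where "plus_list = (@)"

instance by standard (simp_all add: zero_list_def plus_list_def)

end

type_synonym ('g, 'k) free = "'g list \<Rightarrow>\<^sub>0 'k"

definition gen :: "'g \<Rightarrow> ('g, 'k::field) free" where
  "gen x = Poly_Mapping.single [x] 1"

definition cst :: "'k::field \<Rightarrow> ('g, 'k) free" where
  "cst c = Poly_Mapping.single [] c"

definition free_alg :: "('k::field, ('g, 'k) free) module" where
  "free_alg = \<lparr>carrier = UNIV, monoid.mult = (*), one = 1, ring.zero = 0, add = (+),
     module.smult = (\<lambda>c p. cst c * p)\<rparr>"

definition free_eval :: "('k::field, 'a, 'm) module_scheme \<Rightarrow> ('g \<Rightarrow> 'a) \<Rightarrow> ('g, 'k) free \<Rightarrow> 'a" where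
  "free_eval A \<phi> p = (\<Oplus>\<^bsub>A\<^esub>w\<in>Poly_Mapping.keys p. Poly_Mapping.lookup p w \<odot>\<^bsub>A\<^esub>
     foldr (\<lambda>x a. \<phi> x \<otimes>\<^bsub>A\<^esub> a) w \<one>\<^bsub>A\<^esub>)"

definition pres_class :: "('g, 'k::field) free set \<Rightarrow> ('g, 'k) free \<Rightarrow> ('g, 'k) free set" where
  "pres_class R p = (Idl\<^bsub>free_alg\<^esub> R) +>\<^bsub>free_alg\<^esub> p"

definition pres_alg :: "('g, 'k::field) free set \<Rightarrow> ('k, ('g, 'k) free set) module" where
  "pres_alg R = alg_quot free_alg (Idl\<^bsub>free_alg\<^esub> R)"

text \<open>
  The presented algebra with the comultiplication and counit that extend \<open>\<delta>\<close> and \<open>\<epsilon>\<close> to algebra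
  maps and the antipode that extends \<open>\<sigma>\<close> to an algebra antihomomorphism.
\<close>

definition pres_hopf :: "('g, 'k::field) free set \<Rightarrow>
    ('g \<Rightarrow> ((('g, 'k) free set \<times> ('g, 'k) free set) \<Rightarrow>\<^sub>0 'k) set) \<Rightarrow> ('g \<Rightarrow> 'k) \<Rightarrow>
    ('g \<Rightarrow> ('g, 'k) free set) \<Rightarrow> ('k, ('g, 'k) free set) hopf" where
  "pres_hopf R \<delta> \<epsilon> \<sigma> = (let A = pres_alg R in
     module.extend A \<lparr>comult = (\<lambda>C. THE t. \<forall>p\<in>C. t = free_eval (tensor A A) \<delta> p),
       counit = (\<lambda>C. THE c. \<forall>p\<in>C. c = free_eval base_alg \<epsilon> p),
       antipode = (\<lambda>C. THE s. \<forall>p\<in>C. s = free_eval (op_alg A) \<sigma> p)\<rparr>)"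

text \<open>
  The values of the comultiplication that express \<open>g \<in> G(L)\<close> and \<open>l \<in> P\<^bsub>g,h\<^esub>(L)\<close>. Counit and
  antipode are then forced: \<open>\<epsilon>(g) = 1\<close>, \<open>S(g) = g\<^sup>-\<^sup>1\<close>, \<open>\<epsilon>(l) = 0\<close> and \<open>S(l) = - g\<^sup>-\<^sup>1 l h\<^sup>-\<^sup>1\<close>.
\<close>

definition grouplike_comult :: "('k::field, 'a) module \<Rightarrow> 'a \<Rightarrow> (('a \<times> 'a) \<Rightarrow>\<^sub>0 'k) set" where
  "grouplike_comult A g = tens A A g g"

definition skew_prim_comult :: "('k::field, 'a) module \<Rightarrow> 'a \<Rightarrow> 'a \<Rightarrow> 'a \<Rightarrow> (('a \<times> 'a) \<Rightarrow>\<^sub>0 'k) set" where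
  "skew_prim_comult A g h l = tens A A l h \<oplus>\<^bsub>tensor A A\<^esub> tens A A g l"


section \<open>The Ohn Hopf algebra\<close>

text \<open>\<open>OTi\<close> is \<open>T\<^sup>-\<^sup>1\<close>; likewise \<open>JGi\<close> below is \<open>g\<^sup>-\<^sup>1\<close>.\<close>

datatype ohn_gen = OK | OY | OT | OTi

definition ohn_rels :: "'k::field \<Rightarrow> (ohn_gen, 'k) free set" where
  "ohn_rels hbar = (let K = gen OK; Y = gen OY; T = gen OT; Ti = gen OTi in
     {T * Ti - 1,
      Ti * T - 1,
      (K * T - T * K) - (T * T - 1),
      (Y * T - T * Y) + cst (hbar / 2) * (K * T + T * K),
      (K * Y - Y * K) + cst (1 / 2) * (Y * T + T * Y + Y * Ti + Ti * Y)})"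

definition ohn_cls :: "'k::field \<Rightarrow> (ohn_gen, 'k) free \<Rightarrow> (ohn_gen, 'k) free set" where
  "ohn_cls hbar = pres_class (ohn_rels hbar)"

definition ohn :: "'k::field \<Rightarrow> ('k, (ohn_gen, 'k) free set) hopf" where
  "ohn hbar = (let A = pres_alg (ohn_rels hbar); c = ohn_cls hbar;
       K = gen OK; Y = gen OY; T = gen OT; Ti = gen OTi in
     pres_hopf (ohn_rels hbar)
       (case_ohn_gen (skew_prim_comult A (c Ti) (c T) (c K)) (skew_prim_comult A (c Ti) (c T) (c Y))
          (grouplike_comult A (c T)) (grouplike_comult A (c Ti)))
       (case_ohn_gen 0 0 1 1)
       (case_ohn_gen (c (- (T * K * Ti))) (c (- (T * Y * Ti))) (c Ti) (c T)))"


section \<open>The Hopf algebras of Jordan type\<close>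

datatype jordan_gen = JA1 | JA2 | JG | JGi

definition jordan_rels :: "(jordan_gen, 'k::field) free set" where
  "jordan_rels = (let a1 = gen JA1; a2 = gen JA2; g = gen JG; gi = gen JGi in
     {g * gi - 1,
      gi * g - 1,
      g * a1 - (a1 * g + (g - g * g)),
      g * a2 - (a2 * g + a1 * g)})"

definition jordan_cls :: "(jordan_gen, 'k::field) free \<Rightarrow> (jordan_gen, 'k) free set" where
  "jordan_cls = pres_class jordan_rels"

definition jordan_tilde :: "('k::field, (jordan_gen, 'k) free set) hopf" where
  "jordan_tilde = (let A = pres_alg jordan_rels; c = jordan_cls;
       a1 = gen JA1; a2 = gen JA2; g = gen JG; gi = gen JGi in
     pres_hopf jordan_rels
       (case_jordan_gen (skew_prim_comult A (c g) (c 1) (c a1)) (skew_prim_comult A (c g) (c 1) (c a2))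
          (grouplike_comult A (c g)) (grouplike_comult A (c gi)))
       (case_jordan_gen 0 0 1 1)
       (case_jordan_gen (c (- (gi * a1))) (c (- (gi * a2))) (c gi) (c g)))"

definition jordan_z :: "(jordan_gen, 'k::field) free" where
  "jordan_z = (let a1 = gen JA1; a2 = gen JA2 in
     a1 * a2 - a2 * a1 - cst (1 / 2) * (a1 * a1) + a2 + cst (1 / 2) * a1)"

definition jordan_ideal :: "'k::field \<Rightarrow> (jordan_gen, 'k) free set set" where
  "jordan_ideal lam = Idl\<^bsub>jordan_tilde\<^esub> {jordan_cls (jordan_z - cst lam * (1 - gen JG * gen JG))}"

definition jordan :: "'k::field \<Rightarrow> ('k, (jordan_gen, 'k) free set set) hopf" where
  "jordan lam = hopf_quot jordan_tilde (jordan_ideal lam)"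

end

theory Submission
  imports Defs
begin

text \<open>
  The map is \<open>a\<^sub>1 \<mapsto> x / 2\<close>, \<open>a\<^sub>2 \<mapsto> - y / (4 \<hbar>) - x / 4 + (\<lambda> + 1 / 32) (1 - g)\<close>, \<open>g \<mapsto> g\<close>. It respects the
  relations and the Hopf structure, and its image is generated by \<open>x\<close>, \<open>y\<close>, \<open>g\<close> and \<open>g\<^sup>-\<^sup>1\<close>, which
  is the smallest Hopf subalgebra containing \<open>x\<close>, \<open>y\<close>, \<open>g\<close>. Injectivity needs no PBW basis: conjugation
  by \<open>T\<^sup>-\<^sup>1\<close> gives an automorphism \<open>\<sigma>\<close> of the Jordan type algebra \<open>A\<close> whose square is conjugation by \<open>g\<close>,
  so that \<open>A\<close> embeds into an algebra \<open>A \<oplus> A s\<close> with \<open>s\<^sup>2 = g\<close> and \<open>s a = \<sigma>(a) s\<close>. The Ohn algebra maps to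
  this algebra with \<open>T\<^sup>-\<^sup>1 \<mapsto> s\<close>, and the composite \<open>A \<rightarrow> U\<^sub>\<hbar> \<rightarrow> A \<oplus> A s \<rightarrow> A\<close> is the identity.
\<close>

section \<open>Algebras and quotients\<close>

text \<open>Presentations make it easy to prove that two elements agree and hard to prove that they
  differ. Every check is therefore brought into the form of an ideal membership, injectivity
  included: it becomes the existence of a left inverse. There is no evident algebra map from
  \<open>U\<close> back to \<open>A\<close>, since \<open>T\<close> would need a square root of
  \<open>g^-1\<close> in \<open>A\<close>; the extension supplies one. The coefficients come from
  moving \<open>g\<close> to the right. In \<open>U\<close> one has
  \<open>g x = x g + 2 (g - g^2)\<close> and \<open>g y = y g - 2 hbar (x g + g - g^2)\<close>. The
  relation for \<open>g a1\<close> asks for \<open>a1 = x / 2\<close>, and with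
  \<open>a2 = alpha y + beta x\<close> the relation for \<open>g a2\<close> asks for
  \<open>-2 hbar alpha = 1 / 2\<close> and \<open>beta = hbar alpha = -1 / 4\<close>. A multiple of
  \<open>1 - g\<close> commutes with \<open>g\<close>, so it is left to the relation for
  \<open>z\<close>: without it \<open>z = -(1 - g^2) / 32\<close>, and \<open>lam + 1 / 32\<close>
  makes up the difference to \<open>lam (1 - g^2)\<close>.\<close>

lemma base_alg_simps [simp]:
  "carrier base_alg = UNIV" "a \<otimes>\<^bsub>base_alg\<^esub> b = a * b" "a \<oplus>\<^bsub>base_alg\<^esub> b = a + b"
  "\<one>\<^bsub>base_alg\<^esub> = 1" "\<zero>\<^bsub>base_alg\<^esub> = 0" "a \<odot>\<^bsub>base_alg\<^esub> b = a * b"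
  by (simp_all add: base_alg_def)

lemma cring_base_alg: "cring (base_alg :: ('k::field, 'k) module)"
proof (rule cringI)
  show "abelian_group (base_alg :: ('k::field, 'k) module)"
    by (rule abelian_groupI) (auto simp: algebra_simps intro: exI[of _ "- _"])
  show "Group.comm_monoid (base_alg :: ('k::field, 'k) module)"
    by (rule comm_monoidI) (auto simp: algebra_simps)
qed (auto simp: algebra_simps)

text \<open>Additive inverses come from the scalars, as \<open>(-1) a\<close>. The same rule serves
  every algebra built below: pair algebras, quotients, opposites, subalgebras, free algebras and the
  twisted extension.\<close>

lemma k_algebraI:
  fixes A :: "('k::field, 'a, 'm) module_scheme" (structure)
  assumes zero: "\<zero> \<in> carrier A" and one: "\<one> \<in> carrier A"
    and add: "\<And>a b. a \<in> carrier A \<Longrightarrow> b \<in> carrier A \<Longrightarrow> a \<oplus> b \<in> carrier A"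
    and mult: "\<And>a b. a \<in> carrier A \<Longrightarrow> b \<in> carrier A \<Longrightarrow> a \<otimes> b \<in> carrier A"
    and smult: "\<And>c a. a \<in> carrier A \<Longrightarrow> c \<odot> a \<in> carrier A"
    and a_assoc: "\<And>a b c. a \<in> carrier A \<Longrightarrow> b \<in> carrier A \<Longrightarrow> c \<in> carrier A \<Longrightarrow> (a \<oplus> b) \<oplus> c = a \<oplus> (b \<oplus> c)"
    and a_comm: "\<And>a b. a \<in> carrier A \<Longrightarrow> b \<in> carrier A \<Longrightarrow> a \<oplus> b = b \<oplus> a"
    and l_zero: "\<And>a. a \<in> carrier A \<Longrightarrow> \<zero> \<oplus> a = a"
    and m_assoc: "\<And>a b c. a \<in> carrier A \<Longrightarrow> b \<in> carrier A \<Longrightarrow> c \<in> carrier A \<Longrightarrow> (a \<otimes> b) \<otimes> c = a \<otimes> (b \<otimes> c)"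
    and l_one: "\<And>a. a \<in> carrier A \<Longrightarrow> \<one> \<otimes> a = a"
    and r_one: "\<And>a. a \<in> carrier A \<Longrightarrow> a \<otimes> \<one> = a"
    and l_distr: "\<And>a b c. a \<in> carrier A \<Longrightarrow> b \<in> carrier A \<Longrightarrow> c \<in> carrier A \<Longrightarrow> (a \<oplus> b) \<otimes> c = a \<otimes> c \<oplus> b \<otimes> c"
    and r_distr: "\<And>a b c. a \<in> carrier A \<Longrightarrow> b \<in> carrier A \<Longrightarrow> c \<in> carrier A \<Longrightarrow> c \<otimes> (a \<oplus> b) = c \<otimes> a \<oplus> c \<otimes> b"
    and smult_l_distr: "\<And>c d a. a \<in> carrier A \<Longrightarrow> (c + d) \<odot> a = c \<odot> a \<oplus> d \<odot> a"
    and smult_r_distr: "\<And>c a b. a \<in> carrier A \<Longrightarrow> b \<in> carrier A \<Longrightarrow> c \<odot> (a \<oplus> b) = c \<odot> a \<oplus> c \<odot> b"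
    and smult_assoc: "\<And>c d a. a \<in> carrier A \<Longrightarrow> (c * d) \<odot> a = c \<odot> (d \<odot> a)"
    and smult_one: "\<And>a. a \<in> carrier A \<Longrightarrow> 1 \<odot> a = a"
    and smult_zero: "\<And>a. a \<in> carrier A \<Longrightarrow> 0 \<odot> a = \<zero>"
    and sm_left: "\<And>c a b. a \<in> carrier A \<Longrightarrow> b \<in> carrier A \<Longrightarrow> (c \<odot> a) \<otimes> b = c \<odot> (a \<otimes> b)"
    and sm_right: "\<And>c a b. a \<in> carrier A \<Longrightarrow> b \<in> carrier A \<Longrightarrow> a \<otimes> (c \<odot> b) = c \<odot> (a \<otimes> b)"
  shows "k_algebra A"
proof -
  have neg: "\<exists>b\<in>carrier A. b \<oplus> a = \<zero>" if "a \<in> carrier A" for a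
  proof (rule bexI[of _ "(-1) \<odot> a"])
    have "(-1) \<odot> a \<oplus> 1 \<odot> a = (-1 + 1) \<odot> a"
      using smult_l_distr[OF that, of "-1" 1] by simp
    then show "(-1) \<odot> a \<oplus> a = \<zero>" by (simp add: smult_zero smult_one that)
  qed (simp add: smult that)
  have ag: "abelian_group A"
    by (rule abelian_groupI; (rule zero add a_assoc a_comm l_zero neg; assumption)?)
  have mon: "Group.monoid A" by (rule monoidI) (simp_all add: one mult m_assoc l_one r_one)
  have ring: "ring A" by (rule ringI) (simp_all add: ag mon l_distr r_distr)
  have mod: "Module.module base_alg A"
    by (rule moduleI) (simp_all add: cring_base_alg ag smult smult_l_distr smult_r_distr smult_assoc smult_one)
  show ?thesis
    by (intro k_algebra.intro mod ring k_algebra_axioms.intro sm_left sm_right)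
qed

context k_algebra
begin

lemma sm_closed [simp, intro]: "a \<in> carrier A \<Longrightarrow> c \<odot> a \<in> carrier A"
  using smult_closed by simp

lemma sm_l_distr: "a \<in> carrier A \<Longrightarrow> (c + d) \<odot> a = c \<odot> a \<oplus> d \<odot> a"
  using smult_l_distr[of c d a] by simp

lemma sm_r_distr: "a \<in> carrier A \<Longrightarrow> b \<in> carrier A \<Longrightarrow> c \<odot> (a \<oplus> b) = c \<odot> a \<oplus> c \<odot> b"
  using smult_r_distr[of c a b] by simp

lemma sm_assoc: "a \<in> carrier A \<Longrightarrow> (c * d) \<odot> a = c \<odot> (d \<odot> a)"
  using smult_assoc1[of c d a] by simp

lemma sm_one [simp]: "a \<in> carrier A \<Longrightarrow> 1 \<odot> a = a"
  using smult_one[of a] by simp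

lemma sm_zero [simp]: "a \<in> carrier A \<Longrightarrow> 0 \<odot> a = \<zero>"
  using sm_l_distr[of a 0 0] add.l_cancel_one[of "0 \<odot> a" "0 \<odot> a"] by simp

lemma sm_zero_right [simp]: "c \<odot> \<zero> = \<zero>"
  using sm_r_distr[of \<zero> \<zero> c] add.l_cancel_one[of "c \<odot> \<zero>" "c \<odot> \<zero>"] by simp

lemma sm_minus_one: "a \<in> carrier A \<Longrightarrow> (-1) \<odot> a = \<ominus> a"
  using sm_l_distr[of a "-1" 1] by (simp add: minus_equality)

lemma sm_one_mult: "a \<in> carrier A \<Longrightarrow> (c \<odot> \<one>) \<otimes> a = c \<odot> a"
  by (simp add: smult_mult_left)

end

subsection \<open>Linear maps and algebra maps\<close>

lemma linear_mapsI:
  assumes "\<And>a. a \<in> carrier A \<Longrightarrow> f a \<in> carrier B"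
    "\<And>a b. a \<in> carrier A \<Longrightarrow> b \<in> carrier A \<Longrightarrow> f (a \<oplus>\<^bsub>A\<^esub> b) = f a \<oplus>\<^bsub>B\<^esub> f b"
    "\<And>c a. a \<in> carrier A \<Longrightarrow> f (c \<odot>\<^bsub>A\<^esub> a) = c \<odot>\<^bsub>B\<^esub> f a"
  shows "f \<in> linear_maps A B"
  using assms by (auto simp: linear_maps_def)

lemma linear_mapsD:
  assumes "f \<in> linear_maps A B"
  shows "a \<in> carrier A \<Longrightarrow> f a \<in> carrier B"
    "a \<in> carrier A \<Longrightarrow> b \<in> carrier A \<Longrightarrow> f (a \<oplus>\<^bsub>A\<^esub> b) = f a \<oplus>\<^bsub>B\<^esub> f b"
    "a \<in> carrier A \<Longrightarrow> f (c \<odot>\<^bsub>A\<^esub> a) = c \<odot>\<^bsub>B\<^esub> f a"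
  using assms by (auto simp: linear_maps_def)

lemma alg_homI:
  assumes "\<And>a. a \<in> carrier A \<Longrightarrow> f a \<in> carrier B"
    "\<And>a b. a \<in> carrier A \<Longrightarrow> b \<in> carrier A \<Longrightarrow> f (a \<oplus>\<^bsub>A\<^esub> b) = f a \<oplus>\<^bsub>B\<^esub> f b"
    "\<And>c a. a \<in> carrier A \<Longrightarrow> f (c \<odot>\<^bsub>A\<^esub> a) = c \<odot>\<^bsub>B\<^esub> f a"
    "\<And>a b. a \<in> carrier A \<Longrightarrow> b \<in> carrier A \<Longrightarrow> f (a \<otimes>\<^bsub>A\<^esub> b) = f a \<otimes>\<^bsub>B\<^esub> f b"
    "f \<one>\<^bsub>A\<^esub> = \<one>\<^bsub>B\<^esub>"
  shows "f \<in> alg_hom A B"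
  using assms by (auto simp: alg_hom_def linear_maps_def intro: ring_hom_memI)

lemma alg_homD:
  assumes "f \<in> alg_hom A B"
  shows "a \<in> carrier A \<Longrightarrow> f a \<in> carrier B"
    "a \<in> carrier A \<Longrightarrow> b \<in> carrier A \<Longrightarrow> f (a \<oplus>\<^bsub>A\<^esub> b) = f a \<oplus>\<^bsub>B\<^esub> f b"
    "a \<in> carrier A \<Longrightarrow> f (c \<odot>\<^bsub>A\<^esub> a) = c \<odot>\<^bsub>B\<^esub> f a"
    "a \<in> carrier A \<Longrightarrow> b \<in> carrier A \<Longrightarrow> f (a \<otimes>\<^bsub>A\<^esub> b) = f a \<otimes>\<^bsub>B\<^esub> f b"
    "f \<one>\<^bsub>A\<^esub> = \<one>\<^bsub>B\<^esub>"
  using assms by (auto simp: alg_hom_def linear_maps_def ring_hom_def)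

lemma alg_hom_linear: "f \<in> alg_hom A B \<Longrightarrow> f \<in> linear_maps A B"
  by (simp add: alg_hom_def)

lemma linear_maps_comp:
  "f \<in> linear_maps A B \<Longrightarrow> g \<in> linear_maps B C \<Longrightarrow> (\<lambda>a. g (f a)) \<in> linear_maps A C"
  by (rule linear_mapsI) (simp_all add: linear_mapsD)

lemma alg_hom_comp:
  "f \<in> alg_hom A B \<Longrightarrow> g \<in> alg_hom B C \<Longrightarrow> (\<lambda>a. g (f a)) \<in> alg_hom A C"
  by (rule alg_homI) (simp_all add: alg_homD)

lemma linear_map_zero:
  assumes "k_algebra A" "k_algebra B" "f \<in> linear_maps A B"
  shows "f \<zero>\<^bsub>A\<^esub> = \<zero>\<^bsub>B\<^esub>"
proof -
  interpret A: k_algebra A by fact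
  interpret B: k_algebra B by fact
  have "f (0 \<odot>\<^bsub>A\<^esub> \<zero>\<^bsub>A\<^esub>) = 0 \<odot>\<^bsub>B\<^esub> f \<zero>\<^bsub>A\<^esub>"
    using linear_mapsD(3)[OF assms(3)] by blast
  then show ?thesis using linear_mapsD(1)[OF assms(3)] by simp
qed

lemma linear_map_minus:
  assumes "k_algebra A" "k_algebra B" "f \<in> linear_maps A B" "a \<in> carrier A" "b \<in> carrier A"
  shows "f (\<ominus>\<^bsub>A\<^esub> a) = \<ominus>\<^bsub>B\<^esub> f a" "f (a \<ominus>\<^bsub>A\<^esub> b) = f a \<ominus>\<^bsub>B\<^esub> f b"
proof -
  interpret A: k_algebra A by fact
  interpret B: k_algebra B by fact
  note f = linear_mapsD[OF assms(3)]
  have m: "f (\<ominus>\<^bsub>A\<^esub> a) = \<ominus>\<^bsub>B\<^esub> f a" if "a \<in> carrier A" for a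
    using f(3)[of a "-1"] f(1)[of a] that by (simp add: A.sm_minus_one B.sm_minus_one)
  show "f (\<ominus>\<^bsub>A\<^esub> a) = \<ominus>\<^bsub>B\<^esub> f a" using m assms by simp
  show "f (a \<ominus>\<^bsub>A\<^esub> b) = f a \<ominus>\<^bsub>B\<^esub> f b"
    using m[of b] assms(4,5) f(2)[of a "\<ominus>\<^bsub>A\<^esub> b"] by (simp add: A.minus_eq B.minus_eq)
qed

subsection \<open>Quotient algebras\<close>

lemma alg_quot_simps:
  "carrier (alg_quot A I) = carrier (A Quot I)"
  "C \<otimes>\<^bsub>alg_quot A I\<^esub> D = C \<otimes>\<^bsub>A Quot I\<^esub> D"
  "C \<oplus>\<^bsub>alg_quot A I\<^esub> D = C \<oplus>\<^bsub>A Quot I\<^esub> D"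
  "\<one>\<^bsub>alg_quot A I\<^esub> = \<one>\<^bsub>A Quot I\<^esub>" "\<zero>\<^bsub>alg_quot A I\<^esub> = \<zero>\<^bsub>A Quot I\<^esub>"
  by (simp_all add: alg_quot_def)

text \<open>A map on cosets as in the definitions: \<open>THE\<close> is a junk value unless \<open>f\<close> is constant on \<open>C\<close>.\<close>

definition coset_map :: "('a \<Rightarrow> 'b) \<Rightarrow> 'a set \<Rightarrow> 'b" where
  "coset_map f C = (THE v. \<forall>a\<in>C. v = f a)"

locale alg_ideal = k_algebra A + I: ideal I A
  for A :: "('k::field, 'a, 'm) module_scheme" (structure) and I
begin

abbreviation proj :: "'a \<Rightarrow> 'a set" where "proj a \<equiv> I +> a"

text \<open>A ring ideal of a unital algebra is a subspace because \<open>c i = (c 1) i\<close>;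
  hence ideals of the underlying ring suffice for quotient algebras.\<close>

lemma sm_ideal: "i \<in> I \<Longrightarrow> c \<odot> i \<in> I"
  using I.I_l_closed[of i "c \<odot> \<one>"] I.Icarr by (simp add: sm_one_mult)

lemma self_in_proj: "a \<in> carrier A \<Longrightarrow> a \<in> proj a"
  by (rule I.a_rcos_self)

lemma in_proj_iff: "a \<in> carrier A \<Longrightarrow> b \<in> proj a \<longleftrightarrow> b \<in> carrier A \<and> b \<ominus> a \<in> I"
  by (cases "b \<in> carrier A") (simp_all add: I.a_rcos_module minus_eq, blast intro: I.a_elemrcos_carrier)

lemma proj_eq_iff: "a \<in> carrier A \<Longrightarrow> b \<in> carrier A \<Longrightarrow> proj a = proj b \<longleftrightarrow> a \<ominus> b \<in> I"
  using quotient_eq_iff_same_a_r_cos[OF I.ideal_axioms] by blast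

lemma proj_carrier: "C \<in> carrier (alg_quot A I) \<longleftrightarrow> (\<exists>a\<in>carrier A. C = proj a)"
  by (auto simp: alg_quot_simps FactRing_def A_RCOSETS_def')

text \<open>The definition takes a union over all representatives of the coset. They all yield the
  same coset because \<open>I\<close> is closed under scalars, so the union is that coset.\<close>

lemma proj_smult: "a \<in> carrier A \<Longrightarrow> c \<odot>\<^bsub>alg_quot A I\<^esub> proj a = proj (c \<odot> a)"
proof -
  assume a: "a \<in> carrier A"
  have "proj (c \<odot> x) = proj (c \<odot> a)" if "x \<in> proj a" for x
  proof -
    have x: "x \<in> carrier A" "x \<ominus> a \<in> I" using that a in_proj_iff by auto
    have "c \<odot> x \<ominus> c \<odot> a = c \<odot> (x \<ominus> a)"
      using x a by (simp add: minus_eq sm_r_distr flip: sm_minus_one sm_assoc)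
    then show ?thesis using sm_ideal[OF x(2)] x(1) a by (simp add: proj_eq_iff)
  qed
  then show ?thesis unfolding alg_quot_def using UN_constant_eq[OF self_in_proj[OF a], of "\<lambda>x. proj (c \<odot> x)"] by simp
qed

lemma proj_add: "a \<in> carrier A \<Longrightarrow> b \<in> carrier A \<Longrightarrow> proj a \<oplus>\<^bsub>alg_quot A I\<^esub> proj b = proj (a \<oplus> b)"
  by (simp add: alg_quot_simps FactRing_def I.a_rcos_sum)

lemma proj_mult: "a \<in> carrier A \<Longrightarrow> b \<in> carrier A \<Longrightarrow> proj a \<otimes>\<^bsub>alg_quot A I\<^esub> proj b = proj (a \<otimes> b)"
  by (simp add: alg_quot_simps FactRing_def I.rcoset_mult_add)

lemma proj_one: "\<one>\<^bsub>alg_quot A I\<^esub> = proj \<one>"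
  by (simp add: alg_quot_simps FactRing_def)

lemma proj_zero: "\<zero>\<^bsub>alg_quot A I\<^esub> = proj \<zero>"
  using I.a_subset by (simp add: alg_quot_simps FactRing_def a_coset_add_zero)

lemma k_algebra_alg_quot: "k_algebra (alg_quot A I)"
  by (rule k_algebraI)
    (auto simp: proj_carrier proj_smult proj_add proj_mult proj_one proj_zero
      m_assoc l_distr r_distr a_ac sm_l_distr sm_r_distr sm_assoc smult_mult_left smult_mult_right)

lemma proj_hom: "proj \<in> alg_hom A (alg_quot A I)"
  by (rule alg_homI) (auto simp: proj_carrier proj_smult proj_add proj_mult proj_one)

lemma proj_eq_zero_iff: "a \<in> carrier A \<Longrightarrow> proj a = \<zero>\<^bsub>alg_quot A I\<^esub> \<longleftrightarrow> a \<in> I"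
  by (simp add: proj_zero proj_eq_iff minus_eq)

text \<open>A linear map that kills \<open>I\<close> is constant on each coset. This turns every
  \<open>THE\<close> on cosets in the definitions into an actual value.\<close>

lemma coset_map_proj:
  assumes B: "k_algebra B" and f: "f \<in> linear_maps A B" and I: "\<And>i. i \<in> I \<Longrightarrow> f i = \<zero>\<^bsub>B\<^esub>"
    and a: "a \<in> carrier A"
  shows "coset_map f (proj a) = f a"
proof -
  interpret B: k_algebra B by fact
  have "f b = f a" if "b \<in> proj a" for b
  proof -
    have b: "b \<in> carrier A" "b \<ominus> a \<in> I" using that a in_proj_iff by auto
    have "f b \<ominus>\<^bsub>B\<^esub> f a = \<zero>\<^bsub>B\<^esub>"
      using I[OF b(2)] linear_map_minus(2)[OF k_algebra_axioms B f b(1) a] by simp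
    then show ?thesis using linear_mapsD(1)[OF f] a b by simp
  qed
  then show ?thesis unfolding coset_map_def using self_in_proj[OF a] by (intro the_equality) metis+
qed

lemma coset_map_linear:
  assumes B: "k_algebra B" and f: "f \<in> linear_maps A B" and I: "\<And>i. i \<in> I \<Longrightarrow> f i = \<zero>\<^bsub>B\<^esub>"
  shows "coset_map f \<in> linear_maps (alg_quot A I) B"
  by (rule linear_mapsI)
    (auto simp: proj_carrier proj_smult proj_add coset_map_proj[OF assms] linear_mapsD[OF f])

lemma coset_map_hom:
  assumes B: "k_algebra B" and f: "f \<in> alg_hom A B" and I: "\<And>i. i \<in> I \<Longrightarrow> f i = \<zero>\<^bsub>B\<^esub>"
  shows "coset_map f \<in> alg_hom (alg_quot A I) B"
  by (rule alg_homI)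
    (auto simp: proj_carrier proj_smult proj_add proj_mult proj_one
      coset_map_proj[OF B alg_hom_linear[OF f] I] alg_homD[OF f])

end

lemma alg_hom_kernel_ideal:
  assumes A: "k_algebra A" and B: "k_algebra B" and f: "f \<in> alg_hom A B"
  shows "ideal {a \<in> carrier A. f a = \<zero>\<^bsub>B\<^esub>} A"
proof -
  interpret A: k_algebra A by fact
  interpret B: k_algebra B by fact
  have "ring_hom_ring A B f"
    using f by (intro ring_hom_ringI2 A.ring_axioms B.ring_axioms) (simp add: alg_hom_def)
  from ring_hom_ring.kernel_is_ideal[OF this] show ?thesis by (simp add: a_kernel_def')
qed

text \<open>The kernel is an ideal containing \<open>S\<close>, and \<open>Idl S\<close> is the
  least one. To descend to a quotient, a map has to be checked on ideal generators only.\<close>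

lemma alg_hom_genideal_zero:
  assumes A: "k_algebra A" and B: "k_algebra B" and f: "f \<in> alg_hom A B"
    and S: "S \<subseteq> carrier A" "\<And>s. s \<in> S \<Longrightarrow> f s = \<zero>\<^bsub>B\<^esub>" and a: "a \<in> Idl\<^bsub>A\<^esub> S"
  shows "f a = \<zero>\<^bsub>B\<^esub>"
  using ring.genideal_minimal[OF _ alg_hom_kernel_ideal[OF A B f], of S] S a k_algebra.axioms(2)[OF A]
  by blast

section \<open>Finitely supported functions as linear combinations\<close>

abbreviation "pkeys \<equiv> Poly_Mapping.keys"
abbreviation "plookup \<equiv> Poly_Mapping.lookup"
abbreviation "psingle \<equiv> Poly_Mapping.single"
abbreviation pscale :: "'k::field \<Rightarrow> ('u \<Rightarrow>\<^sub>0 'k) \<Rightarrow> 'u \<Rightarrow>\<^sub>0 'k" where "pscale c \<equiv> Poly_Mapping.map ((*) c)"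

lemma lookup_scale [simp]: "plookup (pscale c p) u = (c::'k::field) * plookup p u"
  by (transfer fixing: c) (auto simp: when_def)

lemma keys_scale: "pkeys (pscale (c::'k::field) p) \<subseteq> pkeys p"
  by (auto simp: in_keys_iff)

text \<open>The set \<open>S\<close> carries membership in a carrier through the induction: the
  algebras here live on subsets of types, and their laws hold only there.\<close>

lemma keys_induct [consumes 1, case_names zero add]:
  fixes p :: "'u \<Rightarrow>\<^sub>0 'k::ab_group_add"
  assumes "pkeys p \<subseteq> S" and "P 0"
    and add: "\<And>u c q. u \<in> S \<Longrightarrow> pkeys q \<subseteq> S \<Longrightarrow> P q \<Longrightarrow> P (psingle u c + q)"
  shows "P p"
  using assms(1)
proof (induction "card (pkeys p)" arbitrary: p)
  case 0
  then have "p = 0" by simp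
  then show ?case using \<open>P 0\<close> by simp
next
  case (Suc n)
  then obtain u where u: "u \<in> pkeys p" by fastforce
  define q where "q = p - psingle u (plookup p u)"
  have q: "pkeys q = pkeys p - {u}"
    by (auto simp: q_def in_keys_iff lookup_minus lookup_single when_def split: if_splits)
  have "P q" using Suc u by (intro Suc.hyps(1)) (auto simp: q)
  then have "P (psingle u (plookup p u) + q)"
    using u Suc.prems by (intro add) (auto simp: q)
  then show ?case by (simp add: q_def)
qed

lemma in_keys_diffD: "u \<in> pkeys (p - q :: _ \<Rightarrow>\<^sub>0 'k::field) \<Longrightarrow> u \<in> pkeys p \<or> u \<in> pkeys q"
  by (auto simp: in_keys_iff lookup_minus)

text \<open>Convolution for an arbitrary binary operation on indices. In a pair algebra the
  operation comes from two records, so the product of finitely supported functions that is based on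
  type classes does not apply.\<close>

definition conv :: "('u \<Rightarrow> 'u \<Rightarrow> 'u) \<Rightarrow> ('u \<Rightarrow>\<^sub>0 'k::field) \<Rightarrow> ('u \<Rightarrow>\<^sub>0 'k) \<Rightarrow> ('u \<Rightarrow>\<^sub>0 'k)" where
  "conv m p q = (\<Sum>u\<in>pkeys p. \<Sum>v\<in>pkeys q.
     psingle (m u v) (plookup p u * plookup q v))"

text \<open>Larger index sets add only zero terms. They give both summands of a sum a common index
  set, after which additivity is checked term by term.\<close>

lemma conv_supset:
  assumes "finite S" "pkeys p \<subseteq> S" "finite T" "pkeys q \<subseteq> T"
  shows "conv m p q = (\<Sum>u\<in>S. \<Sum>v\<in>T.
     psingle (m u v) (plookup p u * plookup q v))"
  unfolding conv_def using assms
  by (intro sum.mono_neutral_cong_left ballI sum.neutral) (auto simp: in_keys_iff)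

lemma conv_add_left: "conv m (p + p') q = conv m p q + conv m p' q"
  using Poly_Mapping.keys_add[of p p']
  by (simp add: conv_supset[of "pkeys p \<union> pkeys p'" _ "pkeys q"]
      lookup_add distrib_right single_add sum.distrib)

lemma conv_add_right: "conv m p (q + q') = conv m p q + conv m p q'"
  using Poly_Mapping.keys_add[of q q']
  by (simp add: conv_supset[of "pkeys p" _ "pkeys q \<union> pkeys q'"]
      lookup_add distrib_left single_add sum.distrib)

lemma conv_zero [simp]: "conv m 0 q = 0" "conv m p 0 = 0"
  by (simp_all add: conv_def)

lemma conv_single [simp]:
  "conv m (psingle u a) (psingle v b) = psingle (m u v) (a * b)"
  by (simp add: conv_supset[of "{u}" _ "{v}"])

lemma scale_add: "pscale (c::'k::field) (p + q) = pscale c p + pscale c q"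
  by (rule poly_mapping_eqI) (simp add: lookup_add distrib_left)

lemma scale_single [simp]: "pscale (c::'k::field) (psingle u a) = psingle u (c * a)"
  by (rule poly_mapping_eqI) (simp add: lookup_single when_def)

lemma scale_0 [simp]: "pscale (c::'k::field) 0 = 0"
  by (rule poly_mapping_eqI) simp

lemma module_scale: "Modules.module (\<lambda>c::'k::field. pscale c :: ('u \<Rightarrow>\<^sub>0 'k) \<Rightarrow> _)"
  by standard (auto intro!: poly_mapping_eqI simp: lookup_add algebra_simps)

lemma keys_sum_subset: "(\<And>i. i \<in> I \<Longrightarrow> pkeys (f i) \<subseteq> S) \<Longrightarrow> pkeys (sum f I) \<subseteq> S"
proof (induction I rule: infinite_finite_induct)
  case (insert i I)
  then show ?case using Poly_Mapping.keys_add[of "f i" "sum f I"] by auto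
qed auto

lemma keys_conv_subset:
  assumes "pkeys p \<subseteq> S" "pkeys q \<subseteq> S" "\<And>u v. u \<in> S \<Longrightarrow> v \<in> S \<Longrightarrow> m u v \<in> S"
  shows "pkeys (conv m p q) \<subseteq> S"
  unfolding conv_def using assms by (intro keys_sum_subset) auto

lemma keys_induct_UNIV [case_names zero add]:
  fixes p :: "'u \<Rightarrow>\<^sub>0 'k::ab_group_add"
  assumes "P 0" "\<And>u c q. P q \<Longrightarrow> P (psingle u c + q)"
  shows "P p"
  using subset_UNIV assms by (rule keys_induct)

lemma conv_scale_right: "conv m p (pscale c q) = pscale c (conv m p q)"
proof -
  have s: "conv m (psingle u a) (pscale c q) =
    pscale c (conv m (psingle u a) q)" for u a
    by (induction q rule: keys_induct_UNIV) (simp_all add: scale_add conv_add_right mult.left_commute)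
  show ?thesis
    by (induction p rule: keys_induct_UNIV) (simp_all add: scale_add conv_add_left s)
qed

lemma conv_scale_left: "conv m (pscale c p) q = pscale c (conv m p q)"
proof -
  have s: "conv m (psingle u (c * a)) q =
    pscale c (conv m (psingle u a) q)" for u a
    by (induction q rule: keys_induct_UNIV) (simp_all add: scale_add conv_add_right mult.assoc)
  show ?thesis
    by (induction p rule: keys_induct_UNIV) (simp_all add: scale_add conv_add_left s)
qed

text \<open>Both sides are trilinear, so one induction per argument reduces the claim to single
  terms. Associativity of \<open>m\<close> is assumed on \<open>S\<close> alone because it will be
  the product of carrier elements.\<close>

lemma conv_assoc:
  assumes "pkeys p \<subseteq> S" "pkeys q \<subseteq> S" "pkeys r \<subseteq> S"
    and m: "\<And>u v w. u \<in> S \<Longrightarrow> v \<in> S \<Longrightarrow> w \<in> S \<Longrightarrow> m (m u v) w = m u (m v w)"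
  shows "conv m (conv m p q) r = conv m p (conv m q r)"
proof -
  have s: "conv m (conv m (psingle u a) (psingle v b)) r =
    conv m (psingle u a) (conv m (psingle v b) r)" if "u \<in> S" "v \<in> S" for u a v b
    using assms(3) that by (induction r rule: keys_induct) (simp_all add: conv_add_right m mult.assoc)
  have t: "conv m (conv m (psingle u a) q) r =
    conv m (psingle u a) (conv m q r)" if "u \<in> S" for u a
    using assms(2) that
    by (induction q rule: keys_induct) (simp_all add: conv_add_right conv_add_left s del: conv_single)
  show ?thesis
    using assms(1) by (induction p rule: keys_induct) (simp_all add: conv_add_left t)
qed

lemma conv_unit:
  assumes "pkeys p \<subseteq> S"
  shows "(\<And>u. u \<in> S \<Longrightarrow> m e u = u) \<Longrightarrow> conv m (psingle e 1) p = p"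
    "(\<And>u. u \<in> S \<Longrightarrow> m u e = u) \<Longrightarrow> conv m p (psingle e 1) = p"
  using assms by (induction p rule: keys_induct) (simp_all add: conv_add_left conv_add_right)

lemma conv_diff_left: "conv m (p - p') q = conv m p q - conv m p' q"
  using conv_add_left[of m "p - p'" p' q] by simp

lemma conv_diff_right: "conv m p (q - q') = conv m p q - conv m p q'"
  using conv_add_right[of m p "q - q'" q'] by simp

text \<open>The linear extension of \<open>F\<close> from a basis to the free vector space. Both
  \<open>tensor_lift\<close> and \<open>free_eval\<close> are instances, so linearity is proved
  once.\<close>

definition lincomb :: "('k::field, 'v, 'n) module_scheme \<Rightarrow> ('u \<Rightarrow> 'v) \<Rightarrow> ('u \<Rightarrow>\<^sub>0 'k) \<Rightarrow> 'v" where
  "lincomb V F p = (\<Oplus>\<^bsub>V\<^esub>u\<in>pkeys p. plookup p u \<odot>\<^bsub>V\<^esub> F u)"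

context k_algebra
begin

lemma lincomb_supset:
  assumes "finite S" "pkeys p \<subseteq> S" "\<And>u. u \<in> S \<Longrightarrow> F u \<in> carrier A"
  shows "lincomb A F p = (\<Oplus>u\<in>S. plookup p u \<odot> F u)"
  unfolding lincomb_def using assms
  by (intro add.finprod_mono_neutral_cong_left) (auto simp: in_keys_iff)

lemma lincomb_closed [intro]:
  "(\<And>u. u \<in> pkeys p \<Longrightarrow> F u \<in> carrier A) \<Longrightarrow> lincomb A F p \<in> carrier A"
  unfolding lincomb_def by (intro finsum_closed) auto

lemma lincomb_zero [simp]: "lincomb A F 0 = \<zero>"
  by (simp add: lincomb_def)

lemma lincomb_single [simp]: "F u \<in> carrier A \<Longrightarrow> lincomb A F (psingle u c) = c \<odot> F u"
  by (subst lincomb_supset[of "{u}"]) auto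

lemma lincomb_add:
  assumes "pkeys p \<subseteq> S" "pkeys q \<subseteq> S" "\<And>u. u \<in> S \<Longrightarrow> F u \<in> carrier A"
  shows "lincomb A F (p + q) = lincomb A F p \<oplus> lincomb A F q"
proof -
  let ?S = "pkeys p \<union> pkeys q"
  have F: "F u \<in> carrier A" if "u \<in> ?S" for u using assms that by auto
  have "lincomb A F (p + q) = (\<Oplus>u\<in>?S. plookup (p + q) u \<odot> F u)"
    using Poly_Mapping.keys_add[of p q] F by (intro lincomb_supset) auto
  also have "\<dots> = (\<Oplus>u\<in>?S. plookup p u \<odot> F u \<oplus> plookup q u \<odot> F u)"
    using F by (intro add.finprod_cong') (auto simp: lookup_add sm_l_distr)
  also have "\<dots> = (\<Oplus>u\<in>?S. plookup p u \<odot> F u) \<oplus> (\<Oplus>u\<in>?S. plookup q u \<odot> F u)"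
    using F by (intro finsum_addf) auto
  also have "\<dots> = lincomb A F p \<oplus> lincomb A F q"
    using F lincomb_supset[of ?S p F] lincomb_supset[of ?S q F] by simp
  finally show ?thesis .
qed

lemma lincomb_scale:
  assumes "pkeys p \<subseteq> S" "\<And>u. u \<in> S \<Longrightarrow> F u \<in> carrier A"
  shows "lincomb A F (pscale c p) = c \<odot> lincomb A F p"
  using assms(1)
proof (induction p rule: keys_induct)
  case (add u a p)
  have k: "pkeys (psingle u a) \<subseteq> S" for a using add by auto
  have "pkeys (pscale c p) \<subseteq> S" using add keys_scale[of c p] by auto
  then show ?case
    using add assms(2) by (simp add: scale_add lincomb_add[OF k] sm_r_distr sm_assoc lincomb_closed subset_iff)
qed auto

end

subsection \<open>The algebra of pairs and its quotient\<close>

lemma pair_alg_simps: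
  "carrier (pair_alg A B) = {p. pkeys p \<subseteq> carrier A \<times> carrier B}"
  "p \<otimes>\<^bsub>pair_alg A B\<^esub> q = conv (\<lambda>u v. (fst u \<otimes>\<^bsub>A\<^esub> fst v, snd u \<otimes>\<^bsub>B\<^esub> snd v)) p q"
  "p \<oplus>\<^bsub>pair_alg A B\<^esub> q = p + q" "\<zero>\<^bsub>pair_alg A B\<^esub> = 0"
  "\<one>\<^bsub>pair_alg A B\<^esub> = psingle (\<one>\<^bsub>A\<^esub>, \<one>\<^bsub>B\<^esub>) 1"
  "c \<odot>\<^bsub>pair_alg A B\<^esub> p = pscale c p"
  by (simp_all add: pair_alg_def conv_def)

locale two_algebras = A: k_algebra A + B: k_algebra B
  for A :: "('k::field, 'a, 'm) module_scheme" and B :: "('k, 'b, 'n) module_scheme"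
begin

lemma k_algebra_pair_alg: "k_algebra (pair_alg A B)"
proof (rule k_algebraI, goal_cases)
  \<comment> \<open>The numbers follow the assumptions of \<open>k_algebraI\<close>: 3 to 5 are
    closure, 9 is associativity, 10 and 11 are the unit laws.\<close>
  case (3 a b)
  then show ?case using Poly_Mapping.keys_add[of a b] by (auto simp: pair_alg_simps)
next
  case (4 a b)
  then show ?case unfolding pair_alg_simps
    by (simp, intro keys_conv_subset) auto
next
  case (5 c a)
  then show ?case using keys_scale[of c a] by (auto simp: pair_alg_simps)
next
  case (9 a b c)
  then show ?case unfolding pair_alg_simps
    by (intro conv_assoc[of _ "carrier A \<times> carrier B"]) (auto simp: A.m_assoc B.m_assoc)
next
  case (10 a)
  then show ?case unfolding pair_alg_simps by (intro conv_unit) auto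
next
  case (11 a)
  then show ?case unfolding pair_alg_simps by (intro conv_unit) auto
qed (auto simp: pair_alg_simps add.assoc add.commute conv_add_left conv_add_right conv_scale_left conv_scale_right
      lookup_add algebra_simps intro!: poly_mapping_eqI)

lemma tensor_relsI:
  "a \<in> carrier A \<Longrightarrow> a' \<in> carrier A \<Longrightarrow> b \<in> carrier B \<Longrightarrow>
    psingle (a \<oplus>\<^bsub>A\<^esub> a', b) 1 - psingle (a, b) 1 - psingle (a', b) 1 \<in> tensor_rels A B"
  "a \<in> carrier A \<Longrightarrow> b \<in> carrier B \<Longrightarrow> b' \<in> carrier B \<Longrightarrow>
    psingle (a, b \<oplus>\<^bsub>B\<^esub> b') 1 - psingle (a, b) 1 - psingle (a, b') 1 \<in> tensor_rels A B"
  "a \<in> carrier A \<Longrightarrow> b \<in> carrier B \<Longrightarrow>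
    psingle (c \<odot>\<^bsub>A\<^esub> a, b) 1 - psingle (a, b) c \<in> tensor_rels A B"
  "a \<in> carrier A \<Longrightarrow> b \<in> carrier B \<Longrightarrow>
    psingle (a, c \<odot>\<^bsub>B\<^esub> b) 1 - psingle (a, b) c \<in> tensor_rels A B"
  unfolding tensor_rels_def by blast+

lemma tensor_rels_cases [consumes 1, case_names add_left add_right smult_left smult_right]:
  assumes "r \<in> tensor_rels A B"
  obtains a a' b where "r = psingle (a \<oplus>\<^bsub>A\<^esub> a', b) 1 - psingle (a, b) 1 - psingle (a', b) 1"
      "a \<in> carrier A" "a' \<in> carrier A" "b \<in> carrier B"
    | a b b' where "r = psingle (a, b \<oplus>\<^bsub>B\<^esub> b') 1 - psingle (a, b) 1 - psingle (a, b') 1"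
      "a \<in> carrier A" "b \<in> carrier B" "b' \<in> carrier B"
    | c a b where "r = psingle (c \<odot>\<^bsub>A\<^esub> a, b) 1 - psingle (a, b) c"
      "a \<in> carrier A" "b \<in> carrier B"
    | c a b where "r = psingle (a, c \<odot>\<^bsub>B\<^esub> b) 1 - psingle (a, b) c"
      "a \<in> carrier A" "b \<in> carrier B"
proof -
  from assms show thesis unfolding tensor_rels_def
  proof (elim UnE CollectE exE conjE, goal_cases)
    case 1 then show thesis by (rule that(1))
  next
    case 2 then show thesis by (rule that(2))
  next
    case 3 then show thesis by (rule that(3))
  next
    case 4 then show thesis by (rule that(4))
  qed
qed

lemma tensor_rels_subset: "tensor_rels A B \<subseteq> carrier (pair_alg A B)"
proof
  fix r assume "r \<in> tensor_rels A B"
  then show "r \<in> carrier (pair_alg A B)"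
    by (cases rule: tensor_rels_cases)
      (auto simp: pair_alg_simps(1) dest!: in_keys_diffD split: if_splits)
qed

lemma tensor_null_induct [consumes 1, case_names zero add scale rel]:
  assumes "p \<in> tensor_null A B" "P 0" "\<And>p q. P p \<Longrightarrow> P q \<Longrightarrow> P (p + q)"
    "\<And>c p. P p \<Longrightarrow> P (pscale c p)" "\<And>p. p \<in> tensor_rels A B \<Longrightarrow> P p"
  shows "P p"
proof -
  interpret sc: Modules.module "\<lambda>c. pscale c :: ('a \<times> 'b \<Rightarrow>\<^sub>0 'k) \<Rightarrow> _" by (rule module_scale)
  show ?thesis
    using assms(1) unfolding tensor_null_def
    by (rule sc.span_induct) (auto simp: sc.subspace_def assms(2-))
qed

lemma tensor_null_closed:
  "0 \<in> tensor_null A B"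
  "p \<in> tensor_null A B \<Longrightarrow> q \<in> tensor_null A B \<Longrightarrow> p + q \<in> tensor_null A B"
  "p \<in> tensor_null A B \<Longrightarrow> pscale c p \<in> tensor_null A B"
  "p \<in> tensor_rels A B \<Longrightarrow> p \<in> tensor_null A B"
proof -
  interpret sc: Modules.module "\<lambda>c. pscale c :: ('a \<times> 'b \<Rightarrow>\<^sub>0 'k) \<Rightarrow> _" by (rule module_scale)
  show
    "0 \<in> tensor_null A B"
    "p \<in> tensor_null A B \<Longrightarrow> q \<in> tensor_null A B \<Longrightarrow> p + q \<in> tensor_null A B"
    "p \<in> tensor_null A B \<Longrightarrow> pscale c p \<in> tensor_null A B"
    "p \<in> tensor_rels A B \<Longrightarrow> p \<in> tensor_null A B"
    unfolding tensor_null_def by (rule sc.span_zero sc.span_add sc.span_scale sc.span_base; assumption)+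
qed

lemma tensor_null_subset: "tensor_null A B \<subseteq> carrier (pair_alg A B)"
proof
  interpret P: k_algebra "pair_alg A B" by (rule k_algebra_pair_alg)
  fix p assume "p \<in> tensor_null A B"
  then show "p \<in> carrier (pair_alg A B)"
    using P.zero_closed P.add.m_closed P.sm_closed tensor_rels_subset
    by (induction rule: tensor_null_induct) (auto simp: pair_alg_simps(3-))
qed

text \<open>Multiplication by \<open>a\<close> and by \<open>b\<close> is linear, so each of the
  four kinds of relations is mapped to itself. This works for coefficient 1; other coefficients
  leave the list of relations and are handled in its span.\<close>

lemma tensor_rels_mult:
  assumes "a \<in> carrier A" "b \<in> carrier B" "r \<in> tensor_rels A B"
  shows "conv (\<lambda>u v. (fst u \<otimes>\<^bsub>A\<^esub> fst v, snd u \<otimes>\<^bsub>B\<^esub> snd v)) (psingle (a, b) 1) r \<in> tensor_rels A B"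
    "conv (\<lambda>u v. (fst u \<otimes>\<^bsub>A\<^esub> fst v, snd u \<otimes>\<^bsub>B\<^esub> snd v)) r (psingle (a, b) 1) \<in> tensor_rels A B"
  using assms(3,1,2)
  by (cases rule: tensor_rels_cases; simp add: conv_diff_right conv_diff_left A.r_distr B.r_distr A.l_distr B.l_distr
      A.smult_mult_right B.smult_mult_right A.smult_mult_left B.smult_mult_left tensor_relsI)+

lemma tensor_null_mult:
  assumes "p \<in> carrier (pair_alg A B)" "n \<in> tensor_null A B"
  shows "p \<otimes>\<^bsub>pair_alg A B\<^esub> n \<in> tensor_null A B" "n \<otimes>\<^bsub>pair_alg A B\<^esub> p \<in> tensor_null A B"
proof -
  let ?m = "\<lambda>u v. (fst u \<otimes>\<^bsub>A\<^esub> fst v, snd u \<otimes>\<^bsub>B\<^esub> snd v)"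
  have *: "conv ?m (psingle u c) n \<in> tensor_null A B \<and> conv ?m n (psingle u c) \<in> tensor_null A B"
    if "u \<in> carrier A \<times> carrier B" for u c
    using assms(2)
  proof (induction rule: tensor_null_induct)
    case (rel r)
    then have "conv ?m (psingle u 1) r \<in> tensor_null A B" "conv ?m r (psingle u 1) \<in> tensor_null A B"
      using that tensor_rels_mult[of "fst u" "snd u" r] tensor_null_closed(4) by auto
    moreover have "conv ?m (psingle u c) r = pscale c (conv ?m (psingle u 1) r)"
      "conv ?m r (psingle u c) = pscale c (conv ?m r (psingle u 1))"
      using conv_scale_left[of ?m c "psingle u 1" r]
        conv_scale_right[of ?m r c "psingle u 1"] by simp_all
    ultimately show ?case using tensor_null_closed(3) by presburger
  qed (simp_all add: tensor_null_closed conv_add_left conv_add_right conv_scale_left conv_scale_right)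
  have "conv ?m p n \<in> tensor_null A B \<and> conv ?m n p \<in> tensor_null A B"
    using assms(1) unfolding pair_alg_simps(1) mem_Collect_eq
    by (induction p rule: keys_induct) (simp_all add: tensor_null_closed conv_add_left conv_add_right *)
  then show "p \<otimes>\<^bsub>pair_alg A B\<^esub> n \<in> tensor_null A B" "n \<otimes>\<^bsub>pair_alg A B\<^esub> p \<in> tensor_null A B"
    by (simp_all add: pair_alg_simps)
qed

lemma alg_ideal_tensor_null: "alg_ideal (pair_alg A B) (tensor_null A B)"
proof -
  interpret P: k_algebra "pair_alg A B" by (rule k_algebra_pair_alg)
  have "ideal (tensor_null A B) (pair_alg A B)"
  proof (rule idealI)
    have "\<ominus>\<^bsub>pair_alg A B\<^esub> p \<in> tensor_null A B" if "p \<in> tensor_null A B" for p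
      using P.sm_minus_one[of p] tensor_null_subset tensor_null_closed(3)[of p "-1"] that
      by (auto simp: pair_alg_simps(6))
    then show "subgroup (tensor_null A B) (add_monoid (pair_alg A B))"
      using tensor_null_subset tensor_null_closed(1,2)
      by (intro P.add.subgroupI) (auto simp: pair_alg_simps(3))
  qed (use tensor_null_mult in \<open>auto simp: P.ring_axioms\<close>)
  then show ?thesis by (simp add: alg_ideal_def k_algebra_pair_alg)
qed

end

subsection \<open>Tensor products\<close>

lemma linear_map_cong:
  "f \<in> linear_maps A B \<Longrightarrow> k_algebra A \<Longrightarrow> (\<And>a. a \<in> carrier A \<Longrightarrow> g a = f a) \<Longrightarrow> g \<in> linear_maps A B"
proof -
  assume f: "f \<in> linear_maps A B" and A: "k_algebra A" and g: "\<And>a. a \<in> carrier A \<Longrightarrow> g a = f a"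
  interpret A: k_algebra A by fact
  show ?thesis by (rule linear_mapsI) (simp_all add: g linear_mapsD[OF f])
qed

definition bilinear_map :: "('k, 'a, 'm) module_scheme \<Rightarrow> ('k, 'b, 'n) module_scheme \<Rightarrow>
    ('k, 'v, 'l) module_scheme \<Rightarrow> ('a \<Rightarrow> 'b \<Rightarrow> 'v) \<Rightarrow> bool" where
  "bilinear_map A B V \<beta> \<longleftrightarrow> (\<forall>a\<in>carrier A. \<beta> a \<in> linear_maps B V) \<and>
     (\<forall>b\<in>carrier B. (\<lambda>a. \<beta> a b) \<in> linear_maps A V)"

lemma bilinear_mapI:
  assumes "\<And>a b. a \<in> carrier A \<Longrightarrow> b \<in> carrier B \<Longrightarrow> \<beta> a b \<in> carrier V"
    "\<And>a b b'. a \<in> carrier A \<Longrightarrow> b \<in> carrier B \<Longrightarrow> b' \<in> carrier B \<Longrightarrow> \<beta> a (b \<oplus>\<^bsub>B\<^esub> b') = \<beta> a b \<oplus>\<^bsub>V\<^esub> \<beta> a b'"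
    "\<And>a a' b. a \<in> carrier A \<Longrightarrow> a' \<in> carrier A \<Longrightarrow> b \<in> carrier B \<Longrightarrow> \<beta> (a \<oplus>\<^bsub>A\<^esub> a') b = \<beta> a b \<oplus>\<^bsub>V\<^esub> \<beta> a' b"
    "\<And>c a b. a \<in> carrier A \<Longrightarrow> b \<in> carrier B \<Longrightarrow> \<beta> a (c \<odot>\<^bsub>B\<^esub> b) = c \<odot>\<^bsub>V\<^esub> \<beta> a b"
    "\<And>c a b. a \<in> carrier A \<Longrightarrow> b \<in> carrier B \<Longrightarrow> \<beta> (c \<odot>\<^bsub>A\<^esub> a) b = c \<odot>\<^bsub>V\<^esub> \<beta> a b"
  shows "bilinear_map A B V \<beta>"
  using assms by (auto simp: bilinear_map_def linear_maps_def)

lemma bilinear_mapD: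
  assumes "bilinear_map A B V \<beta>"
  shows "a \<in> carrier A \<Longrightarrow> b \<in> carrier B \<Longrightarrow> \<beta> a b \<in> carrier V"
    "a \<in> carrier A \<Longrightarrow> b \<in> carrier B \<Longrightarrow> b' \<in> carrier B \<Longrightarrow> \<beta> a (b \<oplus>\<^bsub>B\<^esub> b') = \<beta> a b \<oplus>\<^bsub>V\<^esub> \<beta> a b'"
    "a \<in> carrier A \<Longrightarrow> a' \<in> carrier A \<Longrightarrow> b \<in> carrier B \<Longrightarrow> \<beta> (a \<oplus>\<^bsub>A\<^esub> a') b = \<beta> a b \<oplus>\<^bsub>V\<^esub> \<beta> a' b"
    "a \<in> carrier A \<Longrightarrow> b \<in> carrier B \<Longrightarrow> \<beta> a (c \<odot>\<^bsub>B\<^esub> b) = c \<odot>\<^bsub>V\<^esub> \<beta> a b"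
    "a \<in> carrier A \<Longrightarrow> b \<in> carrier B \<Longrightarrow> \<beta> (c \<odot>\<^bsub>A\<^esub> a) b = c \<odot>\<^bsub>V\<^esub> \<beta> a b"
  using assms by (auto simp: bilinear_map_def linear_maps_def)

lemma tensor_lift_eq_coset_map:
  "tensor_lift V \<beta> = coset_map (lincomb V (\<lambda>u. \<beta> (fst u) (snd u)))"
  by (rule ext) (simp add: tensor_lift_def coset_map_def lincomb_def)

context two_algebras
begin

sublocale null: alg_ideal "pair_alg A B" "tensor_null A B"
  by (rule alg_ideal_tensor_null)

lemma k_algebra_tensor: "k_algebra (tensor A B)"
  unfolding tensor_def by (rule null.k_algebra_alg_quot)

lemma single_in_pair_alg: "a \<in> carrier A \<Longrightarrow> b \<in> carrier B \<Longrightarrow> psingle (a, b) c \<in> carrier (pair_alg A B)"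
  by (auto simp: pair_alg_simps)

lemma tens_closed: "a \<in> carrier A \<Longrightarrow> b \<in> carrier B \<Longrightarrow> tens A B a b \<in> carrier (tensor A B)"
  unfolding tensor_def tens_def using alg_homD(1)[OF null.proj_hom] single_in_pair_alg by blast

lemma pair_alg_minus:
  assumes "p \<in> carrier (pair_alg A B)" "q \<in> carrier (pair_alg A B)"
  shows "p \<ominus>\<^bsub>pair_alg A B\<^esub> q = p - q"
proof -
  have "p \<ominus>\<^bsub>pair_alg A B\<^esub> q = p + pscale (-1) q"
    using null.sm_minus_one[OF assms(2)] by (simp add: null.minus_eq pair_alg_simps)
  also have "\<dots> = p - q" by (rule poly_mapping_eqI) (simp add: lookup_add lookup_minus)
  finally show ?thesis .
qed

lemma tens_bilinear: "bilinear_map A B (tensor A B) (tens A B)"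
proof (rule bilinear_mapI)
  have smult: "c \<odot>\<^bsub>tensor A B\<^esub> tens A B a b = null.proj (psingle (a, b) c)"
    if "a \<in> carrier A" "b \<in> carrier B" for c a b
    unfolding tensor_def tens_def using single_in_pair_alg[OF that]
    by (simp add: null.proj_smult) (simp add: pair_alg_simps)
  have add: "tens A B a b \<oplus>\<^bsub>tensor A B\<^esub> tens A B a' b' =
    null.proj (psingle (a, b) 1 + psingle (a', b') 1)"
    if "a \<in> carrier A" "b \<in> carrier B" "a' \<in> carrier A" "b' \<in> carrier B" for a b a' b'
    unfolding tensor_def tens_def using single_in_pair_alg that
    by (simp add: null.proj_add) (simp add: pair_alg_simps)
  have eq: "null.proj p = null.proj q" if "p - q \<in> tensor_rels A B" "p \<in> carrier (pair_alg A B)" "q \<in> carrier (pair_alg A B)" for p q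
    using that tensor_null_closed(4) by (simp add: null.proj_eq_iff pair_alg_minus)
  have sum: "psingle u 1 + psingle v 1 \<in> carrier (pair_alg A B)"
    if "u \<in> carrier A \<times> carrier B" "v \<in> carrier A \<times> carrier B" for u v
    using that null.add.m_closed[of "psingle u 1" "psingle v 1"] by (simp add: pair_alg_simps)
  show "tens A B a b \<in> carrier (tensor A B)" if "a \<in> carrier A" "b \<in> carrier B" for a b
    using that by (rule tens_closed)
  show "tens A B a (b \<oplus>\<^bsub>B\<^esub> b') = tens A B a b \<oplus>\<^bsub>tensor A B\<^esub> tens A B a b'"
    if "a \<in> carrier A" "b \<in> carrier B" "b' \<in> carrier B" for a b b'
    unfolding add[OF that(1,2) that(1,3)] unfolding tens_def using that tensor_relsI(2)[of a b b']
    by (intro eq single_in_pair_alg sum) (auto simp: diff_diff_eq)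
  show "tens A B (a \<oplus>\<^bsub>A\<^esub> a') b = tens A B a b \<oplus>\<^bsub>tensor A B\<^esub> tens A B a' b"
    if "a \<in> carrier A" "a' \<in> carrier A" "b \<in> carrier B" for a a' b
    unfolding add[OF that(1,3) that(2,3)] unfolding tens_def using that tensor_relsI(1)[of a a' b]
    by (intro eq single_in_pair_alg sum) (auto simp: diff_diff_eq)
  show "tens A B a (c \<odot>\<^bsub>B\<^esub> b) = c \<odot>\<^bsub>tensor A B\<^esub> tens A B a b"
    if "a \<in> carrier A" "b \<in> carrier B" for c a b
    unfolding smult[OF that] unfolding tens_def using that tensor_relsI(4)[of a b c]
    by (intro eq single_in_pair_alg) auto
  show "tens A B (c \<odot>\<^bsub>A\<^esub> a) b = c \<odot>\<^bsub>tensor A B\<^esub> tens A B a b"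
    if "a \<in> carrier A" "b \<in> carrier B" for c a b
    unfolding smult[OF that] unfolding tens_def using that tensor_relsI(3)[of a b c]
    by (intro eq single_in_pair_alg) auto
qed

lemma tens_mult:
  assumes "a \<in> carrier A" "b \<in> carrier B" "a' \<in> carrier A" "b' \<in> carrier B"
  shows "tens A B a b \<otimes>\<^bsub>tensor A B\<^esub> tens A B a' b' = tens A B (a \<otimes>\<^bsub>A\<^esub> a') (b \<otimes>\<^bsub>B\<^esub> b')"
  unfolding tensor_def tens_def using single_in_pair_alg assms
  by (simp add: null.proj_mult) (simp add: pair_alg_simps)

lemma tens_one: "\<one>\<^bsub>tensor A B\<^esub> = tens A B \<one>\<^bsub>A\<^esub> \<one>\<^bsub>B\<^esub>"
  unfolding tensor_def tens_def null.proj_one by (simp add: pair_alg_simps)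

text \<open>Sums of pure tensors without coefficients suffice, since a coefficient \<open>c\<close>
  of the pair \<open>(a, b)\<close> is absorbed into the first factor as \<open>c a\<close>.\<close>

lemma tensor_induct [consumes 1, case_names zero add]:
  assumes t: "t \<in> carrier (tensor A B)" and zero: "P \<zero>\<^bsub>tensor A B\<^esub>"
    and add: "\<And>a b t. a \<in> carrier A \<Longrightarrow> b \<in> carrier B \<Longrightarrow> t \<in> carrier (tensor A B) \<Longrightarrow> P t \<Longrightarrow> P (tens A B a b \<oplus>\<^bsub>tensor A B\<^esub> t)"
  shows "P t"
proof -
  obtain p where p: "p \<in> carrier (pair_alg A B)" "t = null.proj p"
    using t null.proj_carrier by (auto simp: tensor_def)
  have "P (null.proj p)"
    using p(1) unfolding pair_alg_simps(1) mem_Collect_eq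
  proof (induction rule: keys_induct)
    case zero
    then show ?case using \<open>P \<zero>\<^bsub>tensor A B\<^esub>\<close> by (simp add: tensor_def null.proj_zero pair_alg_simps)
  next
    case (add u c q)
    obtain a b where u: "u = (a, b)" "a \<in> carrier A" "b \<in> carrier B" using add by auto
    have q: "q \<in> carrier (pair_alg A B)" using add by (simp add: pair_alg_simps)
    have "null.proj (psingle u c + q) =
      null.proj (psingle u c) \<oplus>\<^bsub>tensor A B\<^esub> null.proj q"
      unfolding tensor_def u using null.proj_add[OF single_in_pair_alg[OF u(2,3), of c] q] by (simp add: pair_alg_simps)
    moreover have "null.proj (psingle u c) = tens A B (c \<odot>\<^bsub>A\<^esub> a) b"
      unfolding u bilinear_mapD(5)[OF tens_bilinear u(2,3)] unfolding tensor_def tens_def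
      using single_in_pair_alg[OF u(2,3), of 1]
      by (simp add: null.proj_smult) (simp add: pair_alg_simps)
    moreover have "null.proj q \<in> carrier (tensor A B)"
      unfolding tensor_def using null.proj_carrier q by blast
    ultimately show ?case
      using assms(3)[of "c \<odot>\<^bsub>A\<^esub> a" b "null.proj q"] add.IH u by simp
  qed
  then show ?thesis by (simp add: p)
qed

lemma lincomb_linear:
  assumes V: "k_algebra V" and \<beta>: "bilinear_map A B V \<beta>"
  shows "lincomb V (\<lambda>u. \<beta> (fst u) (snd u)) \<in> linear_maps (pair_alg A B) V"
proof -
  interpret V: k_algebra V by fact
  have F: "\<beta> (fst u) (snd u) \<in> carrier V" if "u \<in> carrier A \<times> carrier B" for u
    using that bilinear_mapD(1)[OF \<beta>] by auto
  show ?thesis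
  proof (rule linear_mapsI)
    show "lincomb V (\<lambda>u. \<beta> (fst u) (snd u)) p \<in> carrier V" if "p \<in> carrier (pair_alg A B)" for p
      using that F by (intro V.lincomb_closed) (auto simp: pair_alg_simps)
  qed (auto simp: pair_alg_simps intro: V.lincomb_add V.lincomb_scale F)
qed

lemma lincomb_tensor_null:
  assumes V: "k_algebra V" and \<beta>: "bilinear_map A B V \<beta>" and n: "n \<in> tensor_null A B"
  shows "lincomb V (\<lambda>u. \<beta> (fst u) (snd u)) n = \<zero>\<^bsub>V\<^esub>"
proof -
  interpret V: k_algebra V by fact
  let ?L = "lincomb V (\<lambda>u. \<beta> (fst u) (snd u))"
  note lin = linear_mapsD[OF lincomb_linear[OF V \<beta>]]
  note bil = bilinear_mapD[OF \<beta>]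
  have single: "?L (psingle (a, b) c) = c \<odot>\<^bsub>V\<^esub> \<beta> a b" if "a \<in> carrier A" "b \<in> carrier B" for a b c
    using that bil(1) by (simp add: V.lincomb_single)
  have diff: "?L (p - q) = ?L p \<ominus>\<^bsub>V\<^esub> ?L q" "p - q \<in> carrier (pair_alg A B)"
    if "p \<in> carrier (pair_alg A B)" "q \<in> carrier (pair_alg A B)" for p q
    using linear_map_minus(2)[OF k_algebra_pair_alg V lincomb_linear[OF V \<beta>] that] that null.minus_closed[OF that]
    by (simp_all add: pair_alg_minus)
  have cancel: "(x \<oplus>\<^bsub>V\<^esub> y) \<ominus>\<^bsub>V\<^esub> x \<ominus>\<^bsub>V\<^esub> y = \<zero>\<^bsub>V\<^esub>" if "x \<in> carrier V" "y \<in> carrier V" for x y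
    using V.r_neg[of "x \<oplus>\<^bsub>V\<^esub> y"] that by (simp add: V.minus_eq V.minus_add V.a_assoc)
  \<comment> \<open>Membership in the pair algebra is carried along because \<open>?L\<close> is
    linear only there, while \<open>tensor_null\<close> is a span in the whole type.\<close>
  have "?L n = \<zero>\<^bsub>V\<^esub> \<and> n \<in> carrier (pair_alg A B)"
    using n
  proof (induction rule: tensor_null_induct)
    case zero then show ?case by (simp add: pair_alg_simps)
  next
    case (add p q)
    then show ?case using lin(2)[of p q] null.add.m_closed[of p q] by (simp add: pair_alg_simps)
  next
    case (scale c p)
    then show ?case using lin(3)[of p c] null.sm_closed[of p c] by (simp add: pair_alg_simps)
  next
    case (rel p)
    then show ?case
      by (cases rule: tensor_rels_cases)
        (simp_all add: diff single single_in_pair_alg bil cancel)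
  qed
  then show ?thesis by simp
qed

lemma tensor_lift_linear:
  assumes V: "k_algebra V" and \<beta>: "bilinear_map A B V \<beta>"
  shows "tensor_lift V \<beta> \<in> linear_maps (tensor A B) V"
  unfolding tensor_lift_eq_coset_map tensor_def
  using assms by (intro null.coset_map_linear lincomb_linear lincomb_tensor_null)

lemma tensor_lift_tens:
  assumes V: "k_algebra V" and \<beta>: "bilinear_map A B V \<beta>" and ab: "a \<in> carrier A" "b \<in> carrier B"
  shows "tensor_lift V \<beta> (tens A B a b) = \<beta> a b"
proof -
  interpret V: k_algebra V by fact
  have "tensor_lift V \<beta> (tens A B a b) = lincomb V (\<lambda>u. \<beta> (fst u) (snd u)) (psingle (a, b) 1)"
    unfolding tensor_lift_eq_coset_map tens_def
    by (rule null.coset_map_proj[OF V lincomb_linear[OF V \<beta>] lincomb_tensor_null[OF V \<beta>] single_in_pair_alg[OF ab]])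
  then show ?thesis using bilinear_mapD(1)[OF \<beta> ab] by simp
qed

lemma tensor_linear_ext:
  assumes V: "k_algebra V" and f: "f \<in> linear_maps (tensor A B) V" and g: "g \<in> linear_maps (tensor A B) V"
    and eq: "\<And>a b. a \<in> carrier A \<Longrightarrow> b \<in> carrier B \<Longrightarrow> f (tens A B a b) = g (tens A B a b)"
    and t: "t \<in> carrier (tensor A B)"
  shows "f t = g t"
  using t
proof (induction rule: tensor_induct)
  case zero
  show ?case using linear_map_zero[OF k_algebra_tensor V f] linear_map_zero[OF k_algebra_tensor V g] by simp
next
  case (add a b t)
  then show ?case using linear_mapsD(2)[OF f] linear_mapsD(2)[OF g] eq by (simp add: tens_closed)
qed

text \<open>The two sides of multiplicativity are linear in each tensor. Extending first in the
  right and then in the left argument reduces the claim to pure tensors.\<close>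

lemma tensor_mult_ext:
  assumes V: "k_algebra V" and f: "f \<in> linear_maps (tensor A B) V"
    and eq: "\<And>a b a' b'. a \<in> carrier A \<Longrightarrow> b \<in> carrier B \<Longrightarrow> a' \<in> carrier A \<Longrightarrow> b' \<in> carrier B \<Longrightarrow>
      f (tens A B (a \<otimes>\<^bsub>A\<^esub> a') (b \<otimes>\<^bsub>B\<^esub> b')) = f (tens A B a b) \<otimes>\<^bsub>V\<^esub> f (tens A B a' b')"
    and one: "f (tens A B \<one>\<^bsub>A\<^esub> \<one>\<^bsub>B\<^esub>) = \<one>\<^bsub>V\<^esub>"
  shows "f \<in> alg_hom (tensor A B) V"
proof -
  interpret V: k_algebra V by fact
  interpret T: k_algebra "tensor A B" by (rule k_algebra_tensor)
  note lin = linear_mapsD[OF f]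
  have *: "f (tens A B a b \<otimes>\<^bsub>tensor A B\<^esub> t) = f (tens A B a b) \<otimes>\<^bsub>V\<^esub> f t"
    if "a \<in> carrier A" "b \<in> carrier B" "t \<in> carrier (tensor A B)" for a b t
    using that(3)
  proof (rule tensor_linear_ext[OF V, rotated 3])
    show "(\<lambda>t. f (tens A B a b \<otimes>\<^bsub>tensor A B\<^esub> t)) \<in> linear_maps (tensor A B) V"
      "(\<lambda>t. f (tens A B a b) \<otimes>\<^bsub>V\<^esub> f t) \<in> linear_maps (tensor A B) V"
      using that(1,2) tens_closed
      by (auto intro!: linear_mapsI simp: lin T.r_distr V.r_distr T.smult_mult_right V.smult_mult_right)
  qed (simp add: that tens_mult eq)
  have **: "f (s \<otimes>\<^bsub>tensor A B\<^esub> t) = f s \<otimes>\<^bsub>V\<^esub> f t"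
    if "s \<in> carrier (tensor A B)" "t \<in> carrier (tensor A B)" for s t
    using that(1)
  proof (rule tensor_linear_ext[OF V, rotated 3])
    show "(\<lambda>s. f (s \<otimes>\<^bsub>tensor A B\<^esub> t)) \<in> linear_maps (tensor A B) V"
      "(\<lambda>s. f s \<otimes>\<^bsub>V\<^esub> f t) \<in> linear_maps (tensor A B) V"
      using that(2)
      by (auto intro!: linear_mapsI simp: lin T.l_distr V.l_distr T.smult_mult_left V.smult_mult_left)
  qed (simp add: that *)
  show ?thesis by (rule alg_homI) (simp_all add: lin ** tens_one one)
qed

end

lemmas k_algebra_tensor = two_algebras.k_algebra_tensor[OF two_algebras.intro]
lemmas tens_closed = two_algebras.tens_closed[OF two_algebras.intro]
lemmas tens_bilinear = bilinear_mapD[OF two_algebras.tens_bilinear[OF two_algebras.intro]]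
lemmas tens_mult = two_algebras.tens_mult[OF two_algebras.intro]
lemmas tens_one = two_algebras.tens_one[OF two_algebras.intro]
lemmas tensor_lift_linear = two_algebras.tensor_lift_linear[OF two_algebras.intro]
lemmas tensor_lift_tens = two_algebras.tensor_lift_tens[OF two_algebras.intro]
lemmas tensor_linear_ext = two_algebras.tensor_linear_ext[OF two_algebras.intro]
lemmas tensor_mult_ext = two_algebras.tensor_mult_ext[OF two_algebras.intro]
lemmas tensor_induct = two_algebras.tensor_induct[OF two_algebras.intro, consumes 3, case_names zero add]

section \<open>Functoriality of the tensor product\<close>

context
  fixes A :: "('k::field, 'a, 'm) module_scheme" and B :: "('k, 'b, 'n) module_scheme"
    and C :: "('k, 'c, 'l) module_scheme" and D :: "('k, 'd, 'o) module_scheme"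
  assumes A: "k_algebra A" and B: "k_algebra B" and C: "k_algebra C" and D: "k_algebra D"
begin

lemma tensor_map_bilinear:
  "f \<in> linear_maps C A \<Longrightarrow> g \<in> linear_maps D B \<Longrightarrow> bilinear_map C D (tensor A B) (\<lambda>c d. tens A B (f c) (g d))"
  by (rule bilinear_mapI) (simp_all add: linear_mapsD tens_bilinear[OF A B])

lemma tensor_map_linear:
  "f \<in> linear_maps C A \<Longrightarrow> g \<in> linear_maps D B \<Longrightarrow> tensor_map A B f g \<in> linear_maps (tensor C D) (tensor A B)"
  unfolding tensor_map_def by (intro tensor_lift_linear C D k_algebra_tensor A B tensor_map_bilinear)

lemma tensor_map_tens:
  "f \<in> linear_maps C A \<Longrightarrow> g \<in> linear_maps D B \<Longrightarrow> c \<in> carrier C \<Longrightarrow> d \<in> carrier D \<Longrightarrow>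
    tensor_map A B f g (tens C D c d) = tens A B (f c) (g d)"
  unfolding tensor_map_def by (rule tensor_lift_tens[OF C D k_algebra_tensor[OF A B] tensor_map_bilinear])

lemma tensor_map_hom:
  assumes f: "f \<in> alg_hom C A" and g: "g \<in> alg_hom D B"
  shows "tensor_map A B f g \<in> alg_hom (tensor C D) (tensor A B)"
proof -
  interpret C: k_algebra C by (rule C)
  interpret D: k_algebra D by (rule D)
  note fg = alg_hom_linear[OF f] alg_hom_linear[OF g]
  show ?thesis
    by (rule tensor_mult_ext[OF C D k_algebra_tensor[OF A B] tensor_map_linear[OF fg]])
      (simp_all add: tensor_map_tens[OF fg] alg_homD[OF f] alg_homD[OF g] tens_mult[OF A B] tens_one[OF A B])
qed

end

lemma tensor_map_id:
  assumes "k_algebra A" "k_algebra B" "t \<in> carrier (tensor A B)"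
  shows "tensor_map A B (\<lambda>x. x) (\<lambda>x. x) t = t"
proof -
  have id: "(\<lambda>x. x) \<in> linear_maps A A" "(\<lambda>x. x) \<in> linear_maps B B" "(\<lambda>x. x) \<in> linear_maps (tensor A B) (tensor A B)"
    by (simp_all add: linear_maps_def)
  show ?thesis
    by (rule tensor_linear_ext[OF assms(1,2) k_algebra_tensor[OF assms(1,2)]
          tensor_map_linear[OF assms(1,2,1,2) id(1,2)] id(3) _ assms(3)])
      (rule tensor_map_tens[OF assms(1,2,1,2) id(1,2)])
qed

lemma tensor_map_comp:
  assumes "k_algebra A" "k_algebra B" "k_algebra C" "k_algebra D" "k_algebra E" "k_algebra F"
    and "f \<in> linear_maps A C" "g \<in> linear_maps B D" "f' \<in> linear_maps C E" "g' \<in> linear_maps D F"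
    and t: "t \<in> carrier (tensor A B)"
  shows "tensor_map E F f' g' (tensor_map C D f g t) = tensor_map E F (\<lambda>x. f' (f x)) (\<lambda>x. g' (g x)) t"
proof (rule tensor_linear_ext[OF assms(1,2) k_algebra_tensor[OF assms(5,6)] _ _ _ t])
  note c = linear_maps_comp[OF assms(7,9)] linear_maps_comp[OF assms(8,10)]
  show "(\<lambda>t. tensor_map E F f' g' (tensor_map C D f g t)) \<in> linear_maps (tensor A B) (tensor E F)"
    using assms by (intro linear_maps_comp[OF tensor_map_linear tensor_map_linear])
  show "tensor_map E F (\<lambda>x. f' (f x)) (\<lambda>x. g' (g x)) \<in> linear_maps (tensor A B) (tensor E F)"
    using assms c by (intro tensor_map_linear)
  show "tensor_map E F f' g' (tensor_map C D f g (tens A B a b)) =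
      tensor_map E F (\<lambda>x. f' (f x)) (\<lambda>x. g' (g x)) (tens A B a b)" if "a \<in> carrier A" "b \<in> carrier B" for a b
    using that assms c by (simp add: tensor_map_tens linear_mapsD)
qed

lemma tensor_map_cong:
  assumes "k_algebra A" "k_algebra B" "k_algebra C" "k_algebra D" "f \<in> linear_maps A C" "g \<in> linear_maps B D"
    and "\<And>a. a \<in> carrier A \<Longrightarrow> f' a = f a" "\<And>b. b \<in> carrier B \<Longrightarrow> g' b = g b"
    and t: "t \<in> carrier (tensor A B)"
  shows "tensor_map C D f' g' t = tensor_map C D f g t"
proof -
  have f': "f' \<in> linear_maps A C" by (rule linear_map_cong[OF assms(5,1,7)])
  have g': "g' \<in> linear_maps B D" by (rule linear_map_cong[OF assms(6,2,8)])
  show ?thesis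
    using assms f' g'
    by (intro tensor_linear_ext[OF assms(1,2) k_algebra_tensor[OF assms(3,4)] tensor_map_linear tensor_map_linear _ t])
      (simp_all add: tensor_map_tens)
qed

text \<open>Naturality of the induced map. The counit and antipode axioms all read
  \<open>tensor_lift _ _ (comult _ a) = _\<close>, so this is what transports them along a Hopf
  algebra map.\<close>

lemma tensor_lift_map:
  assumes "k_algebra A" "k_algebra B" "k_algebra C" "k_algebra D" "k_algebra V" "k_algebra W"
    and f: "f \<in> linear_maps A C" "g \<in> linear_maps B D" and \<phi>: "\<phi> \<in> linear_maps V W"
    and \<beta>: "bilinear_map C D W \<beta>" "bilinear_map A B V \<gamma>"
    and eq: "\<And>a b. a \<in> carrier A \<Longrightarrow> b \<in> carrier B \<Longrightarrow> \<beta> (f a) (g b) = \<phi> (\<gamma> a b)"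
    and t: "t \<in> carrier (tensor A B)"
  shows "tensor_lift W \<beta> (tensor_map C D f g t) = \<phi> (tensor_lift V \<gamma> t)"
  using assms(1-11)
  by (intro tensor_linear_ext[OF assms(1,2,6) linear_maps_comp[OF tensor_map_linear tensor_lift_linear]
        linear_maps_comp[OF tensor_lift_linear \<phi>] _ t])
    (simp_all add: tensor_map_tens tensor_lift_tens linear_mapsD eq)

subsection \<open>Associativity of the tensor product\<close>

locale three_algebras = A: k_algebra A + B: k_algebra B + C: k_algebra C
  for A :: "('k::field, 'a, 'm) module_scheme" and B :: "('k, 'b, 'n) module_scheme"
    and C :: "('k, 'c, 'l) module_scheme"
begin

lemmas AA = A.k_algebra_axioms
lemmas BB = B.k_algebra_axioms
lemmas CC = C.k_algebra_axioms
lemmas AB = k_algebra_tensor[OF AA BB]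
lemmas BC = k_algebra_tensor[OF BB CC]
lemmas AB_C = k_algebra_tensor[OF AB CC]
lemmas A_BC = k_algebra_tensor[OF AA BC]

lemma linear_ext_right:
  assumes "k_algebra V" "f \<in> linear_maps (tensor A (tensor B C)) V" "g \<in> linear_maps (tensor A (tensor B C)) V"
    and eq: "\<And>a b c. a \<in> carrier A \<Longrightarrow> b \<in> carrier B \<Longrightarrow> c \<in> carrier C \<Longrightarrow>
      f (tens A (tensor B C) a (tens B C b c)) = g (tens A (tensor B C) a (tens B C b c))"
    and t: "t \<in> carrier (tensor A (tensor B C))"
  shows "f t = g t"
proof (rule tensor_linear_ext[OF AA BC assms(1-3) _ t])
  fix a s assume a: "a \<in> carrier A" and s: "s \<in> carrier (tensor B C)"
  have l: "tens A (tensor B C) a \<in> linear_maps (tensor B C) (tensor A (tensor B C))"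
    using a by (auto intro!: linear_mapsI simp: tens_bilinear[OF AA BC])
  show "f (tens A (tensor B C) a s) = g (tens A (tensor B C) a s)"
    by (rule tensor_linear_ext[OF BB CC assms(1) linear_maps_comp[OF l assms(2)] linear_maps_comp[OF l assms(3)] _ s])
      (rule eq[OF a])
qed

lemma assoc_bilinear_right:
  "a \<in> carrier A \<Longrightarrow> bilinear_map B C (tensor (tensor A B) C) (\<lambda>b c. tens (tensor A B) C (tens A B a b) c)"
  by (rule bilinear_mapI) (simp_all add: tens_bilinear[OF AA BB] tens_bilinear[OF AB CC])

text \<open>The inner lift is linear in the element of B \<otimes> C by construction. Linearity in
  \<open>a\<close> is an equality of two such linear maps, which is checked on pure tensors.\<close>

lemma assoc_bilinear:
  "bilinear_map A (tensor B C) (tensor (tensor A B) C)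
     (\<lambda>a. tensor_lift (tensor (tensor A B) C) (\<lambda>b c. tens (tensor A B) C (tens A B a b) c))"
  (is "bilinear_map _ _ ?T ?\<beta>")
proof -
  interpret T: k_algebra ?T by (rule AB_C)
  note lin = tensor_lift_linear[OF BB CC AB_C assoc_bilinear_right]
  show ?thesis
  proof (rule bilinear_mapI)
    fix a a' s assume a: "a \<in> carrier A" "a' \<in> carrier A" and s: "s \<in> carrier (tensor B C)"
    have l: "(\<lambda>s. ?\<beta> a s \<oplus>\<^bsub>?T\<^esub> ?\<beta> a' s) \<in> linear_maps (tensor B C) ?T"
      by (rule linear_mapsI) (simp_all add: linear_mapsD[OF lin[OF a(1)]] linear_mapsD[OF lin[OF a(2)]] T.sm_r_distr T.a_ac)
    show "?\<beta> (a \<oplus>\<^bsub>A\<^esub> a') s = ?\<beta> a s \<oplus>\<^bsub>?T\<^esub> ?\<beta> a' s"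
      using a by (intro tensor_linear_ext[OF BB CC AB_C lin l _ s])
        (simp_all add: tensor_lift_tens[OF BB CC AB_C assoc_bilinear_right] tens_bilinear[OF AA BB] tens_bilinear[OF AB CC])
  next
    fix a s and k :: 'k assume a: "a \<in> carrier A" and s: "s \<in> carrier (tensor B C)"
    have l: "(\<lambda>s. k \<odot>\<^bsub>?T\<^esub> ?\<beta> a s) \<in> linear_maps (tensor B C) ?T"
      by (rule linear_mapsI) (simp_all add: linear_mapsD[OF lin[OF a(1)]] T.sm_r_distr mult.commute flip: T.sm_assoc)
    show "?\<beta> (k \<odot>\<^bsub>A\<^esub> a) s = k \<odot>\<^bsub>?T\<^esub> ?\<beta> a s"
      using a by (intro tensor_linear_ext[OF BB CC AB_C lin l _ s])
        (simp_all add: tensor_lift_tens[OF BB CC AB_C assoc_bilinear_right] tens_bilinear[OF AA BB] tens_bilinear[OF AB CC])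
  qed (simp_all add: linear_mapsD[OF lin])
qed

lemma tensor_assoc_linear: "tensor_assoc A B C \<in> linear_maps (tensor A (tensor B C)) (tensor (tensor A B) C)"
  unfolding tensor_assoc_def by (rule tensor_lift_linear[OF AA BC AB_C assoc_bilinear])

lemma tensor_assoc_tens_right:
  "a \<in> carrier A \<Longrightarrow> s \<in> carrier (tensor B C) \<Longrightarrow> tensor_assoc A B C (tens A (tensor B C) a s) =
    tensor_lift (tensor (tensor A B) C) (\<lambda>b c. tens (tensor A B) C (tens A B a b) c) s"
  unfolding tensor_assoc_def by (rule tensor_lift_tens[OF AA BC AB_C assoc_bilinear])

lemma tensor_assoc_tens:
  "a \<in> carrier A \<Longrightarrow> b \<in> carrier B \<Longrightarrow> c \<in> carrier C \<Longrightarrow>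
    tensor_assoc A B C (tens A (tensor B C) a (tens B C b c)) = tens (tensor A B) C (tens A B a b) c"
  by (simp add: tensor_assoc_tens_right tens_bilinear[OF BB CC] tensor_lift_tens[OF BB CC AB_C assoc_bilinear_right])

text \<open>With this, both sides of coassociativity are algebra maps, so that coassociativity can
  be checked on algebra generators.\<close>

lemma tensor_assoc_hom: "tensor_assoc A B C \<in> alg_hom (tensor A (tensor B C)) (tensor (tensor A B) C)"
proof (rule tensor_mult_ext[OF AA BC AB_C tensor_assoc_linear])
  interpret T: k_algebra "tensor (tensor A B) C" by (rule AB_C)
  interpret S: k_algebra "tensor B C" by (rule BC)
  let ?a = "tensor_assoc A B C" and ?t = "tens A (tensor B C)" and ?T = "tensor (tensor A B) C"
  note lin = linear_mapsD[OF tensor_assoc_linear]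
  have tlin: "?t a \<in> linear_maps (tensor B C) (tensor A (tensor B C))" if "a \<in> carrier A" for a
    using that by (auto intro!: linear_mapsI simp: tens_bilinear[OF AA BC])
  fix a s a' s' assume *: "a \<in> carrier A" "s \<in> carrier (tensor B C)" "a' \<in> carrier A" "s' \<in> carrier (tensor B C)"
  have aa: "a \<otimes>\<^bsub>A\<^esub> a' \<in> carrier A" using * by simp
  note al = linear_maps_comp[OF tlin tensor_assoc_linear]
  have 1: "?a (?t (a \<otimes>\<^bsub>A\<^esub> a') (tens B C b c \<otimes>\<^bsub>tensor B C\<^esub> s')) = ?a (?t a (tens B C b c)) \<otimes>\<^bsub>?T\<^esub> ?a (?t a' s')"
    if bc: "b \<in> carrier B" "c \<in> carrier C" for b c
  proof (rule tensor_linear_ext[OF BB CC AB_C _ _ _ *(4)])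
    show "(\<lambda>s'. ?a (?t (a \<otimes>\<^bsub>A\<^esub> a') (tens B C b c \<otimes>\<^bsub>tensor B C\<^esub> s'))) \<in> linear_maps (tensor B C) ?T"
      using * bc linear_mapsD[OF al[OF aa]]
      by (intro linear_mapsI) (simp_all add: tens_bilinear[OF BB CC] S.r_distr S.smult_mult_right)
    show "(\<lambda>s'. ?a (?t a (tens B C b c)) \<otimes>\<^bsub>?T\<^esub> ?a (?t a' s')) \<in> linear_maps (tensor B C) ?T"
      using * bc linear_mapsD[OF al[OF *(1)]] linear_mapsD[OF al[OF *(3)]]
      by (intro linear_mapsI) (simp_all add: tens_bilinear[OF BB CC] T.r_distr T.smult_mult_right)
  qed (use * bc in \<open>simp add: tens_mult[OF BB CC] tensor_assoc_tens tens_mult[OF AB CC] tens_mult[OF AA BB] tens_bilinear[OF AA BB]\<close>)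
  show "?a (?t (a \<otimes>\<^bsub>A\<^esub> a') (s \<otimes>\<^bsub>tensor B C\<^esub> s')) = ?a (?t a s) \<otimes>\<^bsub>?T\<^esub> ?a (?t a' s')"
  proof (rule tensor_linear_ext[OF BB CC AB_C _ _ _ *(2)])
    show "(\<lambda>s. ?a (?t (a \<otimes>\<^bsub>A\<^esub> a') (s \<otimes>\<^bsub>tensor B C\<^esub> s'))) \<in> linear_maps (tensor B C) ?T"
      using * linear_mapsD[OF al[OF aa]]
      by (intro linear_mapsI) (simp_all add: S.l_distr S.smult_mult_left)
    show "(\<lambda>s. ?a (?t a s) \<otimes>\<^bsub>?T\<^esub> ?a (?t a' s')) \<in> linear_maps (tensor B C) ?T"
      using * linear_mapsD[OF al[OF *(1)]] linear_mapsD[OF al[OF *(3)]]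
      by (intro linear_mapsI) (simp_all add: T.l_distr T.smult_mult_left)
  qed (rule 1)
next
  show "tensor_assoc A B C (tens A (tensor B C) \<one>\<^bsub>A\<^esub> \<one>\<^bsub>tensor B C\<^esub>) = \<one>\<^bsub>tensor (tensor A B) C\<^esub>"
    by (simp add: tens_one[OF BB CC] tensor_assoc_tens tens_one[OF AB CC] tens_one[OF AA BB])
qed

end

lemma tensor_assoc_natural:
  assumes H: "k_algebra H" and L: "k_algebra L" and f: "f \<in> linear_maps H L"
    and t: "t \<in> carrier (tensor H (tensor H H))"
  shows "tensor_assoc L L L (tensor_map L (tensor L L) f (tensor_map L L f f) t) =
    tensor_map (tensor L L) L (tensor_map L L f f) f (tensor_assoc H H H t)"
proof -
  interpret H: three_algebras H H H by (intro three_algebras.intro H)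
  interpret L: three_algebras L L L by (intro three_algebras.intro L)
  note ff = tensor_map_linear[OF L L H H f f]
  note l1 = tensor_map_linear[OF L L.AB H H.AB f ff] and l2 = tensor_map_linear[OF L.AB L H.AB H ff f]
  show ?thesis
    by (rule H.linear_ext_right[OF L.AB_C linear_maps_comp[OF l1 L.tensor_assoc_linear]
          linear_maps_comp[OF H.tensor_assoc_linear l2] _ t])
      (simp add: tensor_map_tens[OF L L.AB H H.AB f ff] tensor_map_tens[OF L.AB L H.AB H ff f]
          tensor_map_tens[OF L L H H f f] H.tensor_assoc_tens L.tensor_assoc_tens tens_closed[OF H H] linear_mapsD[OF f])
qed

section \<open>Hopf algebra structures on an algebra\<close>

text \<open>Truncation forgets the Hopf structure. All tensor constructions read the algebra fields
  only and so depend on the truncation alone; in this way results on presented algebras apply to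
  \<open>ohn\<close>, \<open>jordan_tilde\<close> and \<open>jordan\<close>.\<close>

lemma truncate_simps [simp]:
  "carrier (module.truncate A) = carrier A" "monoid.mult (module.truncate A) = monoid.mult A"
  "one (module.truncate A) = one A" "ring.zero (module.truncate A) = ring.zero A"
  "add (module.truncate A) = add A" "module.smult (module.truncate A) = module.smult A"
  by (simp_all add: module.truncate_def)

lemma truncate_eqD:
  assumes "module.truncate A = module.truncate B"
  shows "carrier A = carrier B" "monoid.mult A = monoid.mult B" "one A = one B"
    "ring.zero A = ring.zero B" "add A = add B" "module.smult A = module.smult B"
  using assms by (simp_all add: module.truncate_def)

lemma k_algebra_cong:
  assumes "module.truncate A = module.truncate B" "k_algebra A"
  shows "k_algebra B"
proof -
  interpret A: k_algebra A by fact
  note [simp] = truncate_eqD[OF assms(1), symmetric]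
  show ?thesis
    by (rule k_algebraI)
      (simp_all add: A.a_ac A.m_assoc A.l_distr A.r_distr A.sm_l_distr A.sm_r_distr A.sm_assoc
        A.smult_mult_left A.smult_mult_right)
qed

lemma k_algebra_truncate [simp]: "k_algebra (module.truncate A) \<longleftrightarrow> k_algebra A"
  by (auto elim!: k_algebra_cong[rotated] simp: module.truncate_def)

lemma pair_alg_truncate [simp]:
  "pair_alg (module.truncate A) B = pair_alg A B" "pair_alg A (module.truncate B) = pair_alg A B"
  by (simp_all add: pair_alg_def)

lemma tensor_null_truncate [simp]:
  "tensor_null (module.truncate A) B = tensor_null A B" "tensor_null A (module.truncate B) = tensor_null A B"
  by (simp_all add: tensor_null_def tensor_rels_def)

lemma tensor_truncate [simp]:
  "tensor (module.truncate A) B = tensor A B" "tensor A (module.truncate B) = tensor A B"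
  by (simp_all add: tensor_def)

lemma tens_truncate [simp]:
  "tens (module.truncate A) B = tens A B" "tens A (module.truncate B) = tens A B"
  by (simp_all add: tens_def fun_eq_iff)

lemma tensor_lift_truncate [simp]: "tensor_lift (module.truncate V) \<beta> = tensor_lift V \<beta>"
  by (simp add: tensor_lift_def finsum_def finprod_def fun_eq_iff)

lemma tensor_map_truncate [simp]:
  "tensor_map (module.truncate A) B = tensor_map A B" "tensor_map A (module.truncate B) = tensor_map A B"
  by (simp_all add: tensor_map_def fun_eq_iff)

lemma tensor_assoc_truncate [simp]:
  "tensor_assoc (module.truncate A) B C = tensor_assoc A B C" "tensor_assoc A (module.truncate B) C = tensor_assoc A B C"
  "tensor_assoc A B (module.truncate C) = tensor_assoc A B C"
  by (simp_all add: tensor_assoc_def)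

lemma linear_maps_truncate [simp]:
  "linear_maps (module.truncate A) B = linear_maps A B" "linear_maps A (module.truncate B) = linear_maps A B"
  by (simp_all add: linear_maps_def)

lemma alg_hom_truncate [simp]:
  "alg_hom (module.truncate A) B = alg_hom A B" "alg_hom A (module.truncate B) = alg_hom A B"
  by (simp_all add: alg_hom_def ring_hom_def)

text \<open>
  Unlike \<^const>\<open>hopf_algebra\<close>, this predicate does not see the record extension of \<open>A\<close>, so that
  it can be transported between records with the same underlying algebra.
\<close>

locale hopf_data = k_algebra A for A :: "('k::field, 'a, 'm) module_scheme" (structure) +
  fixes \<Delta> :: "'a \<Rightarrow> (('a \<times> 'a) \<Rightarrow>\<^sub>0 'k) set" and \<epsilon> :: "'a \<Rightarrow> 'k" and S :: "'a \<Rightarrow> 'a"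
  assumes comult_hom: "\<Delta> \<in> alg_hom A (tensor A A)"
    and counit_hom: "\<epsilon> \<in> alg_hom A base_alg"
    and antipode_linear: "S \<in> linear_maps A A"
    and coassoc: "a \<in> carrier A \<Longrightarrow>
      tensor_map (tensor A A) A \<Delta> (\<lambda>x. x) (\<Delta> a) = tensor_assoc A A A (tensor_map A (tensor A A) (\<lambda>x. x) \<Delta> (\<Delta> a))"
    and counit_left: "a \<in> carrier A \<Longrightarrow> tensor_lift A (\<lambda>x y. \<epsilon> x \<odot> y) (\<Delta> a) = a"
    and counit_right: "a \<in> carrier A \<Longrightarrow> tensor_lift A (\<lambda>x y. \<epsilon> y \<odot> x) (\<Delta> a) = a"
    and antipode_left: "a \<in> carrier A \<Longrightarrow> tensor_lift A (\<lambda>x y. S x \<otimes> y) (\<Delta> a) = \<epsilon> a \<odot> \<one>"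
    and antipode_right: "a \<in> carrier A \<Longrightarrow> tensor_lift A (\<lambda>x y. x \<otimes> S y) (\<Delta> a) = \<epsilon> a \<odot> \<one>"

lemma hopf_algebra_iff: "hopf_algebra H \<longleftrightarrow> hopf_data H (comult H) (counit H) (antipode H)"
  unfolding hopf_algebra_def hopf_data_def hopf_algebra_axioms_def hopf_data_axioms_def by simp

lemma hopf_data_truncate: "hopf_data (module.truncate A) \<Delta> \<epsilon> S \<longleftrightarrow> hopf_data A \<Delta> \<epsilon> S"
  unfolding hopf_data_def hopf_data_axioms_def by simp

lemma hopf_data_cong:
  "module.truncate A = module.truncate B \<Longrightarrow> hopf_data A \<Delta> \<epsilon> S \<longleftrightarrow> hopf_data B \<Delta> \<epsilon> S"
  using hopf_data_truncate[of A \<Delta> \<epsilon> S] hopf_data_truncate[of B \<Delta> \<epsilon> S] by simp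

lemma k_algebra_base_alg: "k_algebra (base_alg :: ('k::field, 'k) module)"
  by (rule k_algebraI) (simp_all add: algebra_simps)

context k_algebra
begin

lemma counit_bilinear:
  assumes "\<epsilon> \<in> linear_maps A base_alg"
  shows "bilinear_map A A A (\<lambda>x y. \<epsilon> x \<odot> y)" "bilinear_map A A A (\<lambda>x y. \<epsilon> y \<odot> x)"
  using linear_mapsD(2,3)[OF assms]
  by (auto intro!: bilinear_mapI simp: sm_l_distr sm_r_distr sm_assoc simp flip: sm_assoc) (simp_all add: mult.commute)

lemma mult_bilinear:
  assumes "f \<in> linear_maps A A" "g \<in> linear_maps A A"
  shows "bilinear_map A A A (\<lambda>x y. f x \<otimes> g y)"
  by (rule bilinear_mapI)
    (simp_all add: linear_mapsD[OF assms(1)] linear_mapsD[OF assms(2)] l_distr r_distr smult_mult_left smult_mult_right)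

end

lemma id_linear: "(\<lambda>x. x) \<in> linear_maps A A"
  by (simp add: linear_maps_def)

lemma id_hom: "(\<lambda>x. x) \<in> alg_hom A A"
  by (simp add: alg_hom_def id_linear ring_hom_def)

text \<open>The structure maps of a quotient or an image are known only through their values at
  \<open>f a\<close>. As \<open>f\<close> is onto, each law for \<open>g'\<close> is pulled back to
  the law for \<open>g\<close>.\<close>

lemma alg_hom_surj:
  assumes "k_algebra H" and f: "f \<in> alg_hom H L" and surj: "f ` carrier H = carrier L" and g: "g \<in> alg_hom H W"
    and eq: "\<And>a. a \<in> carrier H \<Longrightarrow> g' (f a) = g a"
  shows "g' \<in> alg_hom L W"
proof -
  interpret H: k_algebra H by fact
  have e: "\<exists>a\<in>carrier H. x = f a" if "x \<in> carrier L" for x using surj that by auto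
  note f' = alg_homD[OF f] and g' = alg_homD[OF g]
  show ?thesis
  proof (rule alg_homI)
    show "g' a \<in> carrier W" if "a \<in> carrier L" for a using e[OF that] by (auto simp: eq g')
    show "g' (a \<oplus>\<^bsub>L\<^esub> b) = g' a \<oplus>\<^bsub>W\<^esub> g' b" if ab: "a \<in> carrier L" "b \<in> carrier L" for a b
    proof -
      obtain x where x: "x \<in> carrier H" "a = f x" using e[OF ab(1)] by blast
      obtain y where y: "y \<in> carrier H" "b = f y" using e[OF ab(2)] by blast
      show ?thesis
        unfolding x(2) y(2) f'(2)[OF x(1) y(1), symmetric] eq[OF x(1)] eq[OF y(1)] eq[OF H.add.m_closed[OF x(1) y(1)]]
        by (rule g'(2)[OF x(1) y(1)])
    qed
    show "g' (a \<otimes>\<^bsub>L\<^esub> b) = g' a \<otimes>\<^bsub>W\<^esub> g' b" if ab: "a \<in> carrier L" "b \<in> carrier L" for a b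
    proof -
      obtain x where x: "x \<in> carrier H" "a = f x" using e[OF ab(1)] by blast
      obtain y where y: "y \<in> carrier H" "b = f y" using e[OF ab(2)] by blast
      show ?thesis
        unfolding x(2) y(2) f'(4)[OF x(1) y(1), symmetric] eq[OF x(1)] eq[OF y(1)] eq[OF H.m_closed[OF x(1) y(1)]]
        by (rule g'(4)[OF x(1) y(1)])
    qed
    show "g' (c \<odot>\<^bsub>L\<^esub> a) = c \<odot>\<^bsub>W\<^esub> g' a" if a: "a \<in> carrier L" for c a
    proof -
      obtain x where x: "x \<in> carrier H" "a = f x" using e[OF a] by blast
      show ?thesis unfolding x(2) f'(3)[OF x(1), symmetric] eq[OF x(1)] eq[OF H.sm_closed[OF x(1)]]
        by (rule g'(3)[OF x(1)])
    qed
    show "g' \<one>\<^bsub>L\<^esub> = \<one>\<^bsub>W\<^esub>" using eq[OF H.one_closed] by (simp add: f'(5) g'(5))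
  qed
qed

lemma linear_map_surj:
  assumes "k_algebra H" and f: "f \<in> linear_maps H L" and surj: "f ` carrier H = carrier L" and g: "g \<in> linear_maps H W"
    and eq: "\<And>a. a \<in> carrier H \<Longrightarrow> g' (f a) = g a"
  shows "g' \<in> linear_maps L W"
proof -
  interpret H: k_algebra H by fact
  have e: "\<exists>a\<in>carrier H. x = f a" if "x \<in> carrier L" for x using surj that by auto
  note f' = linear_mapsD[OF f] and g' = linear_mapsD[OF g]
  show ?thesis
  proof (rule linear_mapsI)
    show "g' a \<in> carrier W" if "a \<in> carrier L" for a using e[OF that] by (auto simp: eq g')
    show "g' (a \<oplus>\<^bsub>L\<^esub> b) = g' a \<oplus>\<^bsub>W\<^esub> g' b" if ab: "a \<in> carrier L" "b \<in> carrier L" for a b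
    proof -
      obtain x where x: "x \<in> carrier H" "a = f x" using e[OF ab(1)] by blast
      obtain y where y: "y \<in> carrier H" "b = f y" using e[OF ab(2)] by blast
      show ?thesis
        unfolding x(2) y(2) f'(2)[OF x(1) y(1), symmetric] eq[OF x(1)] eq[OF y(1)] eq[OF H.add.m_closed[OF x(1) y(1)]]
        by (rule g'(2)[OF x(1) y(1)])
    qed
    show "g' (c \<odot>\<^bsub>L\<^esub> a) = c \<odot>\<^bsub>W\<^esub> g' a" if a: "a \<in> carrier L" for c a
    proof -
      obtain x where x: "x \<in> carrier H" "a = f x" using e[OF a] by blast
      show ?thesis unfolding x(2) f'(3)[OF x(1), symmetric] eq[OF x(1)] eq[OF H.sm_closed[OF x(1)]]
        by (rule g'(3)[OF x(1)])
    qed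
  qed
qed

text \<open>This serves twice: for the projection onto a quotient by a Hopf ideal, and for an
  embedding regarded as a map onto its image.\<close>

lemma hopf_data_image:
  assumes "hopf_data H \<Delta> \<epsilon> S" and L: "k_algebra L"
    and f: "f \<in> alg_hom H L" and surj: "f ` carrier H = carrier L"
    and \<Delta>: "\<And>a. a \<in> carrier H \<Longrightarrow> \<Delta>' (f a) = tensor_map L L f f (\<Delta> a)"
    and \<epsilon>: "\<And>a. a \<in> carrier H \<Longrightarrow> \<epsilon>' (f a) = \<epsilon> a"
    and S: "\<And>a. a \<in> carrier H \<Longrightarrow> S' (f a) = f (S a)"
  shows "hopf_data L \<Delta>' \<epsilon>' S'"
proof -
  interpret H: hopf_data H \<Delta> \<epsilon> S by fact
  interpret L: k_algebra L by fact
  note HH = H.k_algebra_axioms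
  let ?F = "tensor_map L L f f"
  note fl = alg_hom_linear[OF f] and \<Delta>l = alg_hom_linear[OF H.comult_hom]
  note TL = k_algebra_tensor[OF L L] and TH = k_algebra_tensor[OF HH HH]
  have F: "?F \<in> alg_hom (tensor H H) (tensor L L)" by (rule tensor_map_hom[OF L L HH HH f f])
  note Fl = alg_hom_linear[OF F]
  have \<Delta>'h: "\<Delta>' \<in> alg_hom L (tensor L L)"
    by (rule alg_hom_surj[OF HH f surj alg_hom_comp[OF H.comult_hom F] \<Delta>])
  note \<Delta>'l = alg_hom_linear[OF \<Delta>'h]
  have \<epsilon>'h: "\<epsilon>' \<in> alg_hom L base_alg" by (rule alg_hom_surj[OF HH f surj H.counit_hom \<epsilon>])
  have S'l: "S' \<in> linear_maps L L"
    by (rule linear_map_surj[OF HH fl surj linear_maps_comp[OF H.antipode_linear fl] S])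
  have e: "\<exists>a\<in>carrier H. x = f a" if "x \<in> carrier L" for x using surj that by auto
  \<comment> \<open>Both sides are f \<otimes> f \<otimes> f applied to the two sides of
    coassociativity in \<open>H\<close>. The chain moves \<open>f\<close> outwards, applies the
    axiom and naturality of the associator, and moves \<open>f\<close> back in.\<close>
  have co: "tensor_map (tensor L L) L \<Delta>' (\<lambda>x. x) (\<Delta>' (f a)) =
    tensor_assoc L L L (tensor_map L (tensor L L) (\<lambda>x. x) \<Delta>' (\<Delta>' (f a)))" if a: "a \<in> carrier H" for a
  proof -
    have d: "\<Delta> a \<in> carrier (tensor H H)" using linear_mapsD(1)[OF \<Delta>l a] .
    note comp = linear_maps_comp[OF \<Delta>l Fl]
    have "tensor_map (tensor L L) L \<Delta>' (\<lambda>x. x) (\<Delta>' (f a)) = tensor_map (tensor L L) L (\<lambda>x. \<Delta>' (f x)) f (\<Delta> a)"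
      unfolding \<Delta>[OF a] by (rule tensor_map_comp[OF HH HH L L TL L fl fl \<Delta>'l id_linear d])
    also have "\<dots> = tensor_map (tensor L L) L (\<lambda>x. ?F (\<Delta> x)) f (\<Delta> a)"
      by (rule tensor_map_cong[OF HH HH TL L comp fl \<Delta> refl d])
    also have "\<dots> = tensor_map (tensor L L) L ?F f (tensor_map (tensor H H) H \<Delta> (\<lambda>x. x) (\<Delta> a))"
      by (rule tensor_map_comp[OF HH HH TH HH TL L \<Delta>l id_linear Fl fl d, symmetric])
    also have "\<dots> = tensor_assoc L L L (tensor_map L (tensor L L) f ?F (tensor_map H (tensor H H) (\<lambda>x. x) \<Delta> (\<Delta> a)))"
      unfolding H.coassoc[OF a]
      by (rule tensor_assoc_natural[OF HH L fl linear_mapsD(1)[OF tensor_map_linear[OF HH TH HH HH id_linear \<Delta>l] d], symmetric])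
    also have "tensor_map L (tensor L L) f ?F (tensor_map H (tensor H H) (\<lambda>x. x) \<Delta> (\<Delta> a)) =
        tensor_map L (tensor L L) f (\<lambda>x. ?F (\<Delta> x)) (\<Delta> a)"
      by (rule tensor_map_comp[OF HH HH HH TH L TL id_linear \<Delta>l fl Fl d])
    also have "\<dots> = tensor_map L (tensor L L) f (\<lambda>x. \<Delta>' (f x)) (\<Delta> a)"
      by (rule tensor_map_cong[OF HH HH L TL fl comp refl \<Delta> d, symmetric])
    also have "\<dots> = tensor_map L (tensor L L) (\<lambda>x. x) \<Delta>' (\<Delta>' (f a))"
      unfolding \<Delta>[OF a] by (rule tensor_map_comp[OF HH HH L L L TL fl fl id_linear \<Delta>'l d, symmetric])
    finally show ?thesis .
  qed
  \<comment> \<open>The common form of the remaining four axioms: each is the image under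
    \<open>f\<close> of the same axiom in \<open>H\<close>.\<close>
  have lift: "tensor_lift L \<beta> (\<Delta>' (f a)) = f (tensor_lift H \<gamma> (\<Delta> a))"
    if "a \<in> carrier H" "bilinear_map L L L \<beta>" "bilinear_map H H H \<gamma>"
      "\<And>x y. x \<in> carrier H \<Longrightarrow> y \<in> carrier H \<Longrightarrow> \<beta> (f x) (f y) = f (\<gamma> x y)" for a \<beta> \<gamma>
    unfolding \<Delta>[OF that(1)]
    by (rule tensor_lift_map[OF HH HH L L HH L fl fl fl that(2-4) linear_mapsD(1)[OF \<Delta>l that(1)]])
  note eH = alg_hom_linear[OF H.counit_hom] and eL = alg_hom_linear[OF \<epsilon>'h]
  show ?thesis
  proof (intro hopf_data.intro L hopf_data_axioms.intro \<Delta>'h \<epsilon>'h S'l)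
    fix x assume "x \<in> carrier L"
    then obtain a where a: "a \<in> carrier H" "x = f a" using e by blast
    show "tensor_map (tensor L L) L \<Delta>' (\<lambda>x. x) (\<Delta>' x) = tensor_assoc L L L (tensor_map L (tensor L L) (\<lambda>x. x) \<Delta>' (\<Delta>' x))"
      unfolding a(2) by (rule co[OF a(1)])
    show "tensor_lift L (\<lambda>x y. \<epsilon>' x \<odot>\<^bsub>L\<^esub> y) (\<Delta>' x) = x"
      unfolding a(2) using a(1) \<epsilon> H.counit_left alg_homD(3)[OF f]
      by (subst lift[OF a(1) L.counit_bilinear(1)[OF eL] H.counit_bilinear(1)[OF eH]]) simp_all
    show "tensor_lift L (\<lambda>x y. \<epsilon>' y \<odot>\<^bsub>L\<^esub> x) (\<Delta>' x) = x"
      unfolding a(2) using a(1) \<epsilon> H.counit_right alg_homD(3)[OF f]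
      by (subst lift[OF a(1) L.counit_bilinear(2)[OF eL] H.counit_bilinear(2)[OF eH]]) simp_all
    show "tensor_lift L (\<lambda>x y. S' x \<otimes>\<^bsub>L\<^esub> y) (\<Delta>' x) = \<epsilon>' x \<odot>\<^bsub>L\<^esub> \<one>\<^bsub>L\<^esub>"
      unfolding a(2) using a(1) \<epsilon> S H.antipode_left alg_homD[OF f] linear_mapsD(1)[OF H.antipode_linear]
      by (subst lift[OF a(1) L.mult_bilinear[OF S'l id_linear] H.mult_bilinear[OF H.antipode_linear id_linear]]) simp_all
    show "tensor_lift L (\<lambda>x y. x \<otimes>\<^bsub>L\<^esub> S' y) (\<Delta>' x) = \<epsilon>' x \<odot>\<^bsub>L\<^esub> \<one>\<^bsub>L\<^esub>"
      unfolding a(2) using a(1) \<epsilon> S H.antipode_right alg_homD[OF f] linear_mapsD(1)[OF H.antipode_linear]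
      by (subst lift[OF a(1) L.mult_bilinear[OF id_linear S'l] H.mult_bilinear[OF id_linear H.antipode_linear]]) simp_all
  qed
qed

section \<open>Free algebras and presentations\<close>

lemma free_alg_simps [simp]:
  "carrier free_alg = UNIV" "p \<otimes>\<^bsub>free_alg\<^esub> q = p * q" "p \<oplus>\<^bsub>free_alg\<^esub> q = p + q"
  "\<one>\<^bsub>free_alg\<^esub> = 1" "\<zero>\<^bsub>free_alg\<^esub> = 0" "c \<odot>\<^bsub>free_alg\<^esub> p = cst c * p"
  by (simp_all add: free_alg_def)

lemma cst_mult_eq_scale: "cst c * p = pscale c p"
  unfolding cst_def using mult_map_scale_conv_mult[of c p] by (simp add: zero_list_def)

lemma cst_simps [simp]:
  "cst 0 = 0" "cst 1 = 1"
  by (simp_all add: cst_def) (simp flip: single_one add: zero_list_def)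

lemma cst_add: "cst (c + d) = cst c + cst d"
  by (simp add: cst_def single_add)

lemma cst_mult: "cst (c * d) = cst c * cst d"
  by (simp add: cst_def mult_single plus_list_def)

lemma mult_cst: "p * cst c = cst c * p"
  by (induction p rule: keys_induct_UNIV)
    (simp_all add: cst_def distrib_left distrib_right mult_single plus_list_def mult.commute)

lemma mult_cst_left: "p * (cst c * q) = cst c * (p * q)"
  using mult_cst[of p c] by (simp flip: mult.assoc)

lemma k_algebra_free_alg: "k_algebra (free_alg :: ('k::field, ('g, 'k) free) module)"
proof (rule k_algebraI, goal_cases)
  case 20
  then show ?case by (simp only: free_alg_simps mult_cst_left)
qed (simp_all add: distrib_left distrib_right mult.assoc add.assoc add.commute cst_add cst_mult)

lemma free_alg_minus [simp]: "\<ominus>\<^bsub>free_alg\<^esub> p = - p" "p \<ominus>\<^bsub>free_alg\<^esub> q = p - q"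
  for p q :: "('g, 'k::field) free"
proof -
  interpret F: k_algebra "free_alg :: ('k, ('g, 'k) free) module" by (rule k_algebra_free_alg)
  show m: "\<ominus>\<^bsub>free_alg\<^esub> p = - p" for p :: "('g, 'k) free"
    using F.r_neg[of p] by (simp add: eq_neg_iff_add_eq_0 add.commute)
  show "p \<ominus>\<^bsub>free_alg\<^esub> q = p - q" by (simp add: F.minus_eq m)
qed

lemma one_free: "1 = psingle [] (1::'k::field)"
  using single_one[where ?'a = "'g list" and ?'b = 'k] by (simp add: zero_list_def)

lemma single_Cons: "psingle (x # w) c = gen x * psingle w (c::'k::field)"
  by (simp add: gen_def mult_single plus_list_def)

text \<open>Words grow by one generator on the left. This suits properties that are not equations of
  algebra maps but still pass from \<open>p\<close> to \<open>gen x * p\<close>, such as the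
  antipode axioms.\<close>

lemma free_induct [case_names one gen_mult add cst_mult]:
  fixes p :: "('g, 'k::field) free"
  assumes "P 1" "\<And>x p. P p \<Longrightarrow> P (gen x * p)" "\<And>p q. P p \<Longrightarrow> P q \<Longrightarrow> P (p + q)" "\<And>c p. P p \<Longrightarrow> P (cst c * p)"
  shows "P p"
proof -
  have w: "P (psingle w 1)" for w
    using assms(1,2) by (induction w) (auto simp: single_Cons simp flip: single_one zero_list_def)
  have "psingle w c = cst c * psingle w 1" for w c
    by (simp add: cst_def mult_single plus_list_def)
  then have s: "P (psingle w c)" for w c using assms(4) w by metis
  have "P 0" using assms(4)[of 1 0] assms(1) by simp
  then show ?thesis by (induction p rule: keys_induct_UNIV) (auto intro: assms(3) s)
qed

lemma free_eval_eq_lincomb: "free_eval A \<phi> = lincomb A (\<lambda>w. foldr (\<lambda>x a. \<phi> x \<otimes>\<^bsub>A\<^esub> a) w \<one>\<^bsub>A\<^esub>)"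
  by (rule ext) (simp add: free_eval_def lincomb_def)

context k_algebra
begin

context
  fixes \<phi> :: "'g \<Rightarrow> 'a"
  assumes \<phi>: "\<And>x. \<phi> x \<in> carrier A"
begin

lemma word_closed: "foldr (\<lambda>x a. \<phi> x \<otimes> a) w \<one> \<in> carrier A"
  by (induction w) (simp_all add: \<phi>)

lemma word_append:
  "foldr (\<lambda>x a. \<phi> x \<otimes> a) (v @ w) \<one> = foldr (\<lambda>x a. \<phi> x \<otimes> a) v \<one> \<otimes> foldr (\<lambda>x a. \<phi> x \<otimes> a) w \<one>"
  by (induction v) (simp_all add: \<phi> m_assoc word_closed del: foldr_append)

lemma free_eval_hom: "free_eval A \<phi> \<in> alg_hom free_alg A"
proof (rule alg_homI)
  let ?e = "free_eval A \<phi>"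
  show c: "?e p \<in> carrier A" for p
    unfolding free_eval_eq_lincomb using word_closed by blast
  have add: "?e (p + q) = ?e p \<oplus> ?e q" for p q
    unfolding free_eval_eq_lincomb by (rule lincomb_add[of _ UNIV]) (auto simp: word_closed)
  then show "?e (p \<oplus>\<^bsub>free_alg\<^esub> q) = ?e p \<oplus> ?e q" for p q by simp
  show "?e (k \<odot>\<^bsub>free_alg\<^esub> p) = k \<odot> ?e p" for k p
    unfolding free_eval_eq_lincomb free_alg_simps cst_mult_eq_scale
    by (rule lincomb_scale[of _ UNIV]) (auto simp: word_closed)
  define E where "E w = foldr (\<lambda>x a. \<phi> x \<otimes> a) w \<one>" for w
  have E: "E w \<in> carrier A" "E (v @ w) = E v \<otimes> E w" "E [] = \<one>" for v w
    by (simp_all add: E_def word_closed word_append del: foldr_append)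
  have s: "?e (psingle w k) = k \<odot> E w" for w k
    unfolding free_eval_eq_lincomb E_def by (rule lincomb_single) (rule word_closed)
  show "?e \<one>\<^bsub>free_alg\<^esub> = \<one>" using s[of "[]" 1] by (simp add: one_free E)
  have z: "?e 0 = \<zero>" unfolding free_eval_eq_lincomb by simp
  have m1: "?e (psingle w k * q) = ?e (psingle w k) \<otimes> ?e q" for w k q
    by (induction q rule: keys_induct_UNIV)
      (simp_all add: distrib_left add z c r_distr s mult_single plus_list_def E
        smult_mult_left smult_mult_right mult.commute flip: sm_assoc)
  have "?e (p * q) = ?e p \<otimes> ?e q" for p q
    by (induction p rule: keys_induct_UNIV) (simp_all add: distrib_right add z c l_distr m1)
  then show "?e (p \<otimes>\<^bsub>free_alg\<^esub> q) = ?e p \<otimes> ?e q" for p q by simp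
qed

lemma free_eval_gen: "free_eval A \<phi> (gen x) = \<phi> x"
  unfolding free_eval_eq_lincomb gen_def using \<phi> by (subst lincomb_single) simp_all

end

lemma free_hom_simps:
  assumes f: "f \<in> alg_hom free_alg A"
  shows "f p \<in> carrier A" "f (p + q) = f p \<oplus> f q" "f (p * q) = f p \<otimes> f q" "f 1 = \<one>" "f 0 = \<zero>"
    "f (- p) = \<ominus> f p" "f (p - q) = f p \<ominus> f q" "f (cst c * p) = c \<odot> f p" "f (cst c) = c \<odot> \<one>"
proof -
  interpret F: k_algebra free_alg by (rule k_algebra_free_alg)
  note h = alg_homD[OF f, simplified]
  note l = linear_map_minus[OF k_algebra_free_alg k_algebra_axioms alg_hom_linear[OF f], simplified]
  show "f p \<in> carrier A" "f (p + q) = f p \<oplus> f q" "f (p * q) = f p \<otimes> f q" "f 1 = \<one>" "f (cst c * p) = c \<odot> f p"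
    by (rule h)+
  show "f 0 = \<zero>"
    using linear_map_zero[OF k_algebra_free_alg k_algebra_axioms alg_hom_linear[OF f]] by simp
  show "f (- p) = \<ominus> f p" using l(1)[of p] by simp
  show "f (p - q) = f p \<ominus> f q" using l(2)[of p q] by simp
  show "f (cst c) = c \<odot> \<one>" using h(3)[of c 1] h(5) by simp
qed

lemma alg_hom_free_ext:
  assumes f: "f \<in> alg_hom free_alg A" and g: "g \<in> alg_hom free_alg A" and eq: "\<And>x. f (gen x) = g (gen x)"
  shows "f p = g p"
  by (induction p rule: free_induct) (simp_all add: free_hom_simps[OF f] free_hom_simps[OF g] eq)

end

interpretation free: k_algebra free_alg
  by (rule k_algebra_free_alg)

subsection \<open>Substitutions\<close>

abbreviation subst :: "('g \<Rightarrow> ('h, 'k::field) free) \<Rightarrow> ('g, 'k) free \<Rightarrow> ('h, 'k) free" where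
  "subst \<equiv> free_eval free_alg"

lemma subst_hom: "subst d \<in> alg_hom free_alg free_alg"
  by (rule free.free_eval_hom) simp

lemma subst_simps [simp]:
  "subst d (p + q) = subst d p + subst d q" "subst d (p * q) = subst d p * subst d q" "subst d 1 = 1"
  "subst d 0 = 0" "subst d (- p) = - subst d p" "subst d (p - q) = subst d p - subst d q"
  "subst d (cst c) = cst c" "subst d (gen x) = d x"
  using free.free_hom_simps[OF subst_hom, of d] by (simp_all add: free.free_eval_gen)

text \<open>An evaluation at elements \<open>f (d x)\<close> factors through a substitution in a
  free algebra. A condition on values in the target becomes one on noncommutative
  polynomials.\<close>

lemma free_eval_subst:
  assumes A: "k_algebra A" and f: "f \<in> alg_hom free_alg A"
  shows "free_eval A (\<lambda>x. f (d x)) p = f (subst d p)"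
proof -
  interpret A: k_algebra A by fact
  have c: "f (d x) \<in> carrier A" for x by (rule A.free_hom_simps[OF f])
  show ?thesis
    by (rule A.alg_hom_free_ext[OF A.free_eval_hom[OF c] alg_hom_comp[OF subst_hom f]]) (simp add: A.free_eval_gen[OF c])
qed

lemma op_alg_simps [simp]:
  "carrier (op_alg A) = carrier A" "a \<otimes>\<^bsub>op_alg A\<^esub> b = b \<otimes>\<^bsub>A\<^esub> a" "a \<oplus>\<^bsub>op_alg A\<^esub> b = a \<oplus>\<^bsub>A\<^esub> b"
  "\<one>\<^bsub>op_alg A\<^esub> = \<one>\<^bsub>A\<^esub>" "\<zero>\<^bsub>op_alg A\<^esub> = \<zero>\<^bsub>A\<^esub>" "c \<odot>\<^bsub>op_alg A\<^esub> a = c \<odot>\<^bsub>A\<^esub> a"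
  by (simp_all add: op_alg_def)

lemma k_algebra_op_alg: "k_algebra A \<Longrightarrow> k_algebra (op_alg A)"
proof -
  assume "k_algebra A"
  then interpret A: k_algebra A .
  show ?thesis
    by (rule k_algebraI)
      (simp_all add: A.a_ac A.m_assoc A.l_distr A.r_distr A.sm_l_distr A.sm_r_distr A.sm_assoc
        A.smult_mult_left A.smult_mult_right)
qed

lemma op_alg_hom: "f \<in> alg_hom A B \<Longrightarrow> f \<in> alg_hom (op_alg A) (op_alg B)"
  by (rule alg_homI) (simp_all add: alg_homD)

abbreviation op_subst :: "('g \<Rightarrow> ('h, 'k::field) free) \<Rightarrow> ('g, 'k) free \<Rightarrow> ('h, 'k) free" where
  "op_subst \<equiv> free_eval (op_alg free_alg)"

lemma op_subst_hom: "op_subst d \<in> alg_hom free_alg (op_alg free_alg)"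
  by (rule k_algebra.free_eval_hom[OF k_algebra_op_alg[OF k_algebra_free_alg]]) simp

lemma op_subst_simps [simp]:
  "op_subst d (p + q) = op_subst d p + op_subst d q" "op_subst d (p * q) = op_subst d q * op_subst d p" "op_subst d 1 = 1"
  "op_subst d 0 = 0" "op_subst d (- p) = - op_subst d p" "op_subst d (p - q) = op_subst d p - op_subst d q"
  "op_subst d (cst c) = cst c" "op_subst d (gen x) = d x"
proof -
  interpret O: k_algebra "op_alg free_alg :: ('b, ('a, 'b) free) module"
    by (rule k_algebra_op_alg[OF k_algebra_free_alg])
  note s = O.free_hom_simps[OF op_subst_hom[of d]]
  show "op_subst d (p + q) = op_subst d p + op_subst d q" "op_subst d (p * q) = op_subst d q * op_subst d p" "op_subst d 1 = 1"
    "op_subst d 0 = 0" "op_subst d (cst c) = cst c"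
    using s by simp_all
  show "op_subst d (gen x) = d x" by (rule O.free_eval_gen) simp
  show m: "op_subst d (- p) = - op_subst d p" for p
    using s(2)[of p "- p"] s(5) by (simp add: eq_neg_iff_add_eq_0 add.commute)
  show "op_subst d (p - q) = op_subst d p - op_subst d q"
    using s(2)[of p "- q"] m[of q] by simp
qed

lemma free_eval_op_subst:
  assumes A: "k_algebra A" and f: "f \<in> alg_hom free_alg A"
  shows "free_eval (op_alg A) (\<lambda>x. f (d x)) p = f (op_subst d p)"
proof -
  interpret A: k_algebra A by fact
  interpret O: k_algebra "op_alg A" by (rule k_algebra_op_alg[OF A])
  have c: "f (d x) \<in> carrier (op_alg A)" for x using A.free_hom_simps[OF f] by simp
  show ?thesis
    by (rule O.alg_hom_free_ext[OF O.free_eval_hom[OF c] alg_hom_comp[OF op_subst_hom op_alg_hom[OF f]]])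
      (simp add: O.free_eval_gen[OF c])
qed

subsection \<open>Presented algebras\<close>

abbreviation rel_ideal :: "('g, 'k::field) free set \<Rightarrow> ('g, 'k) free set" where
  "rel_ideal R \<equiv> Idl\<^bsub>free_alg\<^esub> R"

lemma alg_ideal_Idl: "alg_ideal free_alg (rel_ideal R)"
  by (simp add: alg_ideal_def free.genideal_ideal k_algebra_free_alg)

lemmas ideal_Idl = free.genideal_ideal[of R for R, simplified]

lemma Idl_base: "r \<in> R \<Longrightarrow> r \<in> rel_ideal R"
  using free.genideal_self[of R] by auto

lemma k_algebra_pres_alg: "k_algebra (pres_alg R)"
  unfolding pres_alg_def by (rule alg_ideal.k_algebra_alg_quot[OF alg_ideal_Idl])

lemma pres_class_hom: "pres_class R \<in> alg_hom free_alg (pres_alg R)"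
  unfolding pres_alg_def pres_class_def[abs_def] by (rule alg_ideal.proj_hom[OF alg_ideal_Idl])

lemma pres_class_eq_zero_iff: "pres_class R p = \<zero>\<^bsub>pres_alg R\<^esub> \<longleftrightarrow> p \<in> rel_ideal R"
  unfolding pres_alg_def pres_class_def by (rule alg_ideal.proj_eq_zero_iff[OF alg_ideal_Idl]) simp

lemma pres_class_eq_iff: "pres_class R p = pres_class R q \<longleftrightarrow> p - q \<in> rel_ideal R"
  unfolding pres_class_def using alg_ideal.proj_eq_iff[OF alg_ideal_Idl, of p q] by simp

lemma pres_alg_carrier: "a \<in> carrier (pres_alg R) \<longleftrightarrow> (\<exists>p. a = pres_class R p)"
  unfolding pres_alg_def pres_class_def using alg_ideal.proj_carrier[OF alg_ideal_Idl] by auto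

lemma free_hom_Idl_zero:
  assumes "k_algebra B" "f \<in> alg_hom free_alg B" "\<And>r. r \<in> R \<Longrightarrow> f r = \<zero>\<^bsub>B\<^esub>" "p \<in> rel_ideal R"
  shows "f p = \<zero>\<^bsub>B\<^esub>"
  by (rule alg_hom_genideal_zero[OF k_algebra_free_alg assms(1,2) _ assms(3,4)]) auto

context
  fixes B :: "('k::field, 'b, 'm) module_scheme" and f :: "('g, 'k) free \<Rightarrow> 'b" and R
  assumes B: "k_algebra B" and f: "f \<in> alg_hom free_alg B" and R: "\<And>r. r \<in> R \<Longrightarrow> f r = \<zero>\<^bsub>B\<^esub>"
begin

lemma pres_lift_class: "coset_map f (pres_class R p) = f p"
  unfolding pres_class_def
  by (rule alg_ideal.coset_map_proj[OF alg_ideal_Idl B alg_hom_linear[OF f] free_hom_Idl_zero[OF B f R]]) simp_all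

lemma pres_lift_hom: "coset_map f \<in> alg_hom (pres_alg R) B"
  unfolding pres_alg_def by (rule alg_ideal.coset_map_hom[OF alg_ideal_Idl B f free_hom_Idl_zero[OF B f R]])

end

lemma alg_hom_pres_ext:
  assumes B: "k_algebra B" and f: "f \<in> alg_hom (pres_alg R) B" and g: "g \<in> alg_hom (pres_alg R) B"
    and eq: "\<And>x. f (pres_class R (gen x)) = g (pres_class R (gen x))" and a: "a \<in> carrier (pres_alg R)"
  shows "f a = g a"
proof -
  interpret B: k_algebra B by fact
  obtain p where p: "a = pres_class R p" using a pres_alg_carrier by blast
  show ?thesis unfolding p
    using eq by (rule B.alg_hom_free_ext[OF alg_hom_comp[OF pres_class_hom f] alg_hom_comp[OF pres_class_hom g]])
qed

section \<open>Hopf algebras presented by generators and relations\<close>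

context
  fixes A :: "('k::field, 'a) module" (structure)
  assumes K: "k_algebra A"
begin

interpretation k_algebra A by (rule K)

text \<open>If \<open>t\<close> is a sum of t1 \<otimes> t2, then antimultiplicativity gives
  \<open>S (t1 x) t2 y = S x (S t1 t2) y\<close>. The inner factor sums to the scalar
  \<open>c\<close>, which can be pulled out.\<close>

lemma mult_op_left_tensor:
  assumes S: "S \<in> alg_hom A (op_alg A)" and t: "t \<in> carrier (tensor A A)" and u: "u \<in> carrier (tensor A A)"
    and eq: "tensor_lift A (\<lambda>x y. S x \<otimes> y) t = c \<odot> \<one>"
  shows "tensor_lift A (\<lambda>x y. S x \<otimes> y) (t \<otimes>\<^bsub>tensor A A\<^esub> u) = c \<odot> tensor_lift A (\<lambda>x y. S x \<otimes> y) u"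
proof -
  note s = alg_homD[OF S, simplified]
  have Sl: "S \<in> linear_maps A A" by (rule linear_mapsI) (simp_all add: s)
  interpret T: k_algebra "tensor A A" by (rule k_algebra_tensor[OF K K])
  let ?L = "tensor_lift A (\<lambda>x y. S x \<otimes> y)"
  note b = mult_bilinear[OF Sl id_linear]
  note Ll = tensor_lift_linear[OF K K K b]
  note l = linear_mapsD[OF Ll] and lt = tensor_lift_tens[OF K K K b]
  note tc = tens_closed[OF K K] and tm = tens_mult[OF K K]
  have 1: "?L (t \<otimes>\<^bsub>tensor A A\<^esub> tens A A x y) = S x \<otimes> ?L t \<otimes> y" if xy: "x \<in> carrier A" "y \<in> carrier A" for x y
  proof (rule tensor_linear_ext[OF K K K _ _ _ t])
    show "(\<lambda>t. ?L (t \<otimes>\<^bsub>tensor A A\<^esub> tens A A x y)) \<in> linear_maps (tensor A A) A"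
      using xy by (intro linear_mapsI) (simp_all add: l tc T.l_distr T.smult_mult_left)
    show "(\<lambda>t. S x \<otimes> ?L t \<otimes> y) \<in> linear_maps (tensor A A) A"
      using xy by (intro linear_mapsI)
        (simp_all add: l s r_distr l_distr smult_mult_left smult_mult_right)
  qed (use xy in \<open>simp add: tm lt s m_assoc\<close>)
  show ?thesis
  proof (rule tensor_linear_ext[OF K K K _ _ _ u])
    show "(\<lambda>u. ?L (t \<otimes>\<^bsub>tensor A A\<^esub> u)) \<in> linear_maps (tensor A A) A"
      using t by (intro linear_mapsI) (simp_all add: l T.r_distr T.smult_mult_right)
    show "(\<lambda>u. c \<odot> ?L u) \<in> linear_maps (tensor A A) A"
      by (intro linear_mapsI) (simp_all add: l sm_r_distr mult.commute flip: sm_assoc)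
  qed (simp add: 1 lt eq s smult_mult_left smult_mult_right)
qed

text \<open>In \<open>x u1 S(y u2) = x (u1 S u2) S y\<close> the inner factor comes from
  \<open>u\<close>, so here the right factor of the product must have the scalar value.\<close>

lemma mult_op_right_tensor:
  assumes S: "S \<in> alg_hom A (op_alg A)" and t: "t \<in> carrier (tensor A A)" and u: "u \<in> carrier (tensor A A)"
    and eq: "tensor_lift A (\<lambda>x y. x \<otimes> S y) u = c \<odot> \<one>"
  shows "tensor_lift A (\<lambda>x y. x \<otimes> S y) (t \<otimes>\<^bsub>tensor A A\<^esub> u) = c \<odot> tensor_lift A (\<lambda>x y. x \<otimes> S y) t"
proof -
  note s = alg_homD[OF S, simplified]
  have Sl: "S \<in> linear_maps A A" by (rule linear_mapsI) (simp_all add: s)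
  interpret T: k_algebra "tensor A A" by (rule k_algebra_tensor[OF K K])
  let ?L = "tensor_lift A (\<lambda>x y. x \<otimes> S y)"
  note b = mult_bilinear[OF id_linear Sl]
  note Ll = tensor_lift_linear[OF K K K b]
  note l = linear_mapsD[OF Ll] and lt = tensor_lift_tens[OF K K K b]
  note tc = tens_closed[OF K K] and tm = tens_mult[OF K K]
  have 1: "?L (tens A A x y \<otimes>\<^bsub>tensor A A\<^esub> u) = x \<otimes> ?L u \<otimes> S y" if xy: "x \<in> carrier A" "y \<in> carrier A" for x y
  proof (rule tensor_linear_ext[OF K K K _ _ _ u])
    show "(\<lambda>u. ?L (tens A A x y \<otimes>\<^bsub>tensor A A\<^esub> u)) \<in> linear_maps (tensor A A) A"
      using xy by (intro linear_mapsI) (simp_all add: l tc T.r_distr T.smult_mult_right)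
    show "(\<lambda>u. x \<otimes> ?L u \<otimes> S y) \<in> linear_maps (tensor A A) A"
      using xy by (intro linear_mapsI)
        (simp_all add: l s r_distr l_distr smult_mult_left smult_mult_right)
  qed (use xy in \<open>simp add: tm lt s m_assoc\<close>)
  show ?thesis
  proof (rule tensor_linear_ext[OF K K K _ _ _ t])
    show "(\<lambda>t. ?L (t \<otimes>\<^bsub>tensor A A\<^esub> u)) \<in> linear_maps (tensor A A) A"
      using u by (intro linear_mapsI) (simp_all add: l T.l_distr T.smult_mult_left)
    show "(\<lambda>t. c \<odot> ?L t) \<in> linear_maps (tensor A A) A"
      by (intro linear_mapsI) (simp_all add: l sm_r_distr mult.commute flip: sm_assoc)
  qed (simp add: 1 lt eq s smult_mult_left smult_mult_right)
qed

end

text \<open>The three evaluations kill the relations. This is exactly what makes the three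
  \<open>THE\<close> values in \<open>pres_hopf\<close> independent of the representative.\<close>

locale pres_hopf_structure =
  fixes R :: "('g, 'k::field) free set"
    and \<delta> :: "'g \<Rightarrow> ((('g, 'k) free set \<times> ('g, 'k) free set) \<Rightarrow>\<^sub>0 'k) set" and \<epsilon> :: "'g \<Rightarrow> 'k"
    and \<sigma> :: "'g \<Rightarrow> ('g, 'k) free set"
  assumes comult_closed: "\<delta> x \<in> carrier (tensor (pres_alg R) (pres_alg R))"
    and antipode_closed: "\<sigma> x \<in> carrier (pres_alg R)"
    and comult_rel: "r \<in> R \<Longrightarrow> free_eval (tensor (pres_alg R) (pres_alg R)) \<delta> r = \<zero>\<^bsub>tensor (pres_alg R) (pres_alg R)\<^esub>"
    and counit_rel: "r \<in> R \<Longrightarrow> free_eval base_alg \<epsilon> r = 0"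
    and antipode_rel: "r \<in> R \<Longrightarrow> free_eval (op_alg (pres_alg R)) \<sigma> r = \<zero>\<^bsub>pres_alg R\<^esub>"
begin

abbreviation A where "A \<equiv> pres_alg R"
abbreviation T where "T \<equiv> tensor A A"
abbreviation H where "H \<equiv> pres_hopf R \<delta> \<epsilon> \<sigma>"
abbreviation cls where "cls \<equiv> pres_class R"

lemma comult_pres_hopf: "comult H = coset_map (free_eval T \<delta>)"
  and counit_pres_hopf: "counit H = coset_map (free_eval base_alg \<epsilon>)"
  and antipode_pres_hopf: "antipode H = coset_map (free_eval (op_alg A) \<sigma>)"
  and truncate_pres_hopf: "module.truncate H = A"
  by (simp_all add: pres_hopf_def Let_def module.extend_def coset_map_def fun_eq_iff module.truncate_def)

sublocale A: k_algebra A by (rule k_algebra_pres_alg)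
sublocale T: k_algebra T by (intro k_algebra_tensor k_algebra_pres_alg)

lemma op_A: "k_algebra (op_alg A)" by (rule k_algebra_op_alg[OF k_algebra_pres_alg])

lemma comult_hom: "comult H \<in> alg_hom A T"
  and comult_cls: "comult H (cls p) = free_eval T \<delta> p"
  unfolding comult_pres_hopf
  by (rule pres_lift_hom[OF T.k_algebra_axioms T.free_eval_hom[OF comult_closed] comult_rel]
      pres_lift_class[OF T.k_algebra_axioms T.free_eval_hom[OF comult_closed] comult_rel]; assumption)+

lemma counit_hom: "counit H \<in> alg_hom A base_alg"
  and counit_cls: "counit H (cls p) = free_eval base_alg \<epsilon> p"
proof -
  have c: "\<epsilon> x \<in> carrier base_alg" for x by simp
  have z: "free_eval base_alg \<epsilon> r = \<zero>\<^bsub>base_alg\<^esub>" if "r \<in> R" for r using counit_rel[OF that] by simp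
  note f = k_algebra.free_eval_hom[OF k_algebra_base_alg c]
  show "counit H \<in> alg_hom A base_alg" "counit H (cls p) = free_eval base_alg \<epsilon> p"
    unfolding counit_pres_hopf
    by (rule pres_lift_hom[OF k_algebra_base_alg f z] pres_lift_class[OF k_algebra_base_alg f z]; assumption)+
qed

lemma antipode_hom: "antipode H \<in> alg_hom A (op_alg A)"
  and antipode_cls: "antipode H (cls p) = free_eval (op_alg A) \<sigma> p"
proof -
  have c: "\<sigma> x \<in> carrier (op_alg A)" for x using antipode_closed by simp
  have z: "free_eval (op_alg A) \<sigma> r = \<zero>\<^bsub>op_alg A\<^esub>" if "r \<in> R" for r using antipode_rel[OF that] by simp
  note f = k_algebra.free_eval_hom[OF op_A c]
  show "antipode H \<in> alg_hom A (op_alg A)" "antipode H (cls p) = free_eval (op_alg A) \<sigma> p"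
    unfolding antipode_pres_hopf
    by (rule pres_lift_hom[OF op_A f z] pres_lift_class[OF op_A f z]; assumption)+
qed

lemma antipode_linear: "antipode H \<in> linear_maps A A"
  using alg_homD[OF antipode_hom] by (intro linear_mapsI) simp_all

lemma gen_values:
  "comult H (cls (gen x)) = \<delta> x" "counit H (cls (gen x)) = \<epsilon> x" "antipode H (cls (gen x)) = \<sigma> x"
proof -
  show "comult H (cls (gen x)) = \<delta> x" unfolding comult_cls by (rule T.free_eval_gen[OF comult_closed])
  show "counit H (cls (gen x)) = \<epsilon> x" unfolding counit_cls by (rule k_algebra.free_eval_gen[OF k_algebra_base_alg]) simp
  show "antipode H (cls (gen x)) = \<sigma> x" unfolding antipode_cls
    by (rule k_algebra.free_eval_gen[OF op_A]) (simp add: antipode_closed)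
qed

lemma cls_closed: "cls p \<in> carrier A"
  using A.free_hom_simps(1)[OF pres_class_hom] .

abbreviation "co_left \<equiv> tensor_map T A (comult H) (\<lambda>x. x)"
abbreviation "co_right \<equiv> tensor_map A T (\<lambda>x. x) (comult H)"

text \<open>
  All structure maps are multiplicative or antimultiplicative, so that the axioms of a Hopf algebra
  need only be checked on the generators.
\<close>

lemma hopf_data_gens:
  assumes coassoc: "\<And>x. co_left (\<delta> x) = tensor_assoc A A A (co_right (\<delta> x))"
    and counit_left: "\<And>x. tensor_lift A (\<lambda>u v. counit H u \<odot>\<^bsub>A\<^esub> v) (\<delta> x) = cls (gen x)"
    and counit_right: "\<And>x. tensor_lift A (\<lambda>u v. counit H v \<odot>\<^bsub>A\<^esub> u) (\<delta> x) = cls (gen x)"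
    and antipode_left: "\<And>x. tensor_lift A (\<lambda>u v. antipode H u \<otimes>\<^bsub>A\<^esub> v) (\<delta> x) = \<epsilon> x \<odot>\<^bsub>A\<^esub> \<one>\<^bsub>A\<^esub>"
    and antipode_right: "\<And>x. tensor_lift A (\<lambda>u v. u \<otimes>\<^bsub>A\<^esub> antipode H v) (\<delta> x) = \<epsilon> x \<odot>\<^bsub>A\<^esub> \<one>\<^bsub>A\<^esub>"
  shows "hopf_data A (comult H) (counit H) (antipode H)"
proof -
  note K = A.k_algebra_axioms and KT = T.k_algebra_axioms
  interpret three: three_algebras A A A by (intro three_algebras.intro K)
  note \<Delta> = alg_homD[OF comult_hom]
  note cl = alg_hom_linear[OF counit_hom]
  have bc: "bilinear_map A A A (\<lambda>u v. counit H u \<odot>\<^bsub>A\<^esub> v)" "bilinear_map A A A (\<lambda>u v. counit H v \<odot>\<^bsub>A\<^esub> u)"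
    using A.counit_bilinear[OF cl] .
  note bS = A.mult_bilinear[OF antipode_linear id_linear] A.mult_bilinear[OF id_linear antipode_linear]
  note \<epsilon> = alg_homD[OF counit_hom, simplified]
  have ch: "tensor_lift A (\<lambda>u v. counit H u \<odot>\<^bsub>A\<^esub> v) \<in> alg_hom T A" "tensor_lift A (\<lambda>u v. counit H v \<odot>\<^bsub>A\<^esub> u) \<in> alg_hom T A"
    using bc by (intro tensor_mult_ext[OF K K K tensor_lift_linear[OF K K K]];
      simp add: tensor_lift_tens[OF K K K] \<epsilon> A.smult_mult_left A.smult_mult_right mult.commute flip: A.sm_assoc)+
  show ?thesis
  proof (intro hopf_data.intro hopf_data_axioms.intro K comult_hom counit_hom antipode_linear)
    fix a assume a: "a \<in> carrier A"
    show "co_left (comult H a) = tensor_assoc A A A (co_right (comult H a))"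
      by (rule alg_hom_pres_ext[OF three.AB_C _ _ _ a])
        (rule alg_hom_comp[OF comult_hom tensor_map_hom[OF KT K K K comult_hom id_hom]]
          alg_hom_comp[OF alg_hom_comp[OF comult_hom tensor_map_hom[OF K KT K K id_hom comult_hom]] three.tensor_assoc_hom]
        | simp add: gen_values coassoc)+
    show "tensor_lift A (\<lambda>u v. counit H u \<odot>\<^bsub>A\<^esub> v) (comult H a) = a"
      by (rule alg_hom_pres_ext[OF K alg_hom_comp[OF comult_hom ch(1)] id_hom _ a])
        (simp add: gen_values counit_left)
    show "tensor_lift A (\<lambda>u v. counit H v \<odot>\<^bsub>A\<^esub> u) (comult H a) = a"
      by (rule alg_hom_pres_ext[OF K alg_hom_comp[OF comult_hom ch(2)] id_hom _ a])
        (simp add: gen_values counit_right)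
    \<comment> \<open>Convolving the antipode with the identity does not give an algebra map, so
      agreement on generators does not extend by itself. The antipode axioms are proved by induction
      on a representative instead.\<close>
    obtain p where p: "a = cls p" using a pres_alg_carrier by blast
    note c = A.free_hom_simps[OF pres_class_hom[of R]]
    note S = alg_homD[OF antipode_hom, simplified]
    note lS1 = linear_mapsD[OF tensor_lift_linear[OF K K K bS(1)]] and lS2 = linear_mapsD[OF tensor_lift_linear[OF K K K bS(2)]]
    show "tensor_lift A (\<lambda>u v. antipode H u \<otimes>\<^bsub>A\<^esub> v) (comult H a) = counit H a \<odot>\<^bsub>A\<^esub> \<one>\<^bsub>A\<^esub>"
      unfolding p
    proof (induction p rule: free_induct)
      case one
      then show ?case by (simp add: c \<Delta> \<epsilon> tens_one[OF K K] tensor_lift_tens[OF K K K bS(1)] S)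
    next
      case (gen_mult x p)
      have "tensor_lift A (\<lambda>u v. antipode H u \<otimes>\<^bsub>A\<^esub> v) (comult H (cls (gen x)) \<otimes>\<^bsub>T\<^esub> comult H (cls p)) =
          \<epsilon> x \<odot>\<^bsub>A\<^esub> tensor_lift A (\<lambda>u v. antipode H u \<otimes>\<^bsub>A\<^esub> v) (comult H (cls p))"
        by (rule mult_op_left_tensor[OF K antipode_hom]) (simp_all add: \<Delta> cls_closed gen_values(1) antipode_left comult_closed)
      then show ?case by (simp add: c \<Delta> \<epsilon> gen_mult gen_values A.sm_assoc)
    qed (simp_all add: c \<Delta> \<epsilon> lS1 A.sm_l_distr A.sm_assoc T.smult_mult_left)
    show "tensor_lift A (\<lambda>u v. u \<otimes>\<^bsub>A\<^esub> antipode H v) (comult H a) = counit H a \<odot>\<^bsub>A\<^esub> \<one>\<^bsub>A\<^esub>"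
      unfolding p
    proof (induction p rule: free_induct)
      case one
      then show ?case by (simp add: c \<Delta> \<epsilon> tens_one[OF K K] tensor_lift_tens[OF K K K bS(2)] S)
    next
      \<comment> \<open>The roles are exchanged against the left axiom: the induction hypothesis for
        \<open>p\<close> gives the inner scalar, and the axiom for the generator settles what is
        left.\<close>
      case (gen_mult x p)
      have "tensor_lift A (\<lambda>u v. u \<otimes>\<^bsub>A\<^esub> antipode H v) (comult H (cls (gen x)) \<otimes>\<^bsub>T\<^esub> comult H (cls p)) =
          counit H (cls p) \<odot>\<^bsub>A\<^esub> tensor_lift A (\<lambda>u v. u \<otimes>\<^bsub>A\<^esub> antipode H v) (comult H (cls (gen x)))"
        by (rule mult_op_right_tensor[OF K antipode_hom]) (simp_all add: \<Delta> cls_closed gen_mult)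
      then show ?case by (simp add: c \<Delta> \<epsilon> gen_values antipode_right mult.commute flip: A.sm_assoc)
    qed (simp_all add: c \<Delta> \<epsilon> lS2 A.sm_l_distr A.sm_assoc T.smult_mult_left)
  qed
qed

definition group_gen :: "'g \<Rightarrow> bool" where
  "group_gen x \<longleftrightarrow> \<delta> x = grouplike_comult A (cls (gen x)) \<and> \<epsilon> x = 1 \<and>
     \<sigma> x \<otimes>\<^bsub>A\<^esub> cls (gen x) = \<one>\<^bsub>A\<^esub> \<and> cls (gen x) \<otimes>\<^bsub>A\<^esub> \<sigma> x = \<one>\<^bsub>A\<^esub>"

text \<open>The last two equations are the left and right antipode axioms written out for l
  \<otimes> h + g \<otimes> l, whose counit is 0.\<close>

definition skew_gen :: "'g \<Rightarrow> bool" where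
  "skew_gen x \<longleftrightarrow> \<epsilon> x = 0 \<and> (\<exists>g\<in>carrier A. \<exists>h\<in>carrier A. \<delta> x = skew_prim_comult A g h (cls (gen x)) \<and>
     comult H g = grouplike_comult A g \<and> comult H h = grouplike_comult A h \<and> counit H g = 1 \<and> counit H h = 1 \<and>
     \<sigma> x \<otimes>\<^bsub>A\<^esub> h \<oplus>\<^bsub>A\<^esub> antipode H g \<otimes>\<^bsub>A\<^esub> cls (gen x) = \<zero>\<^bsub>A\<^esub> \<and>
     cls (gen x) \<otimes>\<^bsub>A\<^esub> antipode H h \<oplus>\<^bsub>A\<^esub> g \<otimes>\<^bsub>A\<^esub> \<sigma> x = \<zero>\<^bsub>A\<^esub>)"

lemma hopf_algebra_pres_hopf:
  assumes gens: "\<And>x. group_gen x \<or> skew_gen x"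
  shows "hopf_algebra H"
proof -
  note K = A.k_algebra_axioms and KT = T.k_algebra_axioms
  interpret three: three_algebras A A A by (intro three_algebras.intro K)
  note \<Delta> = alg_homD[OF comult_hom]
  note cl = alg_hom_linear[OF counit_hom]
  have bc: "bilinear_map A A A (\<lambda>u v. counit H u \<odot>\<^bsub>A\<^esub> v)" "bilinear_map A A A (\<lambda>u v. counit H v \<odot>\<^bsub>A\<^esub> u)"
    using A.counit_bilinear[OF cl] .
  note bS = A.mult_bilinear[OF antipode_linear id_linear] A.mult_bilinear[OF id_linear antipode_linear]
  note lift = tensor_lift_tens[OF K K K bc(1)] tensor_lift_tens[OF K K K bc(2)]
    tensor_lift_tens[OF K K K bS(1)] tensor_lift_tens[OF K K K bS(2)]
    linear_mapsD(2)[OF tensor_lift_linear[OF K K K bc(1)]] linear_mapsD(2)[OF tensor_lift_linear[OF K K K bc(2)]]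
    linear_mapsD(2)[OF tensor_lift_linear[OF K K K bS(1)]] linear_mapsD(2)[OF tensor_lift_linear[OF K K K bS(2)]]
  note \<Delta>l = alg_hom_linear[OF comult_hom]
  note co = tensor_map_tens[OF KT K K K \<Delta>l id_linear] tensor_map_tens[OF K KT K K id_linear \<Delta>l]
    linear_mapsD(2)[OF tensor_map_linear[OF KT K K K \<Delta>l id_linear]] linear_mapsD(2)[OF tensor_map_linear[OF K KT K K id_linear \<Delta>l]]
    three.tensor_assoc_tens linear_mapsD(2)[OF three.tensor_assoc_linear]
    tens_bilinear[OF K K] tens_bilinear[OF K KT] tens_bilinear[OF KT K]
  interpret TT: k_algebra "tensor T A" by (rule three.AB_C)
  interpret TT': k_algebra "tensor A T" by (rule three.A_BC)
  have "hopf_data A (comult H) (counit H) (antipode H)"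
  proof (rule hopf_data_gens)
    fix x
    have x: "cls (gen x) \<in> carrier A" by (rule cls_closed)
    \<comment> \<open>For a skew primitive \<open>l\<close> both sides are l \<otimes> h \<otimes> h
      + g \<otimes> l \<otimes> h + g \<otimes> g \<otimes> l, with the sum bracketed
      differently.\<close>
    show "co_left (\<delta> x) = tensor_assoc A A A (co_right (\<delta> x))"
      using gens[of x] x gen_values(1)[of x] unfolding group_gen_def skew_gen_def
      by (auto simp: grouplike_comult_def skew_prim_comult_def co TT.a_assoc)
    show "tensor_lift A (\<lambda>u v. counit H u \<odot>\<^bsub>A\<^esub> v) (\<delta> x) = cls (gen x)"
      "tensor_lift A (\<lambda>u v. counit H v \<odot>\<^bsub>A\<^esub> u) (\<delta> x) = cls (gen x)"
      "tensor_lift A (\<lambda>u v. antipode H u \<otimes>\<^bsub>A\<^esub> v) (\<delta> x) = \<epsilon> x \<odot>\<^bsub>A\<^esub> \<one>\<^bsub>A\<^esub>"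
      "tensor_lift A (\<lambda>u v. u \<otimes>\<^bsub>A\<^esub> antipode H v) (\<delta> x) = \<epsilon> x \<odot>\<^bsub>A\<^esub> \<one>\<^bsub>A\<^esub>"
      using gens[of x] x gen_values(2,3)[of x] unfolding group_gen_def skew_gen_def
      by (auto simp: grouplike_comult_def skew_prim_comult_def lift tens_closed[OF K K])
  qed
  then show ?thesis
    unfolding hopf_algebra_iff using hopf_data_truncate[of H] by (simp add: truncate_pres_hopf)
qed

end

subsection \<open>Computing in the tensor square\<close>

abbreviation inl :: "('g, 'k::field) free \<Rightarrow> ('g + 'g, 'k) free" where "inl \<equiv> subst (\<lambda>x. gen (Inl x))"
abbreviation inr :: "('g, 'k::field) free \<Rightarrow> ('g + 'g, 'k) free" where "inr \<equiv> subst (\<lambda>x. gen (Inr x))"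

text \<open>
  The tensor square of a presented algebra is a quotient of the free algebra on two copies of the
  generators. This turns identities in the tensor square into ideal membership in a free algebra.
\<close>

definition square_rels :: "('g, 'k::field) free set \<Rightarrow> ('g + 'g, 'k) free set" where
  "square_rels R = inl ` R \<union> inr ` R \<union> {gen (Inl x) * gen (Inr y) - gen (Inr y) * gen (Inl x) | x y. True}"

definition square_eval :: "('g, 'k::field) free set \<Rightarrow> ('g + 'g, 'k) free \<Rightarrow>
    ((('g, 'k) free set \<times> ('g, 'k) free set) \<Rightarrow>\<^sub>0 'k) set" where
  "square_eval R = free_eval (tensor (pres_alg R) (pres_alg R)) (case_sum
     (\<lambda>x. tens (pres_alg R) (pres_alg R) (pres_class R (gen x)) \<one>\<^bsub>pres_alg R\<^esub>)
     (\<lambda>x. tens (pres_alg R) (pres_alg R) \<one>\<^bsub>pres_alg R\<^esub> (pres_class R (gen x))))"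

context
  fixes R :: "('g, 'k::field) free set"
begin

private abbreviation "AR \<equiv> pres_alg R"
private abbreviation "TR \<equiv> tensor AR AR"
private lemmas K = k_algebra_pres_alg[of R]
private lemmas KT = k_algebra_tensor[OF K K]

interpretation A: k_algebra AR by (rule K)
interpretation T: k_algebra TR by (rule KT)

private lemma closed: "case_sum (\<lambda>x. tens AR AR (pres_class R (gen x)) \<one>\<^bsub>AR\<^esub>) (\<lambda>x. tens AR AR \<one>\<^bsub>AR\<^esub> (pres_class R (gen x))) x \<in> carrier TR"
  using A.free_hom_simps(1)[OF pres_class_hom] by (auto split: sum.split intro: tens_closed[OF K K])

lemma square_eval_hom: "square_eval R \<in> alg_hom free_alg TR"
  unfolding square_eval_def by (rule T.free_eval_hom[OF closed])

lemma square_eval_inl: "square_eval R (inl p) = tens AR AR (pres_class R p) \<one>\<^bsub>AR\<^esub>"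
proof -
  have h: "(\<lambda>a. tens AR AR a \<one>\<^bsub>AR\<^esub>) \<in> alg_hom AR TR"
    by (rule alg_homI) (simp_all add: tens_bilinear[OF K K] tens_mult[OF K K] tens_one[OF K K])
  show ?thesis
    by (rule T.alg_hom_free_ext[OF alg_hom_comp[OF subst_hom square_eval_hom] alg_hom_comp[OF pres_class_hom h]])
      (simp add: square_eval_def T.free_eval_gen[OF closed])
qed

lemma square_eval_inr: "square_eval R (inr p) = tens AR AR \<one>\<^bsub>AR\<^esub> (pres_class R p)"
proof -
  have h: "(\<lambda>a. tens AR AR \<one>\<^bsub>AR\<^esub> a) \<in> alg_hom AR TR"
    by (rule alg_homI) (simp_all add: tens_bilinear[OF K K] tens_mult[OF K K] tens_one[OF K K])
  show ?thesis
    by (rule T.alg_hom_free_ext[OF alg_hom_comp[OF subst_hom square_eval_hom] alg_hom_comp[OF pres_class_hom h]])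
      (simp add: square_eval_def T.free_eval_gen[OF closed])
qed

lemma square_eval_tens: "tens AR AR (pres_class R p) (pres_class R q) = square_eval R (inl p * inr q)"
  using A.free_hom_simps(1)[OF pres_class_hom]
  by (simp add: T.free_hom_simps[OF square_eval_hom] square_eval_inl square_eval_inr tens_mult[OF K K])

text \<open>A relation of either copy maps to a tensor with a zero factor, and the copies commute
  because both products of a \<otimes> 1 and 1 \<otimes> b are a \<otimes> b.\<close>

lemma square_eval_zero:
  assumes "p \<in> rel_ideal (square_rels R)"
  shows "square_eval R p = \<zero>\<^bsub>TR\<^esub>"
proof (rule free_hom_Idl_zero[OF KT square_eval_hom _ assms])
  note c = A.free_hom_simps(1)[OF pres_class_hom[of R]]
  note t = tens_closed[OF K K]
  have z: "tens AR AR \<zero>\<^bsub>AR\<^esub> \<one>\<^bsub>AR\<^esub> = \<zero>\<^bsub>TR\<^esub>" "tens AR AR \<one>\<^bsub>AR\<^esub> \<zero>\<^bsub>AR\<^esub> = \<zero>\<^bsub>TR\<^esub>"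
    using tens_bilinear(4,5)[OF K K, of "\<one>\<^bsub>AR\<^esub>" "\<one>\<^bsub>AR\<^esub>" 0] t by simp_all
  fix r assume "r \<in> square_rels R"
  then consider s where "s \<in> R" "r = inl s" | s where "s \<in> R" "r = inr s"
    | x y where "r = gen (Inl x) * gen (Inr y) - gen (Inr y) * gen (Inl x)"
    unfolding square_rels_def by blast
  then show "square_eval R r = \<zero>\<^bsub>TR\<^esub>"
  proof cases
    case (1 s)
    then show ?thesis using pres_class_eq_zero_iff[of R s] Idl_base[of s R] by (simp add: square_eval_inl z)
  next
    case (2 s)
    then show ?thesis using pres_class_eq_zero_iff[of R s] Idl_base[of s R] by (simp add: square_eval_inr z)
  next
    case (3 x y)
    have "square_eval R (gen (Inl x)) = tens AR AR (pres_class R (gen x)) \<one>\<^bsub>AR\<^esub>"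
      "square_eval R (gen (Inr y)) = tens AR AR \<one>\<^bsub>AR\<^esub> (pres_class R (gen y))"
      by (simp_all add: square_eval_def T.free_eval_gen[OF closed])
    then show ?thesis unfolding 3 T.free_hom_simps[OF square_eval_hom]
      using c t by (simp add: tens_mult[OF K K])
  qed
qed

end

lemma base_alg_minus [simp]: "\<ominus>\<^bsub>base_alg\<^esub> a = - a" "a \<ominus>\<^bsub>base_alg\<^esub> b = a - b" for a b :: "'k::field"
proof -
  interpret B: k_algebra "base_alg :: ('k, 'k) module" by (rule k_algebra_base_alg)
  show m: "\<ominus>\<^bsub>base_alg\<^esub> a = - a" for a :: 'k
    using B.sm_minus_one[of a] by simp
  show "a \<ominus>\<^bsub>base_alg\<^esub> b = a - b" by (simp add: a_minus_def m)
qed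

lemma base_eval_hom: "free_eval base_alg \<epsilon> \<in> alg_hom free_alg base_alg"
  by (rule k_algebra.free_eval_hom[OF k_algebra_base_alg]) simp

lemma base_eval_simps [simp]:
  fixes p q :: "('g, 'k::field) free"
  shows "free_eval base_alg \<epsilon> (p + q) = free_eval base_alg \<epsilon> p + free_eval base_alg \<epsilon> q"
    "free_eval base_alg \<epsilon> (p - q) = free_eval base_alg \<epsilon> p - free_eval base_alg \<epsilon> q"
    "free_eval base_alg \<epsilon> (- p) = - free_eval base_alg \<epsilon> p"
    "free_eval base_alg \<epsilon> (p * q) = free_eval base_alg \<epsilon> p * free_eval base_alg \<epsilon> q"
    "free_eval base_alg \<epsilon> (1 :: ('g, 'k) free) = 1" "free_eval base_alg \<epsilon> (cst c :: ('g, 'k) free) = c"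
    "free_eval base_alg \<epsilon> (gen x :: ('g, 'k) free) = \<epsilon> x"
  using k_algebra.free_hom_simps[OF k_algebra_base_alg base_eval_hom, of \<epsilon>]
    k_algebra.free_eval_gen[OF k_algebra_base_alg, of \<epsilon> x]
  by simp_all

definition group_poly :: "('g, 'k::field) free \<Rightarrow> ('g + 'g, 'k) free" where
  "group_poly g = inl g * inr g"

definition skew_poly :: "('g, 'k::field) free \<Rightarrow> ('g, 'k) free \<Rightarrow> ('g, 'k) free \<Rightarrow> ('g + 'g, 'k) free" where
  "skew_poly g h l = inl l * inr h + inl g * inr l"

lemma grouplike_comult_class:
  "grouplike_comult (pres_alg R) (pres_class R g) = square_eval R (group_poly g)"
  by (simp add: grouplike_comult_def group_poly_def square_eval_tens)

lemma skew_prim_comult_class: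
  "skew_prim_comult (pres_alg R) (pres_class R g) (pres_class R h) (pres_class R l) = square_eval R (skew_poly g h l)"
  by (simp add: skew_prim_comult_def skew_poly_def square_eval_tens
      k_algebra.free_hom_simps[OF k_algebra_tensor[OF k_algebra_pres_alg k_algebra_pres_alg] square_eval_hom])

lemma square_eval_eqI:
  assumes "p - q \<in> rel_ideal (square_rels R)"
  shows "square_eval R p = square_eval R q"
proof -
  interpret T: k_algebra "tensor (pres_alg R) (pres_alg R)"
    by (intro k_algebra_tensor k_algebra_pres_alg)
  have "square_eval R p \<ominus>\<^bsub>tensor (pres_alg R) (pres_alg R)\<^esub> square_eval R q = \<zero>\<^bsub>tensor (pres_alg R) (pres_alg R)\<^esub>"
    using square_eval_zero[OF assms] by (simp add: T.free_hom_simps[OF square_eval_hom])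
  then show ?thesis by (simp add: T.free_hom_simps[OF square_eval_hom])
qed

text \<open>Comultiplication and antipode are given by polynomial representatives \<open>d\<close>
  and \<open>s\<close>. The conditions for them to descend are then memberships in ideals of free
  algebras, which explicit certificates can establish.\<close>

locale pres_poly =
  fixes R :: "('g, 'k::field) free set" and d :: "'g \<Rightarrow> ('g + 'g, 'k) free" and \<epsilon> :: "'g \<Rightarrow> 'k"
    and s :: "'g \<Rightarrow> ('g, 'k) free"
  assumes comult_poly: "r \<in> R \<Longrightarrow> subst d r \<in> rel_ideal (square_rels R)"
    and counit_poly: "r \<in> R \<Longrightarrow> free_eval base_alg \<epsilon> r = 0"
    and antipode_poly: "r \<in> R \<Longrightarrow> op_subst s r \<in> rel_ideal R"
begin

lemma comult_eval: "free_eval (tensor (pres_alg R) (pres_alg R)) (\<lambda>x. square_eval R (d x)) p = square_eval R (subst d p)"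
  by (rule free_eval_subst[OF k_algebra_tensor[OF k_algebra_pres_alg k_algebra_pres_alg] square_eval_hom])

lemma antipode_eval: "free_eval (op_alg (pres_alg R)) (\<lambda>x. pres_class R (s x)) p = pres_class R (op_subst s p)"
  by (rule free_eval_op_subst[OF k_algebra_pres_alg pres_class_hom])

sublocale pres_hopf_structure R "\<lambda>x. square_eval R (d x)" \<epsilon> "\<lambda>x. pres_class R (s x)"
proof
  interpret A: k_algebra "pres_alg R" by (rule k_algebra_pres_alg)
  interpret T: k_algebra "tensor (pres_alg R) (pres_alg R)"
    by (intro k_algebra_tensor k_algebra_pres_alg)
  show "square_eval R (d x) \<in> carrier (tensor (pres_alg R) (pres_alg R))" for x
    by (rule T.free_hom_simps(1)[OF square_eval_hom])
  show "pres_class R (s x) \<in> carrier (pres_alg R)" for x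
    by (rule A.free_hom_simps(1)[OF pres_class_hom])
qed (simp_all add: comult_eval antipode_eval square_eval_zero comult_poly counit_poly pres_class_eq_zero_iff antipode_poly)

lemma comult_poly_cls: "comult H (cls p) = square_eval R (subst d p)"
  by (simp add: comult_cls comult_eval)

lemma antipode_poly_cls: "antipode H (cls p) = cls (op_subst s p)"
  by (simp add: antipode_cls antipode_eval)

lemma group_gen_poly:
  assumes "d x = group_poly (gen x)" "\<epsilon> x = 1" "s x * gen x - 1 \<in> rel_ideal R" "gen x * s x - 1 \<in> rel_ideal R"
  shows "group_gen x"
proof -
  have "cls (s x * gen x) = cls 1" "cls (gen x * s x) = cls 1"
    using assms by (simp_all add: pres_class_eq_iff)
  then show ?thesis
    using assms(1,2) by (simp add: group_gen_def grouplike_comult_class A.free_hom_simps[OF pres_class_hom])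
qed

lemma skew_gen_poly:
  assumes "d x = skew_poly g h (gen x)" "\<epsilon> x = 0" "subst d g = group_poly g" "subst d h = group_poly h"
    "free_eval base_alg \<epsilon> g = 1" "free_eval base_alg \<epsilon> h = 1"
    "s x * h + op_subst s g * gen x \<in> rel_ideal R" "gen x * op_subst s h + g * s x \<in> rel_ideal R"
  shows "skew_gen x"
  unfolding skew_gen_def
proof (rule conjI, rule assms(2), rule bexI[of _ "cls g"], rule bexI[of _ "cls h"], intro conjI)
  show "cls (s x) \<otimes>\<^bsub>A\<^esub> cls h \<oplus>\<^bsub>A\<^esub> antipode H (cls g) \<otimes>\<^bsub>A\<^esub> cls (gen x) = \<zero>\<^bsub>A\<^esub>"
    using assms(7) by (simp add: antipode_poly_cls pres_class_eq_zero_iff flip: A.free_hom_simps(2,3)[OF pres_class_hom])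
  show "cls (gen x) \<otimes>\<^bsub>A\<^esub> antipode H (cls h) \<oplus>\<^bsub>A\<^esub> cls g \<otimes>\<^bsub>A\<^esub> cls (s x) = \<zero>\<^bsub>A\<^esub>"
    using assms(8) by (simp add: antipode_poly_cls pres_class_eq_zero_iff flip: A.free_hom_simps(2,3)[OF pres_class_hom])
qed (simp_all add: cls_closed assms(1-6) skew_prim_comult_class grouplike_comult_class comult_poly_cls counit_cls)

end

subsection \<open>Certificates of ideal membership\<close>

text \<open>
  Membership of \<open>p\<close> in the ideal of the relations is shown by an explicit sum of terms
  \<open>c u r v\<close> with a scalar \<open>c\<close>, words \<open>u\<close>, \<open>v\<close> and a relation \<open>r\<close>. The sums record the reduction of
  \<open>p\<close> to \<open>0\<close> by the relations, read as rewrite rules for words.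
\<close>

lemma Idl_add: "p \<in> rel_ideal R \<Longrightarrow> q \<in> rel_ideal R \<Longrightarrow> p + q \<in> rel_ideal R"
  using additive_subgroup.a_closed[OF ideal.axioms(1)[OF ideal_Idl]] by fastforce

lemma Idl_mult: "r \<in> rel_ideal R \<Longrightarrow> u * r * v \<in> rel_ideal R"
  using ideal.I_l_closed[OF ideal_Idl, of r R u] ideal.I_r_closed[OF ideal_Idl, of "u * r" R v] by simp

lemma Idl_certificate: "q \<in> rel_ideal R \<Longrightarrow> p = q \<Longrightarrow> p \<in> rel_ideal R"
  by simp

abbreviation tm :: "'k \<Rightarrow> 'g list \<Rightarrow> ('g, 'k::field) free \<Rightarrow> 'g list \<Rightarrow> ('g, 'k) free" where
  "tm c u r v \<equiv> psingle u c * r * psingle v 1"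

lemma Idl_zero: "0 \<in> rel_ideal R"
  using additive_subgroup.zero_closed[OF ideal.axioms(1)[OF ideal_Idl]] by simp

lemma Idl_subst:
  assumes p: "p \<in> rel_ideal R" and r: "\<And>r. r \<in> R \<Longrightarrow> subst f r \<in> Q"
  shows "subst f p \<in> rel_ideal Q"
proof -
  have "pres_class Q (subst f p) = \<zero>\<^bsub>pres_alg Q\<^esub>"
    by (rule free_hom_Idl_zero[OF k_algebra_pres_alg alg_hom_comp[OF subst_hom pres_class_hom] _ p])
      (simp add: pres_class_eq_zero_iff Idl_base r)
  then show ?thesis by (simp add: pres_class_eq_zero_iff)
qed

lemma Idl_inl: "p \<in> rel_ideal R \<Longrightarrow> inl p \<in> rel_ideal (square_rels R)"
  and Idl_inr: "p \<in> rel_ideal R \<Longrightarrow> inr p \<in> rel_ideal (square_rels R)"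
  by (erule Idl_subst, simp add: square_rels_def)+

definition commutator_rel :: "'g \<Rightarrow> 'g \<Rightarrow> ('g + 'g, 'k::field) free" where
  "commutator_rel x y = gen (Inl x) * gen (Inr y) - gen (Inr y) * gen (Inl x)"

lemma Idl_commutator: "commutator_rel x y \<in> rel_ideal (square_rels R)"
  by (rule Idl_base) (auto simp: square_rels_def commutator_rel_def)

text \<open>
  Two expressions in a free algebra are compared by their coefficients. \<open>word_eq\<close> hides the
  comparison of words from the simplifier, which is left with a linear identity over the field.
\<close>

definition word_eq :: "'a list \<Rightarrow> 'a list \<Rightarrow> 'k::field" where
  "word_eq v w = (if v = w then 1 else 0)"

lemma lookup_word: "plookup (psingle v c) w = c * word_eq v w"
  by (simp add: lookup_single when_def word_eq_def)

lemmas expand_substs = commutator_rel_def subst_simps op_subst_simps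

lemmas expand_words = gen_def cst_def one_free distrib_left distrib_right
  left_diff_distrib right_diff_distrib mult_single plus_list_def append_Cons append_Nil mult_1_left mult_1_right
  minus_mult_left[symmetric] minus_mult_right[symmetric]

lemmas lookup_words = lookup_add lookup_minus lookup_uminus lookup_word lookup_zero

section \<open>The Ohn Hopf algebra\<close>

definition ohn_TTi :: "(ohn_gen, 'k::field) free" where "ohn_TTi = gen OT * gen OTi - 1"
definition ohn_TiT :: "(ohn_gen, 'k::field) free" where "ohn_TiT = gen OTi * gen OT - 1"
definition ohn_KT :: "(ohn_gen, 'k::field) free" where
  "ohn_KT = (gen OK * gen OT - gen OT * gen OK) - (gen OT * gen OT - 1)"
definition ohn_YT :: "'k::field \<Rightarrow> (ohn_gen, 'k) free" where
  "ohn_YT hbar = (gen OY * gen OT - gen OT * gen OY) + cst (hbar / 2) * (gen OK * gen OT + gen OT * gen OK)"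
definition ohn_KY :: "'k::field \<Rightarrow> (ohn_gen, 'k) free" where
  "ohn_KY hbar = (gen OK * gen OY - gen OY * gen OK) +
     cst (1 / 2) * (gen OY * gen OT + gen OT * gen OY + gen OY * gen OTi + gen OTi * gen OY)"
text \<open>\<open>ohn_KTi\<close> and \<open>ohn_YTi\<close> are the relations for
  \<open>K\<close>, \<open>Y\<close> against \<open>T\<close>, multiplied by \<open>T^-1\<close> on
  both sides and negated. They move \<open>K\<close> and \<open>Y\<close> past
  \<open>T^-1\<close>.\<close>

definition ohn_KTi :: "(ohn_gen, 'k::field) free" where
  "ohn_KTi = gen OK * gen OTi - gen OTi * gen OK - gen OTi * gen OTi + 1"
definition ohn_YTi :: "'k::field \<Rightarrow> (ohn_gen, 'k) free" where
  "ohn_YTi hbar = gen OY * gen OTi - gen OTi * gen OY - cst (hbar / 2) * (gen OTi * gen OK + gen OK * gen OTi)"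

lemmas ohn_poly_defs = ohn_TTi_def ohn_TiT_def ohn_KT_def ohn_YT_def ohn_KY_def ohn_KTi_def ohn_YTi_def

lemma ohn_rels_eq: "ohn_rels hbar = {ohn_TTi, ohn_TiT, ohn_KT, ohn_YT hbar, ohn_KY hbar}"
  by (simp add: ohn_rels_def ohn_poly_defs Let_def)

lemma ohn_Idl_base:
  "ohn_TTi \<in> rel_ideal (ohn_rels hbar)" "ohn_TiT \<in> rel_ideal (ohn_rels hbar)"
  "ohn_KT \<in> rel_ideal (ohn_rels hbar)" "ohn_YT hbar \<in> rel_ideal (ohn_rels hbar)"
  "ohn_KY hbar \<in> rel_ideal (ohn_rels hbar)"
  by (rule Idl_base, simp add: ohn_rels_eq)+

lemma ohn_KTi_Idl:
  fixes hbar :: "'k::field_char_0"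
  shows "(ohn_KTi :: (ohn_gen, 'k) free) \<in> rel_ideal (ohn_rels hbar)" (is "_ \<in> ?I")
proof (rule Idl_certificate)
  \<comment> \<open>The last term is \<open>- T^-1 r T^-1\<close> with \<open>r = ohn_KT\<close>;
    the other terms cancel the adjacent \<open>T\<close> and \<open>T^-1\<close> in it.\<close>
  show "tm 1 [OTi, OK] ohn_TTi [] + tm (-1) [] ohn_TiT [OK, OTi] + tm (-1) [OTi, OT] ohn_TTi [] +
      tm (-1) [] ohn_TiT [] + tm (-1) [OTi] ohn_KT [OTi] \<in> ?I"
    by (intro Idl_add Idl_mult ohn_Idl_base)
qed (simp only: ohn_poly_defs expand_substs, simp only: expand_words;
    rule poly_mapping_eqI; simp only: lookup_words; simp add: field_simps)

lemma ohn_YTi_Idl: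
  fixes hbar :: "'k::field_char_0"
  shows "ohn_YTi hbar \<in> rel_ideal (ohn_rels hbar)" (is "_ \<in> ?I")
proof (rule Idl_certificate)
  show "tm (hbar / 2) [OTi, OK] ohn_TTi [] + tm (hbar / 2) [] ohn_TiT [OK, OTi] + tm (-1) [] ohn_TiT [OY, OTi] +
      tm 1 [OTi, OY] ohn_TTi [] + tm (-1) [OTi] (ohn_YT hbar) [OTi] \<in> ?I"
    by (intro Idl_add Idl_mult ohn_Idl_base)
qed (simp only: ohn_poly_defs expand_substs, simp only: expand_words;
    rule poly_mapping_eqI; simp only: lookup_words; simp add: field_simps)

lemmas ohn_Idl = ohn_Idl_base ohn_KTi_Idl ohn_YTi_Idl
lemmas ohn_square_Idl = ohn_Idl[THEN Idl_inl] ohn_Idl[THEN Idl_inr] Idl_commutator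

section \<open>Structure maps of the Ohn algebra as noncommutative polynomials\<close>

definition ohn_comult_poly :: "ohn_gen \<Rightarrow> (ohn_gen + ohn_gen, 'k::field) free" where
  "ohn_comult_poly = case_ohn_gen (skew_poly (gen OTi) (gen OT) (gen OK)) (skew_poly (gen OTi) (gen OT) (gen OY))
     (group_poly (gen OT)) (group_poly (gen OTi))"

definition ohn_antipode_poly :: "ohn_gen \<Rightarrow> (ohn_gen, 'k::field) free" where
  "ohn_antipode_poly = case_ohn_gen (- (gen OT * gen OK * gen OTi)) (- (gen OT * gen OY * gen OTi)) (gen OTi) (gen OT)"

lemmas ohn_hopf_defs = ohn_comult_poly_def ohn_antipode_poly_def ohn_gen.case skew_poly_def group_poly_def

text \<open>In (T \<otimes> T)(T^-1 \<otimes> T^-1) one commutator brings the second left leg past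
  the first right leg, and then each leg cancels. The longer certificates combine the same
  ingredients: commutators of the legs, and relations within one leg.\<close>

lemma ohn_comult_TTi:
  fixes hbar :: "'k::field_char_0"
  shows "subst ohn_comult_poly (ohn_TTi :: (ohn_gen, 'k) free) \<in> rel_ideal (square_rels (ohn_rels hbar))" (is "_ \<in> ?I")
proof (rule Idl_certificate)
  show "tm (-1) [Inl OT] (commutator_rel OTi OT) [Inr OTi] + tm 1 [] (inl ohn_TTi) [Inr OT, Inr OTi] +
      tm 1 [] (inr ohn_TTi) [] \<in> ?I"
    by (intro Idl_add Idl_mult ohn_square_Idl)
qed (simp only: ohn_poly_defs ohn_hopf_defs expand_substs, simp only: expand_words;
    rule poly_mapping_eqI; simp only: lookup_words; simp add: field_simps)

lemma ohn_antipode_TTi: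
  fixes hbar :: "'k::field_char_0"
  shows "op_subst ohn_antipode_poly (ohn_TTi :: (ohn_gen, 'k) free) \<in> rel_ideal (ohn_rels hbar)" (is "_ \<in> ?I")
proof (rule Idl_certificate)
  show "tm 1 [] ohn_TTi [] \<in> ?I"
    by (intro Idl_add Idl_mult ohn_Idl)
qed (simp only: ohn_poly_defs ohn_hopf_defs expand_substs, simp only: expand_words;
    rule poly_mapping_eqI; simp only: lookup_words; simp add: field_simps)

lemma ohn_comult_TiT:
  fixes hbar :: "'k::field_char_0"
  shows "subst ohn_comult_poly (ohn_TiT :: (ohn_gen, 'k) free) \<in> rel_ideal (square_rels (ohn_rels hbar))" (is "_ \<in> ?I")
proof (rule Idl_certificate)
  show "tm (-1) [Inl OTi] (commutator_rel OT OTi) [Inr OT] + tm 1 [] (inl ohn_TiT) [Inr OTi, Inr OT] +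
      tm 1 [] (inr ohn_TiT) [] \<in> ?I"
    by (intro Idl_add Idl_mult ohn_square_Idl)
qed (simp only: ohn_poly_defs ohn_hopf_defs expand_substs, simp only: expand_words;
    rule poly_mapping_eqI; simp only: lookup_words; simp add: field_simps)

lemma ohn_antipode_TiT:
  fixes hbar :: "'k::field_char_0"
  shows "op_subst ohn_antipode_poly (ohn_TiT :: (ohn_gen, 'k) free) \<in> rel_ideal (ohn_rels hbar)" (is "_ \<in> ?I")
proof (rule Idl_certificate)
  show "tm 1 [] ohn_TiT [] \<in> ?I"
    by (intro Idl_add Idl_mult ohn_Idl)
qed (simp only: ohn_poly_defs ohn_hopf_defs expand_substs, simp only: expand_words;
    rule poly_mapping_eqI; simp only: lookup_words; simp add: field_simps)

lemma ohn_comult_KT: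
  fixes hbar :: "'k::field_char_0"
  shows "subst ohn_comult_poly (ohn_KT :: (ohn_gen, 'k) free) \<in> rel_ideal (square_rels (ohn_rels hbar))" (is "_ \<in> ?I")
proof (rule Idl_certificate)
  show "tm (-1) [Inl OK] (commutator_rel OT OT) [Inr OT] + tm 1 [] (inl ohn_KT) [Inr OT, Inr OT] +
      tm 1 [Inl OT] (commutator_rel OK OT) [Inr OT] + tm 1 [Inl OT] (commutator_rel OT OT) [Inr OT] +
      tm 1 [Inl OT] (commutator_rel OTi OT) [Inr OK] + tm (-1) [] (inl ohn_TTi) [Inr OT, Inr OK] +
      tm (-1) [Inl OTi] (commutator_rel OT OK) [Inr OT] + tm 1 [] (inl ohn_TiT) [Inr OK, Inr OT] +
      tm 1 [] (inr ohn_KT) [] \<in> ?I"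
    by (intro Idl_add Idl_mult ohn_square_Idl)
qed (simp only: ohn_poly_defs ohn_hopf_defs expand_substs, simp only: expand_words;
    rule poly_mapping_eqI; simp only: lookup_words; simp add: field_simps)

lemma ohn_antipode_KT:
  fixes hbar :: "'k::field_char_0"
  shows "op_subst ohn_antipode_poly (ohn_KT :: (ohn_gen, 'k) free) \<in> rel_ideal (ohn_rels hbar)" (is "_ \<in> ?I")
proof (rule Idl_certificate)
  show "tm 1 [OT] ohn_KTi [OTi] + tm 1 [] ohn_TTi [OK, OTi] + tm 1 [] ohn_TTi [OTi, OTi] +
      tm (-1) [] ohn_TiT [OK, OTi] + tm (-1) [] ohn_TTi [] \<in> ?I"
    by (intro Idl_add Idl_mult ohn_Idl)
qed (simp only: ohn_poly_defs ohn_hopf_defs expand_substs, simp only: expand_words;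
    rule poly_mapping_eqI; simp only: lookup_words; simp add: field_simps)

lemma ohn_comult_YT:
  fixes hbar :: "'k::field_char_0"
  shows "subst ohn_comult_poly (ohn_YT hbar) \<in> rel_ideal (square_rels (ohn_rels hbar))" (is "_ \<in> ?I")
proof (rule Idl_certificate)
  show "tm (-hbar / 2) [Inl OK] (commutator_rel OT OT) [Inr OT] +
      tm (-hbar / 2) [Inl OT] (commutator_rel OK OT) [Inr OT] +
      tm (-hbar / 2) [Inl OT] (commutator_rel OTi OT) [Inr OK] +
      tm 1 [Inl OT] (commutator_rel OTi OT) [Inr OY] + tm 1 [Inl OT] (commutator_rel OY OT) [Inr OT] +
      tm (hbar / 2) [] (inl ohn_TTi) [Inr OT, Inr OK] + tm (-1) [] (inl ohn_TTi) [Inr OT, Inr OY] +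
      tm (-hbar / 2) [Inl OTi] (commutator_rel OT OK) [Inr OT] +
      tm (hbar / 2) [] (inl ohn_TiT) [Inr OK, Inr OT] + tm (-1) [Inl OTi] (commutator_rel OT OY) [Inr OT] +
      tm 1 [] (inl ohn_TiT) [Inr OY, Inr OT] + tm (-1) [Inl OY] (commutator_rel OT OT) [Inr OT] +
      tm 1 [] (inl (ohn_YT hbar)) [Inr OT, Inr OT] + tm 1 [] (inr (ohn_YT hbar)) [] \<in> ?I"
    by (intro Idl_add Idl_mult ohn_square_Idl)
qed (simp only: ohn_poly_defs ohn_hopf_defs expand_substs, simp only: expand_words;
    rule poly_mapping_eqI; simp only: lookup_words; simp add: field_simps)

lemma ohn_antipode_YT:
  fixes hbar :: "'k::field_char_0"
  shows "op_subst ohn_antipode_poly (ohn_YT hbar) \<in> rel_ideal (ohn_rels hbar)" (is "_ \<in> ?I")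
proof (rule Idl_certificate)
  show "tm (hbar / 2) [] ohn_TTi [OK, OTi] + tm 1 [OT] (ohn_YTi hbar) [OTi] + tm 1 [] ohn_TTi [OY, OTi] +
      tm (-hbar / 2) [] ohn_TiT [OK, OTi] + tm (-1) [] ohn_TiT [OY, OTi] \<in> ?I"
    by (intro Idl_add Idl_mult ohn_Idl)
qed (simp only: ohn_poly_defs ohn_hopf_defs expand_substs, simp only: expand_words;
    rule poly_mapping_eqI; simp only: lookup_words; simp add: field_simps)

text \<open>Besides [K,Y] \<otimes> T^2 and T^-2 \<otimes> [K,Y], the commutator of the coproducts
  has the mixed terms K T^-1 \<otimes> T Y - T^-1 K \<otimes> Y T and T^-1 Y \<otimes> K T - Y T^-1
  \<otimes> T K. Splitting each product into half an anticommutator and half a commutator, the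
  \<open>hbar\<close> parts of the two differences cancel. What remains is half of (Y T^-1 + T^-1 Y)
  \<otimes> (T^2 - 1) + (T^-2 - 1) \<otimes> (Y T + T Y), and this completes the coproduct of the
  right-hand side.\<close>

lemma ohn_comult_KY:
  fixes hbar :: "'k::field_char_0"
  shows "subst ohn_comult_poly (ohn_KY hbar) \<in> rel_ideal (square_rels (ohn_rels hbar))" (is "_ \<in> ?I")
proof (rule Idl_certificate)
  show "tm (-1) [Inl OK] (commutator_rel OTi OT) [Inr OY] + tm (-1) [Inl OK] (commutator_rel OY OT) [Inr OT] +
      tm 1 [] (inl ohn_KTi) [Inr OT, Inr OY] + tm 1 [] (inl (ohn_KY hbar)) [Inr OT, Inr OT] +
      tm (-1 / 2) [Inl OT] (commutator_rel OTi OT) [Inr OY] +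
      tm (-1 / 2) [Inl OT] (commutator_rel OY OT) [Inr OT] + tm (1 / 2) [] (inl ohn_TTi) [Inr OT, Inr OY] +
      tm (-1) [Inl OTi] (commutator_rel OTi OK) [Inr OY] + tm (-1) [Inl OTi] (commutator_rel OY OK) [Inr OT] +
      tm 1 [Inl OTi, Inl OTi] (inr (ohn_KY hbar)) [] + tm (-1 / 2) [Inl OTi, Inl OTi] (inr (ohn_YT hbar)) [] +
      tm (hbar / 4) [Inl OTi, Inl OTi] (inr ohn_KT) [] +
      tm (-1 / 2) [Inl OTi] (commutator_rel OTi OTi) [Inr OY] +
      tm (-1 / 2) [Inl OTi] (commutator_rel OY OTi) [Inr OT] + tm 1 [Inl OTi, Inl OY] (inr ohn_KT) [] +
      tm (1 / 2) [Inl OTi, Inl OY] (inr ohn_TiT) [] + tm 1 [Inl OTi] (commutator_rel OK OY) [Inr OT] +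
      tm (-1) [Inl OTi, Inl OK] (inr (ohn_YT hbar)) [] + tm (hbar / 2) [Inl OTi, Inl OK] (inr ohn_KT) [] +
      tm (-1 / 2) [Inl OTi] (commutator_rel OT OY) [Inr OT] + tm (1 / 2) [] (inl ohn_TiT) [Inr OY, Inr OT] +
      tm 1 [Inl OTi] (commutator_rel OTi OY) [Inr OK] +
      tm (-1 / 2) [Inl OTi] (commutator_rel OTi OY) [Inr OTi] + tm 1 [Inl OY] (commutator_rel OK OT) [Inr OT] +
      tm (-1 / 2) [Inl OY] (commutator_rel OT OT) [Inr OT] + tm 1 [Inl OY] (commutator_rel OTi OT) [Inr OK] +
      tm (-1 / 2) [Inl OY] (commutator_rel OTi OT) [Inr OTi] +
      tm (-1) [] (inl (ohn_YTi hbar)) [Inr OT, Inr OK] + tm (-hbar / 2) [] (inl ohn_KTi) [Inr OT, Inr OK] +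
      tm (-1 / 2) [] (inl (ohn_YTi hbar)) [Inr OT, Inr OT] + tm (-hbar / 4) [] (inl ohn_KTi) [Inr OT, Inr OT] +
      tm (1 / 2) [] (inl (ohn_YTi hbar)) [Inr OT, Inr OTi] + tm (hbar / 4) [] (inl ohn_KTi) [Inr OT, Inr OTi] +
      tm (hbar / 2) [Inl OTi, Inl OK] (inr ohn_TTi) [] + tm (hbar / 4) [Inl OTi, Inl OTi] (inr ohn_TTi) [] +
      tm (1 / 2) [Inl OTi, Inl OY] (inr ohn_TTi) [] + tm (-hbar / 4) [] (inr ohn_TTi) [] +
      tm (1 / 2) [] (inr (ohn_YT hbar)) [] + tm (-hbar / 4) [] (inr ohn_KT) [] \<in> ?I"
    by (intro Idl_add Idl_mult ohn_square_Idl)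
qed (simp only: ohn_poly_defs ohn_hopf_defs expand_substs, simp only: expand_words;
    rule poly_mapping_eqI; simp only: lookup_words; simp add: field_simps)

lemma ohn_antipode_KY:
  fixes hbar :: "'k::field_char_0"
  shows "op_subst ohn_antipode_poly (ohn_KY hbar) \<in> rel_ideal (ohn_rels hbar)" (is "_ \<in> ?I")
proof (rule Idl_certificate)
  show "tm (-1) [OT, OK] ohn_TiT [OY, OTi] + tm 1 [OT, OY] ohn_TiT [OK, OTi] + tm (-1) [OT] (ohn_KY hbar) [OTi] +
      tm (1 / 2) [] ohn_TTi [OY, OTi] + tm (1 / 2) [OT, OY] ohn_TTi [] + tm (-1 / 2) [OT, OY] ohn_TiT [] +
      tm (-1 / 2) [] ohn_TiT [OY, OTi] \<in> ?I"
    by (intro Idl_add Idl_mult ohn_Idl)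
qed (simp only: ohn_poly_defs ohn_hopf_defs expand_substs, simp only: expand_words;
    rule poly_mapping_eqI; simp only: lookup_words; simp add: field_simps)

section \<open>Antipode axioms for the skew primitive generators of the Ohn algebra\<close>

lemma ohn_antipode_left_K:
  fixes hbar :: "'k::field_char_0"
  shows "ohn_antipode_poly OK * gen OT + gen OT * (gen OK :: (ohn_gen, 'k) free) \<in> rel_ideal (ohn_rels hbar)" (is "_ \<in> ?I")
proof (rule Idl_certificate)
  show "tm (-1) [OT, OK] ohn_TiT [] \<in> ?I"
    by (intro Idl_add Idl_mult ohn_Idl)
qed (simp only: ohn_poly_defs ohn_hopf_defs expand_substs, simp only: expand_words;
    rule poly_mapping_eqI; simp only: lookup_words; simp add: field_simps)

lemma ohn_antipode_right_K:
  fixes hbar :: "'k::field_char_0"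
  shows "gen OK * gen OTi + gen OTi * (ohn_antipode_poly OK :: (ohn_gen, 'k) free) \<in> rel_ideal (ohn_rels hbar)" (is "_ \<in> ?I")
proof (rule Idl_certificate)
  show "tm (-1) [] ohn_TiT [OK, OTi] \<in> ?I"
    by (intro Idl_add Idl_mult ohn_Idl)
qed (simp only: ohn_poly_defs ohn_hopf_defs expand_substs, simp only: expand_words;
    rule poly_mapping_eqI; simp only: lookup_words; simp add: field_simps)

lemma ohn_antipode_left_Y:
  fixes hbar :: "'k::field_char_0"
  shows "ohn_antipode_poly OY * gen OT + gen OT * (gen OY :: (ohn_gen, 'k) free) \<in> rel_ideal (ohn_rels hbar)" (is "_ \<in> ?I")
proof (rule Idl_certificate)
  show "tm (-1) [OT, OY] ohn_TiT [] \<in> ?I"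
    by (intro Idl_add Idl_mult ohn_Idl)
qed (simp only: ohn_poly_defs ohn_hopf_defs expand_substs, simp only: expand_words;
    rule poly_mapping_eqI; simp only: lookup_words; simp add: field_simps)

lemma ohn_antipode_right_Y:
  fixes hbar :: "'k::field_char_0"
  shows "gen OY * gen OTi + gen OTi * (ohn_antipode_poly OY :: (ohn_gen, 'k) free) \<in> rel_ideal (ohn_rels hbar)" (is "_ \<in> ?I")
proof (rule Idl_certificate)
  show "tm (-1) [] ohn_TiT [OY, OTi] \<in> ?I"
    by (intro Idl_add Idl_mult ohn_Idl)
qed (simp only: ohn_poly_defs ohn_hopf_defs expand_substs, simp only: expand_words;
    rule poly_mapping_eqI; simp only: lookup_words; simp add: field_simps)

interpretation ohn: pres_poly "ohn_rels (hbar :: 'k::field_char_0)" ohn_comult_poly "case_ohn_gen 0 0 1 1" ohn_antipode_poly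
  for hbar
proof
  fix r assume "r \<in> ohn_rels hbar"
  then consider "r = ohn_TTi" | "r = ohn_TiT" | "r = ohn_KT" | "r = ohn_YT hbar" | "r = ohn_KY hbar"
    by (auto simp: ohn_rels_eq)
  note r = this
  show "subst ohn_comult_poly r \<in> rel_ideal (square_rels (ohn_rels hbar))"
    using r by cases (simp_all only: ohn_comult_TTi ohn_comult_TiT ohn_comult_KT ohn_comult_YT ohn_comult_KY)
  show "op_subst ohn_antipode_poly r \<in> rel_ideal (ohn_rels hbar)"
    using r by cases (simp_all only: ohn_antipode_TTi ohn_antipode_TiT ohn_antipode_KT ohn_antipode_YT ohn_antipode_KY)
  show "free_eval base_alg (case_ohn_gen 0 0 1 1) r = 0"
    using r by cases (simp_all add: ohn_poly_defs)
qed

text \<open>The definition gives the structure maps by tensors of classes. Rewritten as values of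
  polynomials, they fall under the interpretation above.\<close>

lemma ohn_eq: "ohn hbar = pres_hopf (ohn_rels hbar) (\<lambda>x. square_eval (ohn_rels hbar) (ohn_comult_poly x)) (case_ohn_gen 0 0 1 1)
    (\<lambda>x. pres_class (ohn_rels hbar) (ohn_antipode_poly x))"
proof -
  have "(\<lambda>x. square_eval (ohn_rels hbar) (ohn_comult_poly x)) = case_ohn_gen
      (square_eval (ohn_rels hbar) (skew_poly (gen OTi) (gen OT) (gen OK)))
      (square_eval (ohn_rels hbar) (skew_poly (gen OTi) (gen OT) (gen OY)))
      (square_eval (ohn_rels hbar) (group_poly (gen OT))) (square_eval (ohn_rels hbar) (group_poly (gen OTi)))"
    "(\<lambda>x. pres_class (ohn_rels hbar) (ohn_antipode_poly x)) = case_ohn_gen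
      (pres_class (ohn_rels hbar) (- (gen OT * gen OK * gen OTi))) (pres_class (ohn_rels hbar) (- (gen OT * gen OY * gen OTi)))
      (pres_class (ohn_rels hbar) (gen OTi)) (pres_class (ohn_rels hbar) (gen OT))"
    by (auto simp: ohn_comult_poly_def ohn_antipode_poly_def fun_eq_iff split: ohn_gen.split)
  then show ?thesis
    by (simp add: ohn_def ohn_cls_def Let_def skew_prim_comult_class grouplike_comult_class)
qed

lemma hopf_algebra_ohn: "hopf_algebra (ohn (hbar :: 'k::field_char_0))"
  unfolding ohn_eq
proof (rule ohn.hopf_algebra_pres_hopf, goal_cases)
  case (1 x)
  show ?case
  proof (cases x)
    case OK
    show ?thesis unfolding OK
      by (rule disjI2, rule ohn.skew_gen_poly[of _ "gen OTi" "gen OT"])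
        (use ohn_antipode_left_K ohn_antipode_right_K in \<open>simp_all add: ohn_comult_poly_def ohn_antipode_poly_def\<close>)
  next
    case OY
    show ?thesis unfolding OY
      by (rule disjI2, rule ohn.skew_gen_poly[of _ "gen OTi" "gen OT"])
        (use ohn_antipode_left_Y ohn_antipode_right_Y in \<open>simp_all add: ohn_comult_poly_def ohn_antipode_poly_def\<close>)
  next
    case OT
    show ?thesis unfolding OT
      by (rule disjI1, rule ohn.group_gen_poly)
        (use ohn_Idl_base in \<open>simp_all add: ohn_comult_poly_def ohn_antipode_poly_def ohn_TTi_def ohn_TiT_def\<close>)
  next
    case OTi
    show ?thesis unfolding OTi
      by (rule disjI1, rule ohn.group_gen_poly)
        (use ohn_Idl_base in \<open>simp_all add: ohn_comult_poly_def ohn_antipode_poly_def ohn_TTi_def ohn_TiT_def\<close>)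
  qed
qed

section \<open>The Hopf algebras of Jordan type\<close>

definition jordan_GGi :: "(jordan_gen, 'k::field) free" where "jordan_GGi = gen JG * gen JGi - 1"
definition jordan_GiG :: "(jordan_gen, 'k::field) free" where "jordan_GiG = gen JGi * gen JG - 1"
definition jordan_GA1 :: "(jordan_gen, 'k::field) free" where
  "jordan_GA1 = gen JG * gen JA1 - (gen JA1 * gen JG + (gen JG - gen JG * gen JG))"
definition jordan_GA2 :: "(jordan_gen, 'k::field) free" where
  "jordan_GA2 = gen JG * gen JA2 - (gen JA2 * gen JG + gen JA1 * gen JG)"
text \<open>\<open>jordan_GiA1\<close> and \<open>jordan_GiA2\<close> arise from
  \<open>jordan_GA1\<close> and \<open>jordan_GA2\<close> by multiplying with \<open>g^-1\<close> on
  both sides and changing the sign. They move \<open>g^-1\<close> past \<open>a1\<close> and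
  \<open>a2\<close>.\<close>

definition jordan_GiA1 :: "(jordan_gen, 'k::field) free" where
  "jordan_GiA1 = gen JGi * gen JA1 - gen JA1 * gen JGi + gen JGi - 1"
definition jordan_GiA2 :: "(jordan_gen, 'k::field) free" where
  "jordan_GiA2 = gen JGi * gen JA2 - gen JA2 * gen JGi + gen JGi * gen JA1"
definition jordan_zl :: "'k::field \<Rightarrow> (jordan_gen, 'k) free" where
  "jordan_zl lam = jordan_z - cst lam * (1 - gen JG * gen JG)"

lemma jordan_zl_eq: "jordan_zl lam = gen JA1 * gen JA2 - gen JA2 * gen JA1 - cst (1 / 2) * (gen JA1 * gen JA1)
    + gen JA2 + cst (1 / 2) * gen JA1 - cst lam * (1 - gen JG * gen JG)"
  by (simp add: jordan_zl_def jordan_z_def Let_def)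

lemmas jordan_poly_defs = jordan_GGi_def jordan_GiG_def jordan_GA1_def jordan_GA2_def jordan_GiA1_def jordan_GiA2_def jordan_zl_eq

lemma jordan_rels_eq: "jordan_rels = {jordan_GGi, jordan_GiG, jordan_GA1, jordan_GA2}"
  by (simp add: jordan_rels_def jordan_poly_defs Let_def)

lemma jordan_Idl_base:
  "jordan_GGi \<in> rel_ideal jordan_rels" "jordan_GiG \<in> rel_ideal jordan_rels"
  "jordan_GA1 \<in> rel_ideal jordan_rels" "jordan_GA2 \<in> rel_ideal jordan_rels"
  by (rule Idl_base, simp add: jordan_rels_eq)+

lemma jordan_GiA1_Idl:
  "(jordan_GiA1 :: (jordan_gen, 'k::field_char_0) free) \<in> rel_ideal jordan_rels" (is "_ \<in> ?I")
proof (rule Idl_certificate)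
  show "tm (-1) [JGi, JA1] jordan_GGi [] + tm 1 [] jordan_GiG [JA1, JGi] + tm 1 [JGi, JG] jordan_GGi [] +
      tm (-1) [JGi] jordan_GGi [] + tm 1 [] jordan_GiG [] + tm (-1) [JGi] jordan_GA1 [JGi] \<in> ?I"
    by (intro Idl_add Idl_mult jordan_Idl_base)
qed (simp only: jordan_poly_defs expand_substs, simp only: expand_words;
    rule poly_mapping_eqI; simp only: lookup_words; simp add: field_simps)

lemma jordan_GiA2_Idl:
  "(jordan_GiA2 :: (jordan_gen, 'k::field_char_0) free) \<in> rel_ideal jordan_rels" (is "_ \<in> ?I")
proof (rule Idl_certificate)
  show "tm (-1) [JGi, JA1] jordan_GGi [] + tm (-1) [JGi, JA2] jordan_GGi [] + tm 1 [] jordan_GiG [JA2, JGi] +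
      tm (-1) [JGi] jordan_GA2 [JGi] \<in> ?I"
    by (intro Idl_add Idl_mult jordan_Idl_base)
qed (simp only: jordan_poly_defs expand_substs, simp only: expand_words;
    rule poly_mapping_eqI; simp only: lookup_words; simp add: field_simps)

lemmas jordan_Idl = jordan_Idl_base jordan_GiA1_Idl jordan_GiA2_Idl
lemmas jordan_square_Idl = jordan_Idl[THEN Idl_inl] jordan_Idl[THEN Idl_inr] Idl_commutator

section \<open>Structure maps of the Jordan type algebra as noncommutative polynomials\<close>

definition jordan_comult_poly :: "jordan_gen \<Rightarrow> (jordan_gen + jordan_gen, 'k::field) free" where
  "jordan_comult_poly = case_jordan_gen (skew_poly (gen JG) 1 (gen JA1)) (skew_poly (gen JG) 1 (gen JA2))
     (group_poly (gen JG)) (group_poly (gen JGi))"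

definition jordan_antipode_poly :: "jordan_gen \<Rightarrow> (jordan_gen, 'k::field) free" where
  "jordan_antipode_poly = case_jordan_gen (- (gen JGi * gen JA1)) (- (gen JGi * gen JA2)) (gen JGi) (gen JG)"

lemmas jordan_hopf_defs = jordan_comult_poly_def jordan_antipode_poly_def jordan_gen.case skew_poly_def group_poly_def

lemma jordan_comult_GGi:
  "subst jordan_comult_poly (jordan_GGi :: (jordan_gen, 'k::field_char_0) free) \<in> rel_ideal (square_rels jordan_rels)" (is "_ \<in> ?I")
proof (rule Idl_certificate)
  show "tm (-1) [Inl JG] (commutator_rel JGi JG) [Inr JGi] + tm 1 [] (inl jordan_GGi) [Inr JG, Inr JGi] +
      tm 1 [] (inr jordan_GGi) [] \<in> ?I"
    by (intro Idl_add Idl_mult jordan_square_Idl)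
qed (simp only: jordan_poly_defs jordan_hopf_defs expand_substs, simp only: expand_words;
    rule poly_mapping_eqI; simp only: lookup_words; simp add: field_simps)

lemma jordan_antipode_GGi:
  "op_subst jordan_antipode_poly (jordan_GGi :: (jordan_gen, 'k::field_char_0) free) \<in> rel_ideal jordan_rels" (is "_ \<in> ?I")
proof (rule Idl_certificate)
  show "tm 1 [] jordan_GGi [] \<in> ?I"
    by (intro Idl_add Idl_mult jordan_Idl)
qed (simp only: jordan_poly_defs jordan_hopf_defs expand_substs, simp only: expand_words;
    rule poly_mapping_eqI; simp only: lookup_words; simp add: field_simps)

lemma jordan_comult_GiG:
  "subst jordan_comult_poly (jordan_GiG :: (jordan_gen, 'k::field_char_0) free) \<in> rel_ideal (square_rels jordan_rels)" (is "_ \<in> ?I")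
proof (rule Idl_certificate)
  show "tm (-1) [Inl JGi] (commutator_rel JG JGi) [Inr JG] + tm 1 [] (inl jordan_GiG) [Inr JGi, Inr JG] +
      tm 1 [] (inr jordan_GiG) [] \<in> ?I"
    by (intro Idl_add Idl_mult jordan_square_Idl)
qed (simp only: jordan_poly_defs jordan_hopf_defs expand_substs, simp only: expand_words;
    rule poly_mapping_eqI; simp only: lookup_words; simp add: field_simps)

lemma jordan_antipode_GiG:
  "op_subst jordan_antipode_poly (jordan_GiG :: (jordan_gen, 'k::field_char_0) free) \<in> rel_ideal jordan_rels" (is "_ \<in> ?I")
proof (rule Idl_certificate)
  show "tm 1 [] jordan_GiG [] \<in> ?I"
    by (intro Idl_add Idl_mult jordan_Idl)
qed (simp only: jordan_poly_defs jordan_hopf_defs expand_substs, simp only: expand_words;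
    rule poly_mapping_eqI; simp only: lookup_words; simp add: field_simps)

lemma jordan_comult_GA1:
  "subst jordan_comult_poly (jordan_GA1 :: (jordan_gen, 'k::field_char_0) free) \<in> rel_ideal (square_rels jordan_rels)" (is "_ \<in> ?I")
proof (rule Idl_certificate)
  show "tm 1 [Inl JG] (commutator_rel JG JA1) [Inr JG] + tm 1 [Inl JG, Inl JG] (inr jordan_GA1) [] +
      tm (-1) [Inl JG] (commutator_rel JG JG) [Inr JA1] + tm (-1) [Inl JG] (commutator_rel JG JG) [Inr JG] +
      tm 1 [] (inl jordan_GA1) [Inr JG] + tm (-1) [Inl JG] (commutator_rel JA1 JG) [] \<in> ?I"
    by (intro Idl_add Idl_mult jordan_square_Idl)
qed (simp only: jordan_poly_defs jordan_hopf_defs expand_substs, simp only: expand_words;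
    rule poly_mapping_eqI; simp only: lookup_words; simp add: field_simps)

lemma jordan_antipode_GA1:
  "op_subst jordan_antipode_poly (jordan_GA1 :: (jordan_gen, 'k::field_char_0) free) \<in> rel_ideal jordan_rels" (is "_ \<in> ?I")
proof (rule Idl_certificate)
  show "tm 1 [JGi] jordan_GiA1 [] \<in> ?I"
    by (intro Idl_add Idl_mult jordan_Idl)
qed (simp only: jordan_poly_defs jordan_hopf_defs expand_substs, simp only: expand_words;
    rule poly_mapping_eqI; simp only: lookup_words; simp add: field_simps)

lemma jordan_comult_GA2:
  "subst jordan_comult_poly (jordan_GA2 :: (jordan_gen, 'k::field_char_0) free) \<in> rel_ideal (square_rels jordan_rels)" (is "_ \<in> ?I")
proof (rule Idl_certificate)
  show "tm 1 [Inl JG] (commutator_rel JG JA1) [Inr JG] + tm 1 [Inl JG] (commutator_rel JG JA2) [Inr JG] +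
      tm 1 [Inl JG, Inl JG] (inr jordan_GA2) [] + tm (-1) [Inl JG] (commutator_rel JG JG) [Inr JA2] +
      tm 1 [] (inl jordan_GA2) [Inr JG] + tm (-1) [Inl JG] (commutator_rel JA2 JG) [] \<in> ?I"
    by (intro Idl_add Idl_mult jordan_square_Idl)
qed (simp only: jordan_poly_defs jordan_hopf_defs expand_substs, simp only: expand_words;
    rule poly_mapping_eqI; simp only: lookup_words; simp add: field_simps)

lemma jordan_antipode_GA2:
  "op_subst jordan_antipode_poly (jordan_GA2 :: (jordan_gen, 'k::field_char_0) free) \<in> rel_ideal jordan_rels" (is "_ \<in> ?I")
proof (rule Idl_certificate)
  show "tm 1 [JGi] jordan_GiA2 [] \<in> ?I"
    by (intro Idl_add Idl_mult jordan_Idl)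
qed (simp only: jordan_poly_defs jordan_hopf_defs expand_substs, simp only: expand_words;
    rule poly_mapping_eqI; simp only: lookup_words; simp add: field_simps)

text \<open>With antipode value \<open>- g^-1 a1\<close> and second group-like 1, the two terms
  cancel in the free algebra already, and the certificate is empty.\<close>

lemma jordan_antipode_left_JA1:
  "jordan_antipode_poly JA1 * 1 + gen JGi * (gen JA1 :: (jordan_gen, 'k::field_char_0) free) \<in> rel_ideal jordan_rels"
proof -
  have "jordan_antipode_poly JA1 * 1 + gen JGi * (gen JA1 :: (jordan_gen, 'k::field_char_0) free) = 0"
    by (simp only: jordan_poly_defs jordan_hopf_defs expand_substs, simp only: expand_words, simp)
  then show ?thesis by (simp only: Idl_zero)
qed

lemma jordan_antipode_right_JA1:
  "gen JA1 * 1 + gen JG * (jordan_antipode_poly JA1 :: (jordan_gen, 'k::field_char_0) free) \<in> rel_ideal jordan_rels" (is "_ \<in> ?I")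
proof (rule Idl_certificate)
  show "tm (-1) [] jordan_GGi [JA1] \<in> ?I"
    by (intro Idl_add Idl_mult jordan_Idl)
qed (simp only: jordan_poly_defs jordan_hopf_defs expand_substs, simp only: expand_words;
    rule poly_mapping_eqI; simp only: lookup_words; simp add: field_simps)

lemma jordan_antipode_left_JA2:
  "jordan_antipode_poly JA2 * 1 + gen JGi * (gen JA2 :: (jordan_gen, 'k::field_char_0) free) \<in> rel_ideal jordan_rels"
proof -
  have "jordan_antipode_poly JA2 * 1 + gen JGi * (gen JA2 :: (jordan_gen, 'k::field_char_0) free) = 0"
    by (simp only: jordan_poly_defs jordan_hopf_defs expand_substs, simp only: expand_words, simp)
  then show ?thesis by (simp only: Idl_zero)
qed

lemma jordan_antipode_right_JA2:
  "gen JA2 * 1 + gen JG * (jordan_antipode_poly JA2 :: (jordan_gen, 'k::field_char_0) free) \<in> rel_ideal jordan_rels" (is "_ \<in> ?I")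
proof (rule Idl_certificate)
  show "tm (-1) [] jordan_GGi [JA2] \<in> ?I"
    by (intro Idl_add Idl_mult jordan_Idl)
qed (simp only: jordan_poly_defs jordan_hopf_defs expand_substs, simp only: expand_words;
    rule poly_mapping_eqI; simp only: lookup_words; simp add: field_simps)

text \<open>Modulo the relations the element is skew primitive of type \<open>(g^2, 1)\<close>. The
  mixed terms of the commutator of \<open>a1\<close>, \<open>a2\<close> are a1 g \<otimes> a1 - (g -
  g^2) \<otimes> a2. The term \<open>- a1^2 / 2\<close> of \<open>z\<close> turns the first into -(g
  - g^2)/2 \<otimes> a1, and \<open>a2 + a1 / 2\<close> cancels what is left. The element
  \<open>1 - g^2\<close> has the same type.\<close>

lemma jordan_comult_zl:
  fixes lam :: "'k::field_char_0"
  shows "subst jordan_comult_poly (jordan_zl lam) - (inl (jordan_zl lam) + inl (gen JG * gen JG) * inr (jordan_zl lam)) \<in> rel_ideal (square_rels jordan_rels)" (is "_ \<in> ?I")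
proof (rule Idl_certificate)
  show "tm (1 / 2) [Inl JG] (commutator_rel JG JA1) [Inr JA1] +
      tm (-1) [Inl JG] (commutator_rel JG JA1) [Inr JA2] + tm 1 [Inl JG] (commutator_rel JG JA2) [Inr JA1] +
      tm (-lam) [Inl JG] (commutator_rel JG JG) [Inr JG] + tm (-1 / 2) [] (inl jordan_GA1) [Inr JA1] +
      tm (-1) [] (inl jordan_GA1) [Inr JA2] + tm 1 [] (inl jordan_GA2) [Inr JA1] +
      tm (1 / 2) [Inl JG] (commutator_rel JA1 JA1) [] + tm (-1) [Inl JG] (commutator_rel JA2 JA1) [] +
      tm 1 [Inl JG] (commutator_rel JA1 JA2) [] \<in> ?I"
    by (intro Idl_add Idl_mult jordan_square_Idl)
qed (simp only: jordan_poly_defs jordan_hopf_defs expand_substs, simp only: expand_words;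
    rule poly_mapping_eqI; simp only: lookup_words; simp add: field_simps)

text \<open>The factor \<open>- g^-2\<close> is the one that the antipode axiom forces on a skew
  primitive of type \<open>(g^2, 1)\<close>.\<close>

lemma jordan_antipode_zl:
  fixes lam :: "'k::field_char_0"
  shows "op_subst jordan_antipode_poly (jordan_zl lam) - (- (gen JGi * gen JGi)) * jordan_zl lam \<in> rel_ideal jordan_rels" (is "_ \<in> ?I")
proof (rule Idl_certificate)
  show "tm (1 / 2) [JGi] jordan_GiA1 [JA1] + tm 1 [JGi] jordan_GiA1 [JA2] + tm (-1) [JGi] jordan_GiA2 [JA1] +
      tm lam [JGi] jordan_GiG [JG] + tm lam [] jordan_GiG [] \<in> ?I"
    by (intro Idl_add Idl_mult jordan_Idl)
qed (simp only: jordan_poly_defs jordan_hopf_defs expand_substs, simp only: expand_words;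
    rule poly_mapping_eqI; simp only: lookup_words; simp add: field_simps)

interpretation jordan: pres_poly "jordan_rels :: (jordan_gen, 'k::field_char_0) free set" jordan_comult_poly "case_jordan_gen 0 0 1 1"
  jordan_antipode_poly
proof
  fix r :: "(jordan_gen, 'k) free" assume "r \<in> jordan_rels"
  then consider "r = jordan_GGi" | "r = jordan_GiG" | "r = jordan_GA1" | "r = jordan_GA2"
    by (auto simp: jordan_rels_eq)
  note r = this
  show "subst jordan_comult_poly r \<in> rel_ideal (square_rels jordan_rels)"
    using r by cases (simp_all only: jordan_comult_GGi jordan_comult_GiG jordan_comult_GA1 jordan_comult_GA2)
  show "op_subst jordan_antipode_poly r \<in> rel_ideal jordan_rels"
    using r by cases (simp_all only: jordan_antipode_GGi jordan_antipode_GiG jordan_antipode_GA1 jordan_antipode_GA2)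
  show "free_eval base_alg (case_jordan_gen 0 0 1 1) r = 0"
    using r by cases (simp_all add: jordan_poly_defs)
qed

lemma jordan_tilde_eq: "(jordan_tilde :: ('k::field, _) hopf) = pres_hopf jordan_rels (\<lambda>x. square_eval jordan_rels (jordan_comult_poly x))
    (case_jordan_gen 0 0 1 1) (\<lambda>x. pres_class jordan_rels (jordan_antipode_poly x))"
proof -
  have "(\<lambda>x. square_eval (jordan_rels :: (jordan_gen, 'k) free set) (jordan_comult_poly x)) = case_jordan_gen
      (square_eval jordan_rels (skew_poly (gen JG) 1 (gen JA1)))
      (square_eval jordan_rels (skew_poly (gen JG) 1 (gen JA2)))
      (square_eval jordan_rels (group_poly (gen JG))) (square_eval jordan_rels (group_poly (gen JGi)))"
    "(\<lambda>x. pres_class (jordan_rels :: (jordan_gen, 'k) free set) (jordan_antipode_poly x)) = case_jordan_gen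
      (pres_class jordan_rels (- (gen JGi * gen JA1))) (pres_class jordan_rels (- (gen JGi * gen JA2)))
      (pres_class jordan_rels (gen JGi)) (pres_class jordan_rels (gen JG))"
    by (auto simp: jordan_comult_poly_def jordan_antipode_poly_def fun_eq_iff split: jordan_gen.split)
  then show ?thesis
    by (simp add: jordan_tilde_def jordan_cls_def Let_def skew_prim_comult_class grouplike_comult_class)
qed

lemma hopf_algebra_jordan_tilde: "hopf_algebra (jordan_tilde :: ('k::field_char_0, _) hopf)"
  unfolding jordan_tilde_eq
proof (rule jordan.hopf_algebra_pres_hopf, goal_cases)
  case (1 x)
  show ?case
  proof (cases x)
    case JA1
    show ?thesis unfolding JA1
      by (rule disjI2, rule jordan.skew_gen_poly[of _ "gen JG" 1])
        (use jordan_antipode_left_JA1 jordan_antipode_right_JA1 in \<open>simp_all add: jordan_comult_poly_def jordan_antipode_poly_def group_poly_def\<close>)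
  next
    case JA2
    show ?thesis unfolding JA2
      by (rule disjI2, rule jordan.skew_gen_poly[of _ "gen JG" 1])
        (use jordan_antipode_left_JA2 jordan_antipode_right_JA2 in \<open>simp_all add: jordan_comult_poly_def jordan_antipode_poly_def group_poly_def\<close>)
  next
    case JG
    show ?thesis unfolding JG
      by (rule disjI1, rule jordan.group_gen_poly)
        (use jordan_Idl_base in \<open>simp_all add: jordan_comult_poly_def jordan_antipode_poly_def jordan_GGi_def jordan_GiG_def\<close>)
  next
    case JGi
    show ?thesis unfolding JGi
      by (rule disjI1, rule jordan.group_gen_poly)
        (use jordan_Idl_base in \<open>simp_all add: jordan_comult_poly_def jordan_antipode_poly_def jordan_GGi_def jordan_GiG_def\<close>)
  qed
qed

section \<open>Hopf ideals and quotients\<close>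

text \<open>The preimage of an ideal is an ideal, seen here by composing with the projection modulo
  \<open>J\<close>. It is applied to the comultiplication, and to the antipode as an algebra map
  into the opposite algebra.\<close>

lemma alg_hom_preimage_genideal:
  assumes A: "k_algebra A" and B: "k_algebra B" and f: "f \<in> alg_hom A B" and J: "ideal J B"
    and S: "S \<subseteq> carrier A" "\<And>s. s \<in> S \<Longrightarrow> f s \<in> J" and a: "a \<in> Idl\<^bsub>A\<^esub> S"
  shows "f a \<in> J"
proof -
  interpret J: alg_ideal B J using B J by (simp add: alg_ideal_def)
  interpret A: k_algebra A by fact
  note f1 = alg_homD(1)[OF f]
  have a': "a \<in> carrier A" using a ideal.Icarr[OF A.genideal_ideal[OF S(1)]] by blast
  have "J.proj (f a) = \<zero>\<^bsub>alg_quot B J\<^esub>"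
    using S f1 by (intro alg_hom_genideal_zero[OF A J.k_algebra_alg_quot alg_hom_comp[OF f J.proj_hom] S(1) _ a])
      (auto simp: J.proj_eq_zero_iff)
  then show ?thesis using f1[OF a'] by (simp add: J.proj_eq_zero_iff)
qed

lemma ideal_op_alg:
  assumes "ideal I A" "k_algebra (A :: ('k::field, 'a) module)" shows "ideal I (op_alg A)"
proof -
  interpret I: ideal I A by fact
  interpret O: k_algebra "op_alg A" by (rule k_algebra_op_alg[OF assms(2)])
  have "add_monoid (op_alg A) = add_monoid A" by (simp add: op_alg_def)
  then show ?thesis
    using I.a_subgroup by (intro idealI O.ring_axioms) (auto simp: I.I_l_closed I.I_r_closed)
qed

text \<open>The additive subgroup generated by this set is the usual I \<otimes> H + H \<otimes> I,
  as a subset of H \<otimes> H.\<close>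

definition mixed_tensors :: "('k::field, 'a, 'm) module_scheme \<Rightarrow> 'a set \<Rightarrow> (('a \<times> 'a) \<Rightarrow>\<^sub>0 'k) set set" where
  "mixed_tensors H I = {tens H H i a | i a. i \<in> I \<and> a \<in> carrier H} \<union> {tens H H a i | i a. i \<in> I \<and> a \<in> carrier H}"

context
  fixes H :: "('k::field, 'a, 'm) module_scheme" and I
  assumes H: "k_algebra H" and I: "ideal I H"
begin

interpretation H: k_algebra H by (rule H)
interpretation I: ideal I H by (rule I)
interpretation T: k_algebra "tensor H H" by (rule k_algebra_tensor[OF H H])

private abbreviation "TH \<equiv> tensor H H"
private abbreviation "JH \<equiv> generate (add_monoid TH) (mixed_tensors H I)"

lemma mixed_tensors_subset: "mixed_tensors H I \<subseteq> carrier TH"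
  by (auto simp: mixed_tensors_def I.Icarr intro: tens_closed[OF H H])

lemma mixed_tensorsI:
  "i \<in> I \<Longrightarrow> a \<in> carrier H \<Longrightarrow> tens H H i a \<in> mixed_tensors H I"
  "i \<in> I \<Longrightarrow> a \<in> carrier H \<Longrightarrow> tens H H a i \<in> mixed_tensors H I"
  by (auto simp: mixed_tensors_def)

lemma mixed_tensors_mult:
  assumes m: "m \<in> mixed_tensors H I" and x: "x \<in> carrier H" "y \<in> carrier H"
  shows "tens H H x y \<otimes>\<^bsub>TH\<^esub> m \<in> mixed_tensors H I" "m \<otimes>\<^bsub>TH\<^esub> tens H H x y \<in> mixed_tensors H I"
proof -
  consider i a where "i \<in> I" "a \<in> carrier H" "m = tens H H i a" | i a where "i \<in> I" "a \<in> carrier H" "m = tens H H a i"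
    using m unfolding mixed_tensors_def by blast
  then show "tens H H x y \<otimes>\<^bsub>TH\<^esub> m \<in> mixed_tensors H I" "m \<otimes>\<^bsub>TH\<^esub> tens H H x y \<in> mixed_tensors H I"
    using x by (cases; simp add: tens_mult[OF H H] mixed_tensorsI I.I_l_closed I.I_r_closed I.Icarr)+
qed

text \<open>Pure tensors map the generating set into itself from both sides, and additivity does the
  rest. Being an ideal, the set can be pulled back along the comultiplication, so that a Hopf ideal
  is recognised on ideal generators.\<close>

lemma ideal_mixed_tensors: "ideal JH TH"
proof (rule idealI)
  show "ring TH" by (rule T.ring_axioms)
  show sg: "subgroup JH (add_monoid TH)"
    by (rule T.add.generate_is_subgroup) (simp add: mixed_tensors_subset)
  note addJ = subgroup.m_closed[OF sg, simplified] and zeroJ = subgroup.one_closed[OF sg, simplified]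
  have inv: "\<ominus>\<^bsub>TH\<^esub> j \<in> JH" if "j \<in> JH" for j using subgroup.m_inv_closed[OF sg that] by (simp add: a_inv_def)
  have carr: "j \<in> carrier TH" if "j \<in> JH" for j using subgroup.mem_carrier[OF sg that] by simp
  have mult: "t \<otimes>\<^bsub>TH\<^esub> m \<in> JH \<and> m \<otimes>\<^bsub>TH\<^esub> t \<in> JH" if m: "m \<in> mixed_tensors H I" and t: "t \<in> carrier TH" for m t
    using t
  proof (induction rule: tensor_induct[OF H H, consumes 1, case_names zero add])
    case zero
    then show ?case using subsetD[OF mixed_tensors_subset m] zeroJ by simp
  next
    case (add a b t)
    then show ?case
      using m mixed_tensors_subset mixed_tensors_mult[OF m, of a b] tens_closed[OF H H, of a b] T.l_distr T.r_distr
        subgroup.m_closed[OF sg] generate.incl[of _ "mixed_tensors H I" "add_monoid TH"]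
      by (auto simp: subset_iff)
  qed
  show "t \<otimes>\<^bsub>TH\<^esub> j \<in> JH" if j: "j \<in> JH" and t: "t \<in> carrier TH" for j t
    using j
  proof (induction rule: generate.induct)
    case one then show ?case using t zeroJ by simp
  next
    case (incl h) then show ?case using mult t by blast
  next
    case (inv h)
    then have h: "h \<in> carrier TH" using mixed_tensors_subset by blast
    then have "t \<otimes>\<^bsub>TH\<^esub> (\<ominus>\<^bsub>TH\<^esub> h) = \<ominus>\<^bsub>TH\<^esub> (t \<otimes>\<^bsub>TH\<^esub> h)" using t by (simp add: T.r_minus)
    then show ?case using \<open>\<And>j. j \<in> JH \<Longrightarrow> \<ominus>\<^bsub>TH\<^esub> j \<in> JH\<close>[of "t \<otimes>\<^bsub>TH\<^esub> h"] mult[OF inv t] by (simp add: a_inv_def)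
  next
    case (eng h1 h2)
    then show ?case using addJ[of "t \<otimes>\<^bsub>TH\<^esub> h1" "t \<otimes>\<^bsub>TH\<^esub> h2"] carr[of h1] carr[of h2] t by (simp add: T.r_distr)
  qed
  show "j \<otimes>\<^bsub>TH\<^esub> t \<in> JH" if j: "j \<in> JH" and t: "t \<in> carrier TH" for j t
    using j
  proof (induction rule: generate.induct)
    case one then show ?case using t zeroJ by simp
  next
    case (incl h) then show ?case using mult t by blast
  next
    case (inv h)
    then have h: "h \<in> carrier TH" using mixed_tensors_subset by blast
    then have "(\<ominus>\<^bsub>TH\<^esub> h) \<otimes>\<^bsub>TH\<^esub> t = \<ominus>\<^bsub>TH\<^esub> (h \<otimes>\<^bsub>TH\<^esub> t)" using t by (simp add: T.l_minus)
    then show ?case using \<open>\<And>j. j \<in> JH \<Longrightarrow> \<ominus>\<^bsub>TH\<^esub> j \<in> JH\<close>[of "h \<otimes>\<^bsub>TH\<^esub> t"] mult[OF inv t] by (simp add: a_inv_def)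
  next
    case (eng h1 h2)
    then show ?case using addJ[of "h1 \<otimes>\<^bsub>TH\<^esub> t" "h2 \<otimes>\<^bsub>TH\<^esub> t"] carr[of h1] carr[of h2] t by (simp add: T.l_distr)
  qed
qed

text \<open>I \<otimes> H + H \<otimes> I lies in the kernel of \<pi> \<otimes> \<pi>; by this the
  comultiplication descends to the quotient.\<close>

lemma tensor_map_proj_mixed:
  assumes j: "j \<in> JH"
  shows "tensor_map (alg_quot H I) (alg_quot H I) (\<lambda>a. I +>\<^bsub>H\<^esub> a) (\<lambda>a. I +>\<^bsub>H\<^esub> a) j = \<zero>\<^bsub>tensor (alg_quot H I) (alg_quot H I)\<^esub>"
proof -
  interpret Q: alg_ideal H I using H I by (simp add: alg_ideal_def)
  let ?Q = "alg_quot H I" and ?\<pi> = "\<lambda>a. I +>\<^bsub>H\<^esub> a"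
  note Q = Q.k_algebra_alg_quot
  interpret TQ: k_algebra "tensor ?Q ?Q" by (rule k_algebra_tensor[OF Q Q])
  interpret QQ: k_algebra ?Q by (rule Q)
  note pl = alg_hom_linear[OF Q.proj_hom]
  note F = tensor_map_linear[OF Q Q H H pl pl]
  have z: "tens ?Q ?Q \<zero>\<^bsub>?Q\<^esub> a = \<zero>\<^bsub>tensor ?Q ?Q\<^esub>" "tens ?Q ?Q a \<zero>\<^bsub>?Q\<^esub> = \<zero>\<^bsub>tensor ?Q ?Q\<^esub>"
    if "a \<in> carrier ?Q" for a
    using tens_bilinear(5)[OF Q Q QQ.zero_closed that, of 0] tens_bilinear(4)[OF Q Q that QQ.zero_closed, of 0]
      tens_closed[OF Q Q] that by simp_all
  have m: "tensor_map ?Q ?Q ?\<pi> ?\<pi> m = \<zero>\<^bsub>tensor ?Q ?Q\<^esub>" if mm: "m \<in> mixed_tensors H I" for m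
  proof -
    consider i a where "i \<in> I" "a \<in> carrier H" "m = tens H H i a" | i a where "i \<in> I" "a \<in> carrier H" "m = tens H H a i"
      using mm unfolding mixed_tensors_def by blast
    then show ?thesis
    proof cases
      case (1 i a)
      have "?\<pi> i = \<zero>\<^bsub>?Q\<^esub>" using Q.proj_eq_zero_iff I.Icarr 1(1) by blast
      then show ?thesis
        unfolding 1(3) tensor_map_tens[OF Q Q H H pl pl I.Icarr[OF 1(1)] 1(2)]
        using z(1)[OF linear_mapsD(1)[OF pl 1(2)]] by simp
    next
      case (2 i a)
      have "?\<pi> i = \<zero>\<^bsub>?Q\<^esub>" using Q.proj_eq_zero_iff I.Icarr 2(1) by blast
      then show ?thesis
        unfolding 2(3) tensor_map_tens[OF Q Q H H pl pl 2(2) I.Icarr[OF 2(1)]]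
        using z(2)[OF linear_mapsD(1)[OF pl 2(2)]] by simp
    qed
  qed
  have "j \<in> carrier TH \<and> tensor_map ?Q ?Q ?\<pi> ?\<pi> j = \<zero>\<^bsub>tensor ?Q ?Q\<^esub>"
    using j
  proof (induction rule: generate.induct)
    case one then show ?case using linear_map_zero[OF T.k_algebra_axioms TQ.k_algebra_axioms F] by simp
  next
    case (incl h) then show ?case using m mixed_tensors_subset by blast
  next
    case (inv h)
    then have "h \<in> carrier TH" using mixed_tensors_subset by blast
    then show ?case
      using m[OF inv] linear_map_minus(1)[OF T.k_algebra_axioms TQ.k_algebra_axioms F, of h] by (simp flip: a_inv_def)
  next
    case (eng h1 h2)
    then show ?case by (simp add: linear_mapsD(2)[OF F])
  qed
  then show ?thesis by simp
qed

end

lemma hopf_ideal_iff: "hopf_ideal I H \<longleftrightarrow> hopf_algebra H \<and> ideal I H \<and>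
    comult H ` I \<subseteq> generate (add_monoid (tensor H H)) (mixed_tensors H I) \<and> counit H ` I \<subseteq> {0} \<and> antipode H ` I \<subseteq> I"
  by (simp add: hopf_ideal_def mixed_tensors_def)

text \<open>Each condition says that an algebra map, possibly into an opposite algebra, sends the
  ideal into an ideal. Therefore it passes from \<open>X\<close> to the ideal generated by
  \<open>X\<close>.\<close>

lemma hopf_ideal_genideal:
  assumes H: "hopf_algebra H" and S: "antipode H \<in> alg_hom H (op_alg (module.truncate H))"
    and X: "X \<subseteq> carrier H"
    and \<Delta>: "\<And>x. x \<in> X \<Longrightarrow> comult H x \<in> generate (add_monoid (tensor H H)) (mixed_tensors H (Idl\<^bsub>H\<^esub> X))"
    and \<epsilon>: "\<And>x. x \<in> X \<Longrightarrow> counit H x = 0" and \<sigma>: "\<And>x. x \<in> X \<Longrightarrow> antipode H x \<in> Idl\<^bsub>H\<^esub> X"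
  shows "hopf_ideal (Idl\<^bsub>H\<^esub> X) H"
proof -
  interpret H: hopf_algebra H by fact
  note K = H.k_algebra_axioms
  have i: "ideal (Idl\<^bsub>H\<^esub> X) H" by (rule H.genideal_ideal[OF X])
  have KT: "k_algebra (module.truncate H)" using K by simp
  \<comment> \<open>\<open>op_alg\<close> takes records without Hopf fields, so the ideal is first
    carried over to the truncated record.\<close>
  have it: "ideal (Idl\<^bsub>H\<^esub> X) (module.truncate H)"
  proof -
    interpret I: alg_ideal H "Idl\<^bsub>H\<^esub> X" using i K by (simp add: alg_ideal_def)
    interpret T: k_algebra "module.truncate H" by (rule KT)
    have "\<ominus>\<^bsub>module.truncate H\<^esub> a \<in> Idl\<^bsub>H\<^esub> X" if "a \<in> Idl\<^bsub>H\<^esub> X" for a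
      using I.sm_ideal[OF that, of "-1"] T.sm_minus_one[of a] I.I.Icarr[OF that] by simp
    moreover have ne: "Idl\<^bsub>H\<^esub> X \<noteq> {}" using I.I.zero_closed by blast
    ultimately have "subgroup (Idl\<^bsub>H\<^esub> X) (add_monoid (module.truncate H))"
      using I.I.a_subset I.I.a_closed ne by (intro T.add.subgroupI) auto
    then show ?thesis
      using I.I.I_l_closed I.I.I_r_closed by (intro idealI T.ring_axioms) auto
  qed
  show ?thesis
    unfolding hopf_ideal_iff
  proof (intro conjI H i subsetI; elim imageE; hypsubst)
    fix a assume a: "a \<in> Idl\<^bsub>H\<^esub> X"
    show "comult H a \<in> generate (add_monoid (tensor H H)) (mixed_tensors H (Idl\<^bsub>H\<^esub> X))"
      by (rule alg_hom_preimage_genideal[OF K k_algebra_tensor[OF K K] H.comult_hom ideal_mixed_tensors[OF K i] X \<Delta> a])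
    show "counit H a \<in> {0}"
      using alg_hom_genideal_zero[OF K k_algebra_base_alg H.counit_hom X _ a] \<epsilon> by simp
    show "antipode H a \<in> Idl\<^bsub>H\<^esub> X"
      by (rule alg_hom_preimage_genideal[OF K k_algebra_op_alg[OF KT] S ideal_op_alg[OF it KT] X \<sigma> a])
  qed
qed

lemma hopf_quot_simps:
  "module.truncate (hopf_quot H I) = alg_quot H I"
  "comult (hopf_quot H I) = coset_map (\<lambda>a. tensor_map (alg_quot H I) (alg_quot H I) (\<lambda>a. I +>\<^bsub>H\<^esub> a) (\<lambda>a. I +>\<^bsub>H\<^esub> a) (comult H a))"
  "counit (hopf_quot H I) = coset_map (counit H)"
  "antipode (hopf_quot H I) = coset_map (\<lambda>a. I +>\<^bsub>H\<^esub> (antipode H a))"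
  by (simp_all add: hopf_quot_def Let_def module.extend_def module.truncate_def coset_map_def fun_eq_iff)

text \<open>The three inclusions in the definition of a Hopf ideal make the maps on cosets well
  defined. The axioms then follow along the projection by \<open>hopf_data_image\<close>.\<close>

lemma
  assumes I: "hopf_ideal I H"
  shows hopf_algebra_hopf_quot: "hopf_algebra (hopf_quot H I)"
    and comult_hopf_quot: "a \<in> carrier H \<Longrightarrow> comult (hopf_quot H I) (I +>\<^bsub>H\<^esub> a) =
      tensor_map (alg_quot H I) (alg_quot H I) (\<lambda>a. I +>\<^bsub>H\<^esub> a) (\<lambda>a. I +>\<^bsub>H\<^esub> a) (comult H a)"
    and counit_hopf_quot: "a \<in> carrier H \<Longrightarrow> counit (hopf_quot H I) (I +>\<^bsub>H\<^esub> a) = counit H a"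
    and antipode_hopf_quot: "a \<in> carrier H \<Longrightarrow> antipode (hopf_quot H I) (I +>\<^bsub>H\<^esub> a) = I +>\<^bsub>H\<^esub> (antipode H a)"
proof -
  have H: "hopf_algebra H" and i: "ideal I H"
    and \<Delta>: "\<And>a. a \<in> I \<Longrightarrow> comult H a \<in> generate (add_monoid (tensor H H)) (mixed_tensors H I)"
    and \<epsilon>: "\<And>a. a \<in> I \<Longrightarrow> counit H a = 0" and \<sigma>: "\<And>a. a \<in> I \<Longrightarrow> antipode H a \<in> I"
    using I by (auto simp: hopf_ideal_iff)
  interpret H: hopf_algebra H by fact
  note K = H.k_algebra_axioms
  interpret Q: alg_ideal H I using K i by (simp add: alg_ideal_def)
  let ?Q = "alg_quot H I" and ?\<pi> = "\<lambda>a. I +>\<^bsub>H\<^esub> a"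
  note KQ = Q.k_algebra_alg_quot
  note pl = alg_hom_linear[OF Q.proj_hom]
  note F = tensor_map_linear[OF KQ KQ K K pl pl]
  have c1: "comult (hopf_quot H I) (?\<pi> a) = tensor_map ?Q ?Q ?\<pi> ?\<pi> (comult H a)" if "a \<in> carrier H" for a
    unfolding hopf_quot_simps
    by (rule Q.coset_map_proj[OF k_algebra_tensor[OF KQ KQ] linear_maps_comp[OF alg_hom_linear[OF H.comult_hom] F] _ that])
      (rule tensor_map_proj_mixed[OF K i \<Delta>])
  have c2: "counit (hopf_quot H I) (?\<pi> a) = counit H a" if "a \<in> carrier H" for a
    unfolding hopf_quot_simps
    by (rule Q.coset_map_proj[OF k_algebra_base_alg alg_hom_linear[OF H.counit_hom] _ that]) (simp add: \<epsilon>)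
  have c3: "antipode (hopf_quot H I) (?\<pi> a) = ?\<pi> (antipode H a)" if "a \<in> carrier H" for a
    unfolding hopf_quot_simps
    using \<sigma> Q.I.Icarr Q.proj_eq_zero_iff
    by (intro Q.coset_map_proj[OF KQ linear_maps_comp[OF H.antipode_linear pl] _ that]) blast
  have "hopf_data ?Q (comult (hopf_quot H I)) (counit (hopf_quot H I)) (antipode (hopf_quot H I))"
    using H unfolding hopf_algebra_iff
    by (rule hopf_data_image[where f = ?\<pi> and \<Delta> = "comult H" and \<epsilon> = "counit H" and S = "antipode H",
          OF _ KQ Q.proj_hom _ c1 c2 c3]) (auto simp: Q.proj_carrier)
  then show "hopf_algebra (hopf_quot H I)"
    unfolding hopf_algebra_iff using hopf_data_truncate[of "hopf_quot H I"] by (simp add: hopf_quot_simps(1))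
  show "a \<in> carrier H \<Longrightarrow> comult (hopf_quot H I) (?\<pi> a) = tensor_map ?Q ?Q ?\<pi> ?\<pi> (comult H a)"
    "a \<in> carrier H \<Longrightarrow> counit (hopf_quot H I) (?\<pi> a) = counit H a"
    "a \<in> carrier H \<Longrightarrow> antipode (hopf_quot H I) (?\<pi> a) = ?\<pi> (antipode H a)"
    by (rule c1 c2 c3; assumption)+
qed

section \<open>Images of injective Hopf algebra maps\<close>

lemma (in k_algebra) k_algebra_subset:
  assumes "C \<subseteq> carrier A" "\<zero> \<in> C" "\<one> \<in> C" "\<And>a b. a \<in> C \<Longrightarrow> b \<in> C \<Longrightarrow> a \<oplus> b \<in> C"
    "\<And>a b. a \<in> C \<Longrightarrow> b \<in> C \<Longrightarrow> a \<otimes> b \<in> C" "\<And>c a. a \<in> C \<Longrightarrow> c \<odot> a \<in> C"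
  shows "k_algebra (A\<lparr>carrier := C\<rparr>)"
proof -
  have c: "a \<in> C \<Longrightarrow> a \<in> carrier A" for a using assms(1) by blast
  show ?thesis
    by (rule k_algebraI)
      (simp_all add: assms(2-) c a_ac m_assoc l_distr r_distr sm_l_distr sm_r_distr sm_assoc
        smult_mult_left smult_mult_right)
qed

text \<open>
  The retraction \<open>\<rho>\<close> is only linear. It makes \<open>B \<otimes> B \<rightarrow> L \<otimes> L\<close> injective for the image \<open>B\<close>
  of \<open>f\<close>, so that no bases are needed.
\<close>

locale hopf_embedding = H: hopf_algebra H + L: hopf_algebra L
  for H :: "('k::field, 'a) hopf" and L :: "('k, 'b) hopf" +
  fixes f :: "'a \<Rightarrow> 'b" and \<rho> :: "'b \<Rightarrow> 'a"
  assumes hom: "f \<in> alg_hom H L"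
    and comult_map: "a \<in> carrier H \<Longrightarrow> comult L (f a) = tensor_map L L f f (comult H a)"
    and counit_map: "a \<in> carrier H \<Longrightarrow> counit L (f a) = counit H a"
    and antipode_map: "a \<in> carrier H \<Longrightarrow> antipode L (f a) = f (antipode H a)"
    and retraction_linear: "\<rho> \<in> linear_maps L H"
    and retraction: "a \<in> carrier H \<Longrightarrow> \<rho> (f a) = a"
begin

abbreviation B where "B \<equiv> f ` carrier H"
abbreviation LB where "LB \<equiv> L\<lparr>carrier := B\<rparr>"
abbreviation incl where "incl \<equiv> tensor_map L L (\<lambda>x. x) (\<lambda>x. x)"

lemmas f = alg_homD[OF hom]

lemma B_closed:
  "b \<in> B \<Longrightarrow> b \<in> carrier L" "b \<in> B \<Longrightarrow> c \<in> B \<Longrightarrow> b \<oplus>\<^bsub>L\<^esub> c \<in> B" "b \<in> B \<Longrightarrow> c \<in> B \<Longrightarrow> b \<otimes>\<^bsub>L\<^esub> c \<in> B"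
  "\<zero>\<^bsub>L\<^esub> \<in> B" "\<one>\<^bsub>L\<^esub> \<in> B" "b \<in> B \<Longrightarrow> k \<odot>\<^bsub>L\<^esub> b \<in> B"
proof -
  show "b \<in> B \<Longrightarrow> b \<in> carrier L" using f(1) by auto
  show "b \<oplus>\<^bsub>L\<^esub> c \<in> B" if bc: "b \<in> B" "c \<in> B"
  proof -
    obtain x y where "b = f x" "c = f y" "x \<in> carrier H" "y \<in> carrier H" using bc by blast
    then have "b \<oplus>\<^bsub>L\<^esub> c = f (x \<oplus>\<^bsub>H\<^esub> y)" "x \<oplus>\<^bsub>H\<^esub> y \<in> carrier H" by (simp_all add: f(2))
    then show ?thesis by (simp only: imageI)
  qed
  show "b \<otimes>\<^bsub>L\<^esub> c \<in> B" if bc: "b \<in> B" "c \<in> B"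
  proof -
    obtain x y where "b = f x" "c = f y" "x \<in> carrier H" "y \<in> carrier H" using bc by blast
    then have "b \<otimes>\<^bsub>L\<^esub> c = f (x \<otimes>\<^bsub>H\<^esub> y)" "x \<otimes>\<^bsub>H\<^esub> y \<in> carrier H" by (simp_all add: f(4))
    then show ?thesis by (simp only: imageI)
  qed
  show "\<zero>\<^bsub>L\<^esub> \<in> B"
    using linear_map_zero[OF H.k_algebra_axioms L.k_algebra_axioms alg_hom_linear[OF hom]] by (metis H.zero_closed imageI)
  show "\<one>\<^bsub>L\<^esub> \<in> B" using f(5) by (metis H.one_closed imageI)
  show "k \<odot>\<^bsub>L\<^esub> b \<in> B" if b: "b \<in> B"
  proof -
    obtain x where "b = f x" "x \<in> carrier H" using b by blast
    then have "k \<odot>\<^bsub>L\<^esub> b = f (k \<odot>\<^bsub>H\<^esub> x)" "k \<odot>\<^bsub>H\<^esub> x \<in> carrier H" by (simp_all add: f(3))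
    then show ?thesis by (simp only: imageI)
  qed
qed

lemma k_algebra_LB: "k_algebra LB"
  by (rule L.k_algebra_subset[OF subsetI]; rule B_closed; assumption)

lemma incl_linear: "(\<lambda>x. x) \<in> linear_maps LB L"
  by (rule linear_mapsI) (simp_all add: B_closed)

lemma hom_LB: "f \<in> alg_hom H LB"
  by (rule alg_homI) (simp_all add: f)

lemmas KH = H.k_algebra_axioms
lemmas KL = L.k_algebra_axioms
lemmas KB = k_algebra_LB
lemmas lin_LB = alg_hom_linear[OF hom_LB]

lemma comult_factor: "a \<in> carrier H \<Longrightarrow> comult L (f a) = incl (tensor_map LB LB f f (comult H a))"
  using tensor_map_comp[OF KH KH KB KB KL KL lin_LB lin_LB incl_linear incl_linear alg_homD(1)[OF H.comult_hom]]
  by (simp add: comult_map)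

lemma factor_closed: "a \<in> carrier H \<Longrightarrow> tensor_map LB LB f f (comult H a) \<in> carrier (tensor LB LB)"
  by (rule linear_mapsD(1)[OF tensor_map_linear[OF KB KB KH KH lin_LB lin_LB] alg_homD(1)[OF H.comult_hom]])

lemma inj_incl:
  assumes "s \<in> carrier (tensor LB LB)" "t \<in> carrier (tensor LB LB)" "incl s = incl t"
  shows "s = t"
proof -
  \<comment> \<open>A linear projection of \<open>L\<close> onto \<open>B\<close>. Applied to both
    factors, it undoes the inclusion of B \<otimes> B.\<close>
  let ?r = "\<lambda>x. f (\<rho> x)"
  have r: "?r \<in> linear_maps L LB" by (rule linear_maps_comp[OF retraction_linear lin_LB])
  have id: "tensor_map LB LB ?r ?r (incl t) = t" if "t \<in> carrier (tensor LB LB)" for t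
  proof -
    have "tensor_map LB LB ?r ?r (incl t) = tensor_map LB LB ?r ?r t"
      by (rule tensor_map_comp[OF KB KB KL KL KB KB incl_linear incl_linear r r that])
    also have "\<dots> = tensor_map LB LB (\<lambda>x. x) (\<lambda>x. x) t"
      by (rule tensor_map_cong[OF KB KB KB KB id_linear id_linear _ _ that]) (simp_all, (erule imageE, simp only: retraction)+)
    also have "\<dots> = t" by (rule tensor_map_id[OF KB KB that])
    finally show ?thesis .
  qed
  show ?thesis using id[OF assms(1), unfolded assms(3)] id[OF assms(2)] by (rule trans[OF sym])
qed

lemma hopf_subalgebra_image: "hopf_subalgebra B L"
  unfolding hopf_subalgebra_def
proof (intro conjI)
  show "subring B L"
  proof (rule L.subringI)
    show "B \<subseteq> carrier L" by (rule subsetI, rule B_closed)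
    show "\<ominus>\<^bsub>L\<^esub> b \<in> B" if "b \<in> B" for b
      using B_closed(6)[OF that, of "-1"] L.sm_minus_one[OF B_closed(1)[OF that]] by simp
  qed (rule B_closed; assumption)+
  show "comult L ` B \<subseteq> incl ` carrier (tensor LB LB)"
  proof (rule image_subsetI, elim imageE, hypsubst)
    fix a assume a: "a \<in> carrier H"
    show "comult L (f a) \<in> incl ` carrier (tensor LB LB)"
      unfolding comult_factor[OF a] by (rule imageI[OF factor_closed[OF a]])
  qed
  show "antipode L ` B \<subseteq> B"
  proof (rule image_subsetI, elim imageE, hypsubst)
    fix a assume a: "a \<in> carrier H"
    show "antipode L (f a) \<in> B"
      unfolding antipode_map[OF a] by (rule imageI[OF linear_mapsD(1)[OF H.antipode_linear a]])
  qed
  show "\<forall>c. \<forall>b\<in>B. c \<odot>\<^bsub>L\<^esub> b \<in> B" by (intro allI ballI B_closed(6))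
qed (rule L.hopf_algebra_axioms)

text \<open>The tensor described in \<open>hopf_restrict\<close> exists by
  \<open>comult_factor\<close> and is unique by \<open>inj_incl\<close>.\<close>

lemma comult_restrict: "a \<in> carrier H \<Longrightarrow> comult (hopf_restrict L B) (f a) = tensor_map LB LB f f (comult H a)"
proof -
  assume a: "a \<in> carrier H"
  have "(THE t. t \<in> carrier (tensor LB LB) \<and> incl t = comult L (f a)) = tensor_map LB LB f f (comult H a)"
    using factor_closed[OF a] comult_factor[OF a] by (intro the_equality conjI) (simp_all only: inj_incl)
  then show ?thesis by (simp add: hopf_restrict_def)
qed

lemma truncate_restrict: "module.truncate (hopf_restrict L B) = module.truncate LB"
  by (simp add: hopf_restrict_def module.truncate_def)

lemma hopf_isomorphic_restrict: "hopf_isomorphic H (hopf_restrict L B)"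
proof -
  let ?M = "hopf_restrict L B"
  have s: "counit ?M = counit L" "antipode ?M = antipode L" by (simp_all add: hopf_restrict_def)
  have "hopf_data LB (comult ?M) (counit ?M) (antipode ?M)"
    using H.hopf_algebra_axioms unfolding hopf_algebra_iff
    by (rule hopf_data_image[where f = f and \<Delta> = "comult H" and \<epsilon> = "counit H" and S = "antipode H", OF _ KB hom_LB])
      (simp_all add: comult_restrict s counit_map antipode_map)
  then have M: "hopf_algebra ?M"
    unfolding hopf_algebra_iff using hopf_data_cong[OF truncate_restrict] by simp
  have inj: "inj_on f (carrier H)" by (rule inj_on_inverseI) (rule retraction)
  have tm: "tensor_map ?M ?M = tensor_map LB LB"
    by (metis tensor_map_truncate truncate_restrict)
  have "f \<in> alg_hom H ?M"
    using hom_LB by (metis alg_hom_truncate(2) truncate_restrict)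
  moreover have "bij_betw f (carrier H) (carrier ?M)"
    using inj truncate_eqD(1)[OF truncate_restrict] by (simp add: bij_betw_def)
  ultimately have "f \<in> hopf_iso H ?M"
    by (simp add: hopf_iso_def comult_restrict tm s counit_map antipode_map)
  then show ?thesis using M H.hopf_algebra_axioms by (auto simp: hopf_isomorphic_def)
qed

text \<open>The hull is an intersection of Hopf subalgebras. Exhibiting \<open>B\<close> as the
  least member of the family avoids the question whether such intersections are Hopf
  subalgebras.\<close>

lemma hopf_isomorphic_generated:
  assumes "X \<subseteq> B" and min: "\<And>C. hopf_subalgebra C L \<Longrightarrow> X \<subseteq> C \<Longrightarrow> B \<subseteq> C"
  shows "hopf_isomorphic H (hopf_generated L X)"
proof -
  have "(\<lambda>B. hopf_subalgebra B L) hull X = B"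
    unfolding hull_def using assms hopf_subalgebra_image by blast
  then show ?thesis using hopf_isomorphic_restrict by (simp add: hopf_generated_def)
qed

end

section \<open>Maps of presented Hopf algebras\<close>

text \<open>A map of presented Hopf algebras given by polynomials on generators, with every
  condition an ideal membership. The substitution by \<open>case_sum\<close> is \<phi> \<otimes>
  \<phi> written in the doubled set of generators.\<close>

locale pres_poly_map = P: pres_poly R d \<epsilon> s + P': pres_poly R' d' \<epsilon>' s'
  for R :: "('g, 'k::field) free set" and d \<epsilon> s and R' :: "('h, 'k) free set" and d' \<epsilon>' s' +
  fixes \<phi> :: "'g \<Rightarrow> ('h, 'k) free"
  assumes rels: "r \<in> R \<Longrightarrow> subst \<phi> r \<in> rel_ideal R'"
    and comult_gens: "subst d' (\<phi> x) - subst (case_sum (\<lambda>y. inl (\<phi> y)) (\<lambda>y. inr (\<phi> y))) (d x) \<in> rel_ideal (square_rels R')"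
    and counit_gens: "free_eval base_alg \<epsilon>' (\<phi> x) = \<epsilon> x"
    and antipode_gens: "op_subst s' (\<phi> x) - subst \<phi> (s x) \<in> rel_ideal R'"
begin

definition F where "F = coset_map (\<lambda>p. pres_class R' (subst \<phi> p))"

lemma poly_hom: "(\<lambda>p. pres_class R' (subst \<phi> p)) \<in> alg_hom free_alg (pres_alg R')"
  by (rule alg_hom_comp[OF subst_hom pres_class_hom])

lemma F_hom: "F \<in> alg_hom (pres_alg R) (pres_alg R')"
  and F_class: "F (pres_class R p) = pres_class R' (subst \<phi> p)"
proof -
  have z: "pres_class R' (subst \<phi> r) = \<zero>\<^bsub>pres_alg R'\<^esub>" if "r \<in> R" for r
    using rels[OF that] by (simp add: pres_class_eq_zero_iff)
  show "F \<in> alg_hom (pres_alg R) (pres_alg R')" "F (pres_class R p) = pres_class R' (subst \<phi> p)"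
    unfolding F_def by (rule pres_lift_hom[OF k_algebra_pres_alg poly_hom z] pres_lift_class[OF k_algebra_pres_alg poly_hom z]; assumption)+
qed

lemmas F_linear = alg_hom_linear[OF F_hom]

lemma F_square:
  "tensor_map P'.A P'.A F F (square_eval R w) = square_eval R' (subst (case_sum (\<lambda>y. inl (\<phi> y)) (\<lambda>y. inr (\<phi> y))) w)"
proof -
  note K = P.A.k_algebra_axioms and K' = P'.A.k_algebra_axioms
  have e: "tensor_map P'.A P'.A F F (square_eval R (gen z)) =
      square_eval R' (case_sum (\<lambda>y. inl (\<phi> y)) (\<lambda>y. inr (\<phi> y)) z)" for z
  proof (cases z)
    case (Inl x)
    have "square_eval R (gen z) = tens P.A P.A (P.cls (gen x)) \<one>\<^bsub>P.A\<^esub>"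
      using square_eval_inl[of R "gen x"] by (simp add: Inl)
    then show ?thesis
      by (simp add: Inl tensor_map_tens[OF K' K' K K F_linear F_linear] P.cls_closed F_class alg_homD(5)[OF F_hom] square_eval_inl)
  next
    case (Inr x)
    have "square_eval R (gen z) = tens P.A P.A \<one>\<^bsub>P.A\<^esub> (P.cls (gen x))"
      using square_eval_inr[of R "gen x"] by (simp add: Inr)
    then show ?thesis
      by (simp add: Inr tensor_map_tens[OF K' K' K K F_linear F_linear] P.cls_closed F_class alg_homD(5)[OF F_hom] square_eval_inr)
  qed
  show ?thesis
    by (rule P'.T.alg_hom_free_ext[OF alg_hom_comp[OF square_eval_hom tensor_map_hom[OF K' K' K K F_hom F_hom]]
          alg_hom_comp[OF subst_hom square_eval_hom]]) (simp add: e)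
qed

lemma F_comult:
  assumes a: "a \<in> carrier P.A"
  shows "comult P'.H (F a) = tensor_map P'.A P'.A F F (comult P.H a)"
proof -
  note K = P.A.k_algebra_axioms and K' = P'.A.k_algebra_axioms
  show ?thesis
    by (rule alg_hom_pres_ext[OF P'.T.k_algebra_axioms alg_hom_comp[OF F_hom P'.comult_hom]
          alg_hom_comp[OF P.comult_hom tensor_map_hom[OF K' K' K K F_hom F_hom]] _ a])
      (simp add: F_class P.gen_values(1) P'.comult_poly_cls F_square square_eval_eqI comult_gens)
qed

lemma F_counit:
  assumes a: "a \<in> carrier P.A" shows "counit P'.H (F a) = counit P.H a"
  by (rule alg_hom_pres_ext[OF k_algebra_base_alg alg_hom_comp[OF F_hom P'.counit_hom] P.counit_hom _ a])
    (simp add: F_class P.gen_values(2) P'.counit_cls counit_gens)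

lemma F_antipode:
  assumes a: "a \<in> carrier P.A" shows "antipode P'.H (F a) = F (antipode P.H a)"
  by (rule alg_hom_pres_ext[OF P'.op_A alg_hom_comp[OF F_hom P'.antipode_hom]
        alg_hom_comp[OF P.antipode_hom op_alg_hom[OF F_hom]] _ a])
    (simp add: F_class P.gen_values(3) P'.antipode_poly_cls pres_class_eq_iff antipode_gens)

end

section \<open>Adjoining a square root of a normal element\<close>

text \<open>
  \<open>A \<oplus> A s\<close> with \<open>s a = \<sigma>(a) s\<close> and \<open>s\<^sup>2 = g\<close>; the pair \<open>(a, b)\<close> stands for \<open>a + b s\<close>.
\<close>

definition twist_ext :: "('k, 'a, 'm) module_scheme \<Rightarrow> ('a \<Rightarrow> 'a) \<Rightarrow> 'a \<Rightarrow> ('k, 'a \<times> 'a) module" where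
  "twist_ext A \<sigma> g = \<lparr>carrier = carrier A \<times> carrier A,
     monoid.mult = (\<lambda>u v. (fst u \<otimes>\<^bsub>A\<^esub> fst v \<oplus>\<^bsub>A\<^esub> snd u \<otimes>\<^bsub>A\<^esub> \<sigma> (snd v) \<otimes>\<^bsub>A\<^esub> g,
       fst u \<otimes>\<^bsub>A\<^esub> snd v \<oplus>\<^bsub>A\<^esub> snd u \<otimes>\<^bsub>A\<^esub> \<sigma> (fst v))),
     one = (\<one>\<^bsub>A\<^esub>, \<zero>\<^bsub>A\<^esub>), ring.zero = (\<zero>\<^bsub>A\<^esub>, \<zero>\<^bsub>A\<^esub>),
     add = (\<lambda>u v. (fst u \<oplus>\<^bsub>A\<^esub> fst v, snd u \<oplus>\<^bsub>A\<^esub> snd v)),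
     module.smult = (\<lambda>c u. (c \<odot>\<^bsub>A\<^esub> fst u, c \<odot>\<^bsub>A\<^esub> snd u))\<rparr>"

lemma twist_ext_simps [simp]:
  "carrier (twist_ext A \<sigma> g) = carrier A \<times> carrier A"
  "(a, b) \<otimes>\<^bsub>twist_ext A \<sigma> g\<^esub> (a', b') =
     (a \<otimes>\<^bsub>A\<^esub> a' \<oplus>\<^bsub>A\<^esub> b \<otimes>\<^bsub>A\<^esub> \<sigma> b' \<otimes>\<^bsub>A\<^esub> g, a \<otimes>\<^bsub>A\<^esub> b' \<oplus>\<^bsub>A\<^esub> b \<otimes>\<^bsub>A\<^esub> \<sigma> a')"
  "\<one>\<^bsub>twist_ext A \<sigma> g\<^esub> = (\<one>\<^bsub>A\<^esub>, \<zero>\<^bsub>A\<^esub>)" "\<zero>\<^bsub>twist_ext A \<sigma> g\<^esub> = (\<zero>\<^bsub>A\<^esub>, \<zero>\<^bsub>A\<^esub>)"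
  "(a, b) \<oplus>\<^bsub>twist_ext A \<sigma> g\<^esub> (a', b') = (a \<oplus>\<^bsub>A\<^esub> a', b \<oplus>\<^bsub>A\<^esub> b')"
  "c \<odot>\<^bsub>twist_ext A \<sigma> g\<^esub> (a, b) = (c \<odot>\<^bsub>A\<^esub> a, c \<odot>\<^bsub>A\<^esub> b)"
  by (simp_all add: twist_ext_def)

text \<open>The assumptions are what associativity asks of \<open>s\<close>: comparing
  \<open>(s s) s\<close> with \<open>s (s s)\<close> gives \<open>sigma_g\<close>, and comparing
  \<open>(s s) a\<close> with \<open>s (s a)\<close> gives \<open>sigma_sigma\<close>, which is
  conjugation by \<open>g\<close> written without an inverse.\<close>

locale twisted = k_algebra A for A :: "('k::field, 'a, 'm) module_scheme" (structure) +
  fixes \<sigma> :: "'a \<Rightarrow> 'a" and g :: 'a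
  assumes sigma_hom: "\<sigma> \<in> alg_hom A A" and g_closed [simp]: "g \<in> carrier A" and sigma_g [simp]: "\<sigma> g = g"
    and sigma_sigma: "a \<in> carrier A \<Longrightarrow> \<sigma> (\<sigma> a) \<otimes> g = g \<otimes> a"
begin

lemmas sigma [simp] = alg_homD[OF sigma_hom]

lemma sigma_zero [simp]: "\<sigma> \<zero> = \<zero>"
  by (rule linear_map_zero[OF k_algebra_axioms k_algebra_axioms alg_hom_linear[OF sigma_hom]])

lemma g_mult: "a \<in> carrier A \<Longrightarrow> b \<in> carrier A \<Longrightarrow> g \<otimes> (a \<otimes> b) = \<sigma> (\<sigma> a) \<otimes> (g \<otimes> b)"
  by (metis sigma_sigma m_assoc g_closed sigma(1))

lemma k_algebra_twist_ext: "k_algebra (twist_ext A \<sigma> g)"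
proof (rule k_algebraI, goal_cases)
  \<comment> \<open>Associativity: a product of three pairs expands into eight terms, and those with
    two or three factors \<open>s\<close> are matched by \<open>sigma_sigma\<close> and
    \<open>g_mult\<close>.\<close>
  case (9 u v w)
  then show ?case
    by (cases u; cases v; cases w)
      (simp add: l_distr r_distr m_assoc a_assoc, simp add: a_ac flip: sigma_sigma g_mult)
qed (auto simp: l_distr r_distr a_ac sm_l_distr sm_r_distr sm_assoc smult_mult_left smult_mult_right)

lemma twist_embed: "(\<lambda>a. (a, \<zero>)) \<in> alg_hom A (twist_ext A \<sigma> g)"
  by (rule alg_homI) simp_all

lemma twist_fst_linear: "fst \<in> linear_maps (twist_ext A \<sigma> g) A"
  by (rule linear_mapsI) auto

end

subsection \<open>Substitutions between the two presentations\<close>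

lemma Idl_mono: "R \<subseteq> R' \<Longrightarrow> p \<in> rel_ideal R \<Longrightarrow> p \<in> rel_ideal R'"
  using free.subset_Idl_subset[of R' R] by auto

definition jordan_lam_rels :: "'k::field \<Rightarrow> (jordan_gen, 'k) free set" where
  "jordan_lam_rels lam = insert (jordan_zl lam) jordan_rels"

lemma jordan_lam_Idl:
  "p \<in> rel_ideal jordan_rels \<Longrightarrow> p \<in> rel_ideal (jordan_lam_rels lam)"
  "jordan_zl lam \<in> rel_ideal (jordan_lam_rels lam)"
  by (auto simp: jordan_lam_rels_def intro: Idl_mono Idl_base)

text \<open>
  \<open>a\<^sub>1\<close> goes to \<open>x / 2\<close> and \<open>a\<^sub>2\<close> to \<open>- y / (4 \<hbar>) - x / 4 + (\<lambda> + 1 / 32) (1 - g)\<close>. Adding \<open>c (1 - g)\<close> to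
  \<open>a\<^sub>2\<close> adds \<open>c (1 - g\<^sup>2)\<close> to \<open>z\<close>, which is why one \<open>U\<^sub>\<hbar>\<close> serves all \<open>\<lambda>\<close>.
\<close>

definition jordan_to_ohn :: "'k::field \<Rightarrow> 'k \<Rightarrow> jordan_gen \<Rightarrow> (ohn_gen, 'k) free" where
  "jordan_to_ohn hbar lam = case_jordan_gen (cst (1 / 2) * (gen OK * gen OTi))
     (cst (- 1 / (4 * hbar)) * (gen OY * gen OTi) - cst (1 / 4) * (gen OK * gen OTi) + cst (lam + 1 / 32) * (1 - gen OTi * gen OTi))
     (gen OTi * gen OTi) (gen OT * gen OT)"

lemmas jordan_to_ohn_defs = jordan_to_ohn_def jordan_gen.case

section \<open>Relations of the Jordan type algebra in the Ohn algebra\<close>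

lemma jordan_to_ohn_GGi:
  fixes hbar lam :: "'k::field_char_0"
  assumes "hbar \<noteq> 0"
  shows "subst (jordan_to_ohn hbar lam) (jordan_GGi) \<in> rel_ideal (ohn_rels hbar)" (is "_ \<in> ?I")
proof (rule Idl_certificate)
  show "tm 1 [OTi] ohn_TiT [OT] + tm 1 [] ohn_TiT [] \<in> ?I"
    by (intro Idl_add Idl_mult ohn_Idl)
qed (simp only: jordan_poly_defs jordan_to_ohn_defs ohn_poly_defs expand_substs, simp only: expand_words;
    rule poly_mapping_eqI; simp only: lookup_words; simp add: field_simps assms)

lemma jordan_to_ohn_GiG:
  fixes hbar lam :: "'k::field_char_0"
  assumes "hbar \<noteq> 0"
  shows "subst (jordan_to_ohn hbar lam) (jordan_GiG) \<in> rel_ideal (ohn_rels hbar)" (is "_ \<in> ?I")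
proof (rule Idl_certificate)
  show "tm 1 [OT] ohn_TTi [OTi] + tm 1 [] ohn_TTi [] \<in> ?I"
    by (intro Idl_add Idl_mult ohn_Idl)
qed (simp only: jordan_poly_defs jordan_to_ohn_defs ohn_poly_defs expand_substs, simp only: expand_words;
    rule poly_mapping_eqI; simp only: lookup_words; simp add: field_simps assms)

lemma jordan_to_ohn_GA1:
  fixes hbar lam :: "'k::field_char_0"
  assumes "hbar \<noteq> 0"
  shows "subst (jordan_to_ohn hbar lam) (jordan_GA1) \<in> rel_ideal (ohn_rels hbar)" (is "_ \<in> ?I")
proof (rule Idl_certificate)
  show "tm (-1 / 2) [] ohn_KTi [OTi, OTi] + tm (-1 / 2) [OTi] ohn_KTi [OTi] \<in> ?I"
    by (intro Idl_add Idl_mult ohn_Idl)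
qed (simp only: jordan_poly_defs jordan_to_ohn_defs ohn_poly_defs expand_substs, simp only: expand_words;
    rule poly_mapping_eqI; simp only: lookup_words; simp add: field_simps assms)

lemma jordan_to_ohn_GA2:
  fixes hbar lam :: "'k::field_char_0"
  assumes "hbar \<noteq> 0"
  shows "subst (jordan_to_ohn hbar lam) (jordan_GA2) \<in> rel_ideal (ohn_rels hbar)" (is "_ \<in> ?I")
proof (rule Idl_certificate)
  show "tm (-1 / 8) [] ohn_KTi [OTi, OTi] + tm (1 / (4 * hbar)) [] (ohn_YTi hbar) [OTi, OTi] +
      tm (1 / (4 * hbar)) [OTi] (ohn_YTi hbar) [OTi] + tm (1 / 8) [OTi] ohn_KTi [OTi] \<in> ?I"
    by (intro Idl_add Idl_mult ohn_Idl)
qed (simp only: jordan_poly_defs jordan_to_ohn_defs ohn_poly_defs expand_substs, simp only: expand_words;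
    rule poly_mapping_eqI; simp only: lookup_words; simp add: field_simps assms)

text \<open>\<open>ohn_KY\<close> enters once, for the commutator of \<open>x\<close> and
  \<open>y\<close> inside \<open>z\<close>. The other terms move \<open>T^-1\<close> past
  \<open>K\<close> and \<open>Y\<close> or cancel it against \<open>T\<close>.\<close>

lemma jordan_to_ohn_zl:
  fixes hbar lam :: "'k::field_char_0"
  assumes "hbar \<noteq> 0"
  shows "subst (jordan_to_ohn hbar lam) (jordan_zl lam) \<in> rel_ideal (ohn_rels hbar)" (is "_ \<in> ?I")
proof (rule Idl_certificate)
  show "tm (-1 / 8) [] ohn_KTi [OK, OTi] + tm (3 / 64 - lam / 2) [] ohn_KTi [OTi, OTi] +
      tm (-1 / (8 * hbar)) [] ohn_KTi [OY, OTi] + tm (-1 / 8) [OTi, OK] ohn_KTi [] +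
      tm (1 / 64 - lam / 2) [OTi] ohn_KTi [OTi] + tm (-1 / (8 * hbar)) [OTi] (ohn_KY hbar) [OTi] +
      tm (1 / (16 * hbar)) [] ohn_TiT [OY, OTi] + tm (-1 / 16) [OTi, OTi] ohn_KTi [] +
      tm (-1 / (8 * hbar)) [OTi, OY] ohn_KTi [] + tm (1 / (16 * hbar)) [OTi, OY] ohn_TTi [] +
      tm (1 / (16 * hbar)) [OTi] (ohn_YTi hbar) [OTi] + tm (1 / (8 * hbar)) [OY, OTi] ohn_KTi [] +
      tm (1 / (8 * hbar)) [] (ohn_YTi hbar) [OTi, OK] + tm (1 / 16) [] ohn_KTi [OTi, OK] +
      tm (1 / (8 * hbar)) [] (ohn_YTi hbar) [OTi, OTi] + tm (1 / 32) [] ohn_KTi [] +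
      tm (-3 / (16 * hbar)) [] (ohn_YTi hbar) [] \<in> ?I"
    by (intro Idl_add Idl_mult ohn_Idl)
qed (simp only: jordan_poly_defs jordan_to_ohn_defs ohn_poly_defs expand_substs, simp only: expand_words;
    rule poly_mapping_eqI; simp only: lookup_words; simp add: field_simps assms)

text \<open>\<open>K\<close> is skew primitive of type \<open>(T^-1, T)\<close>. Multiplying by
  \<open>T^-1\<close> on the right gives \<open>x\<close> the type \<open>(T^-2, 1) = (g, 1)\<close>
  of \<open>a1\<close>. The elements \<open>y\<close> and \<open>1 - g\<close> have this type as
  well, which covers \<open>a2\<close>.\<close>

lemma jordan_to_ohn_comult_JA1:
  fixes hbar lam :: "'k::field_char_0"
  assumes "hbar \<noteq> 0"
  shows "subst ohn_comult_poly (jordan_to_ohn hbar lam JA1) - subst (case_sum (\<lambda>y. inl (jordan_to_ohn hbar lam y)) (\<lambda>y. inr (jordan_to_ohn hbar lam y))) (jordan_comult_poly JA1) \<in> rel_ideal (square_rels (ohn_rels hbar))" (is "_ \<in> ?I")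
proof (rule Idl_certificate)
  show "tm (-1 / 2) [Inl OK] (commutator_rel OTi OT) [Inr OTi] + tm (1 / 2) [] (inl ohn_KTi) [Inr OT, Inr OTi] +
      tm (1 / 2) [Inl OTi, Inl OK] (inr ohn_TTi) [] + tm (-1 / 2) [Inl OTi] (commutator_rel OTi OK) [Inr OTi] +
      tm (1 / 2) [Inl OTi, Inl OTi] (inr ohn_TTi) [] + tm (-1 / 2) [] (inl ohn_KTi) [] +
      tm (-1 / 2) [] (inr ohn_TTi) [] \<in> ?I"
    by (intro Idl_add Idl_mult ohn_square_Idl)
qed (simp only: jordan_hopf_defs jordan_to_ohn_defs ohn_hopf_defs ohn_poly_defs sum.case expand_substs, simp only: expand_words;
    rule poly_mapping_eqI; simp only: lookup_words; simp add: field_simps assms)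

lemma jordan_to_ohn_antipode_JA1:
  fixes hbar lam :: "'k::field_char_0"
  assumes "hbar \<noteq> 0"
  shows "op_subst ohn_antipode_poly (jordan_to_ohn hbar lam JA1) - subst (jordan_to_ohn hbar lam) (jordan_antipode_poly JA1) \<in> rel_ideal (ohn_rels hbar)"
proof -
  have "op_subst ohn_antipode_poly (jordan_to_ohn hbar lam JA1) - subst (jordan_to_ohn hbar lam) (jordan_antipode_poly JA1) = 0"
    by (simp only: jordan_hopf_defs jordan_to_ohn_defs ohn_hopf_defs ohn_poly_defs expand_substs, simp only: expand_words, simp)
  then show ?thesis by (simp only: Idl_zero)
qed

lemma jordan_to_ohn_comult_JA2:
  fixes hbar lam :: "'k::field_char_0"
  assumes "hbar \<noteq> 0"
  shows "subst ohn_comult_poly (jordan_to_ohn hbar lam JA2) - subst (case_sum (\<lambda>y. inl (jordan_to_ohn hbar lam y)) (\<lambda>y. inr (jordan_to_ohn hbar lam y))) (jordan_comult_poly JA2) \<in> rel_ideal (square_rels (ohn_rels hbar))" (is "_ \<in> ?I")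
proof (rule Idl_certificate)
  show "tm (1 / 4) [Inl OK] (commutator_rel OTi OT) [Inr OTi] + tm (-3 / 8) [] (inl ohn_KTi) [Inr OT, Inr OTi] +
      tm (-1 / 2) [Inl OTi, Inl OK] (inr ohn_TTi) [] + tm (1 / 4) [Inl OTi] (commutator_rel OTi OK) [Inr OTi] +
      tm (-3 / 8) [Inl OTi, Inl OTi] (inr ohn_TTi) [] +
      tm (1 / 32 + lam) [Inl OTi] (commutator_rel OTi OTi) [Inr OTi] +
      tm (1 / (4 * hbar)) [Inl OTi] (commutator_rel OTi OY) [Inr OTi] +
      tm (1 / (4 * hbar)) [Inl OY] (commutator_rel OTi OT) [Inr OTi] +
      tm (-1 / (4 * hbar)) [] (inl (ohn_YTi hbar)) [Inr OT, Inr OTi] +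
      tm (-1 / (4 * hbar)) [Inl OTi, Inl OY] (inr ohn_TTi) [] + tm (3 / 8) [] (inl ohn_KTi) [] +
      tm (3 / 8) [] (inr ohn_TTi) [] + tm (1 / (4 * hbar)) [] (inl (ohn_YTi hbar)) [] \<in> ?I"
    by (intro Idl_add Idl_mult ohn_square_Idl)
qed (simp only: jordan_hopf_defs jordan_to_ohn_defs ohn_hopf_defs ohn_poly_defs sum.case expand_substs, simp only: expand_words;
    rule poly_mapping_eqI; simp only: lookup_words; simp add: field_simps assms)

lemma jordan_to_ohn_antipode_JA2:
  fixes hbar lam :: "'k::field_char_0"
  assumes "hbar \<noteq> 0"
  shows "op_subst ohn_antipode_poly (jordan_to_ohn hbar lam JA2) - subst (jordan_to_ohn hbar lam) (jordan_antipode_poly JA2) \<in> rel_ideal (ohn_rels hbar)" (is "_ \<in> ?I")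
proof (rule Idl_certificate)
  show "tm (-1 / 32 - lam) [OT] ohn_TTi [OTi] + tm (-1 / 32 - lam) [] ohn_TTi [] \<in> ?I"
    by (intro Idl_add Idl_mult ohn_Idl)
qed (simp only: jordan_hopf_defs jordan_to_ohn_defs ohn_hopf_defs ohn_poly_defs expand_substs, simp only: expand_words;
    rule poly_mapping_eqI; simp only: lookup_words; simp add: field_simps assms)

lemma jordan_to_ohn_comult_JG:
  fixes hbar lam :: "'k::field_char_0"
  assumes "hbar \<noteq> 0"
  shows "subst ohn_comult_poly (jordan_to_ohn hbar lam JG) - subst (case_sum (\<lambda>y. inl (jordan_to_ohn hbar lam y)) (\<lambda>y. inr (jordan_to_ohn hbar lam y))) (jordan_comult_poly JG) \<in> rel_ideal (square_rels (ohn_rels hbar))" (is "_ \<in> ?I")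
proof (rule Idl_certificate)
  show "tm (-1) [Inl OTi] (commutator_rel OTi OTi) [Inr OTi] \<in> ?I"
    by (intro Idl_add Idl_mult ohn_square_Idl)
qed (simp only: jordan_hopf_defs jordan_to_ohn_defs ohn_hopf_defs ohn_poly_defs sum.case expand_substs, simp only: expand_words;
    rule poly_mapping_eqI; simp only: lookup_words; simp add: field_simps assms)

lemma jordan_to_ohn_antipode_JG:
  fixes hbar lam :: "'k::field_char_0"
  assumes "hbar \<noteq> 0"
  shows "op_subst ohn_antipode_poly (jordan_to_ohn hbar lam JG) - subst (jordan_to_ohn hbar lam) (jordan_antipode_poly JG) \<in> rel_ideal (ohn_rels hbar)"
proof -
  have "op_subst ohn_antipode_poly (jordan_to_ohn hbar lam JG) - subst (jordan_to_ohn hbar lam) (jordan_antipode_poly JG) = 0"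
    by (simp only: jordan_hopf_defs jordan_to_ohn_defs ohn_hopf_defs ohn_poly_defs expand_substs, simp only: expand_words, simp)
  then show ?thesis by (simp only: Idl_zero)
qed

lemma jordan_to_ohn_comult_JGi:
  fixes hbar lam :: "'k::field_char_0"
  assumes "hbar \<noteq> 0"
  shows "subst ohn_comult_poly (jordan_to_ohn hbar lam JGi) - subst (case_sum (\<lambda>y. inl (jordan_to_ohn hbar lam y)) (\<lambda>y. inr (jordan_to_ohn hbar lam y))) (jordan_comult_poly JGi) \<in> rel_ideal (square_rels (ohn_rels hbar))" (is "_ \<in> ?I")
proof (rule Idl_certificate)
  show "tm (-1) [Inl OT] (commutator_rel OT OT) [Inr OT] \<in> ?I"
    by (intro Idl_add Idl_mult ohn_square_Idl)
qed (simp only: jordan_hopf_defs jordan_to_ohn_defs ohn_hopf_defs ohn_poly_defs sum.case expand_substs, simp only: expand_words;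
    rule poly_mapping_eqI; simp only: lookup_words; simp add: field_simps assms)

lemma jordan_to_ohn_antipode_JGi:
  fixes hbar lam :: "'k::field_char_0"
  assumes "hbar \<noteq> 0"
  shows "op_subst ohn_antipode_poly (jordan_to_ohn hbar lam JGi) - subst (jordan_to_ohn hbar lam) (jordan_antipode_poly JGi) \<in> rel_ideal (ohn_rels hbar)"
proof -
  have "op_subst ohn_antipode_poly (jordan_to_ohn hbar lam JGi) - subst (jordan_to_ohn hbar lam) (jordan_antipode_poly JGi) = 0"
    by (simp only: jordan_hopf_defs jordan_to_ohn_defs ohn_hopf_defs ohn_poly_defs expand_substs, simp only: expand_words, simp)
  then show ?thesis by (simp only: Idl_zero)
qed

text \<open>Conjugation by \<open>T\<^sup>-\<^sup>1\<close>, in the generators of the Jordan type algebra.\<close>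

definition jordan_conj :: "jordan_gen \<Rightarrow> (jordan_gen, 'k::field) free" where
  "jordan_conj = case_jordan_gen (gen JA1 + cst (1 / 2) * (1 - gen JG))
     (gen JA2 + cst (1 / 2) * gen JA1 - cst (1 / 8) * (1 - gen JG)) (gen JG) (gen JGi)"

lemmas jordan_conj_defs = jordan_conj_def jordan_gen.case
lemmas jordan_lam_Idls = jordan_Idl[THEN jordan_lam_Idl(1)] jordan_lam_Idl(2)

section \<open>Conjugation by \<open>T^-1\<close> as an endomorphism, and its square\<close>

lemma jordan_conj_GGi:
  fixes lam :: "'k::field_char_0"
  shows "subst jordan_conj (jordan_GGi) \<in> rel_ideal (jordan_lam_rels lam)" (is "_ \<in> ?I")
proof (rule Idl_certificate)
  show "tm 1 [] jordan_GGi [] \<in> ?I"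
    by (intro Idl_add Idl_mult jordan_lam_Idls)
qed (simp only: jordan_poly_defs jordan_conj_defs expand_substs, simp only: expand_words;
    rule poly_mapping_eqI; simp only: lookup_words; simp add: field_simps)

lemma jordan_conj_GiG:
  fixes lam :: "'k::field_char_0"
  shows "subst jordan_conj (jordan_GiG) \<in> rel_ideal (jordan_lam_rels lam)" (is "_ \<in> ?I")
proof (rule Idl_certificate)
  show "tm 1 [] jordan_GiG [] \<in> ?I"
    by (intro Idl_add Idl_mult jordan_lam_Idls)
qed (simp only: jordan_poly_defs jordan_conj_defs expand_substs, simp only: expand_words;
    rule poly_mapping_eqI; simp only: lookup_words; simp add: field_simps)

lemma jordan_conj_GA1:
  fixes lam :: "'k::field_char_0"
  shows "subst jordan_conj (jordan_GA1) \<in> rel_ideal (jordan_lam_rels lam)" (is "_ \<in> ?I")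
proof (rule Idl_certificate)
  show "tm 1 [] jordan_GA1 [] \<in> ?I"
    by (intro Idl_add Idl_mult jordan_lam_Idls)
qed (simp only: jordan_poly_defs jordan_conj_defs expand_substs, simp only: expand_words;
    rule poly_mapping_eqI; simp only: lookup_words; simp add: field_simps)

lemma jordan_conj_GA2:
  fixes lam :: "'k::field_char_0"
  shows "subst jordan_conj (jordan_GA2) \<in> rel_ideal (jordan_lam_rels lam)" (is "_ \<in> ?I")
proof (rule Idl_certificate)
  show "tm (1 / 2) [] jordan_GA1 [] + tm 1 [] jordan_GA2 [] \<in> ?I"
    by (intro Idl_add Idl_mult jordan_lam_Idls)
qed (simp only: jordan_poly_defs jordan_conj_defs expand_substs, simp only: expand_words;
    rule poly_mapping_eqI; simp only: lookup_words; simp add: field_simps)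

text \<open>Modulo the relations conjugation fixes both \<open>z\<close> and \<open>1 - g^2\<close>.
  This leaves one copy of \<open>jordan_zl lam\<close> and corrections from moving \<open>g\<close>
  past \<open>a1\<close> and \<open>a2\<close>.\<close>

lemma jordan_conj_zl:
  fixes lam :: "'k::field_char_0"
  shows "subst jordan_conj (jordan_zl lam) \<in> rel_ideal (jordan_lam_rels lam)" (is "_ \<in> ?I")
proof (rule Idl_certificate)
  show "tm 1 [] (jordan_zl lam) [] + tm (-1 / 8) [] jordan_GA1 [] + tm (-1 / 2) [] jordan_GA2 [] \<in> ?I"
    by (intro Idl_add Idl_mult jordan_lam_Idls)
qed (simp only: jordan_poly_defs jordan_conj_defs expand_substs, simp only: expand_words;
    rule poly_mapping_eqI; simp only: lookup_words; simp add: field_simps)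

text \<open>Two conjugations add \<open>1 - g\<close> to \<open>a1\<close>, and
  \<open>(a1 + 1 - g) g = g a1\<close> is the relation \<open>jordan_GA1\<close>.\<close>

lemma jordan_conj_conj_JA1:
  fixes lam :: "'k::field_char_0"
  shows "subst jordan_conj (jordan_conj JA1) * gen JG - gen JG * (gen JA1 :: (jordan_gen, 'k) free) \<in> rel_ideal (jordan_lam_rels lam)" (is "_ \<in> ?I")
proof (rule Idl_certificate)
  show "tm (-1) [] jordan_GA1 [] \<in> ?I"
    by (intro Idl_add Idl_mult jordan_lam_Idls)
qed (simp only: jordan_poly_defs jordan_conj_defs expand_substs, simp only: expand_words;
    rule poly_mapping_eqI; simp only: lookup_words; simp add: field_simps)

text \<open>Two conjugations send \<open>a2\<close> to \<open>a2 + a1\<close>: the constant 1/8 is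
  chosen such that the multiples of \<open>1 - g\<close> cancel.\<close>

lemma jordan_conj_conj_JA2:
  fixes lam :: "'k::field_char_0"
  shows "subst jordan_conj (jordan_conj JA2) * gen JG - gen JG * (gen JA2 :: (jordan_gen, 'k) free) \<in> rel_ideal (jordan_lam_rels lam)" (is "_ \<in> ?I")
proof (rule Idl_certificate)
  show "tm (-1) [] jordan_GA2 [] \<in> ?I"
    by (intro Idl_add Idl_mult jordan_lam_Idls)
qed (simp only: jordan_poly_defs jordan_conj_defs expand_substs, simp only: expand_words;
    rule poly_mapping_eqI; simp only: lookup_words; simp add: field_simps)

lemma jordan_conj_conj_JG:
  fixes lam :: "'k::field_char_0"
  shows "subst jordan_conj (jordan_conj JG) * gen JG - gen JG * (gen JG :: (jordan_gen, 'k) free) \<in> rel_ideal (jordan_lam_rels lam)"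
proof -
  have "subst jordan_conj (jordan_conj JG) * gen JG - gen JG * (gen JG :: (jordan_gen, 'k) free) = 0"
    by (simp only: jordan_poly_defs jordan_conj_defs expand_substs, simp only: expand_words, simp)
  then show ?thesis by (simp only: Idl_zero)
qed

lemma jordan_conj_conj_JGi:
  fixes lam :: "'k::field_char_0"
  shows "subst jordan_conj (jordan_conj JGi) * gen JG - gen JG * (gen JGi :: (jordan_gen, 'k) free) \<in> rel_ideal (jordan_lam_rels lam)" (is "_ \<in> ?I")
proof (rule Idl_certificate)
  show "tm (-1) [] jordan_GGi [] + tm 1 [] jordan_GiG [] \<in> ?I"
    by (intro Idl_add Idl_mult jordan_lam_Idls)
qed (simp only: jordan_poly_defs jordan_conj_defs expand_substs, simp only: expand_words;
    rule poly_mapping_eqI; simp only: lookup_words; simp add: field_simps)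

text \<open>Generators of the quadratic extension: \<open>ES\<close> is the square root \<open>s\<close> of \<open>g\<close> and \<open>ET\<close> its inverse.\<close>

datatype ext_gen = EJ jordan_gen | ES | ET

abbreviation emb :: "(jordan_gen, 'k::field) free \<Rightarrow> (ext_gen, 'k) free" where "emb \<equiv> subst (\<lambda>x. gen (EJ x))"

definition ext_st :: "(ext_gen, 'k::field) free" where "ext_st = gen ES * gen ET - 1"
definition ext_ts :: "(ext_gen, 'k::field) free" where "ext_ts = gen ET * gen ES - 1"
definition ext_ss :: "(ext_gen, 'k::field) free" where "ext_ss = gen ES * gen ES - gen (EJ JG)"
definition ext_tt :: "(ext_gen, 'k::field) free" where "ext_tt = gen ET * gen ET - gen (EJ JGi)"
definition ext_sG :: "(ext_gen, 'k::field) free" where "ext_sG = gen ES * gen (EJ JG) - gen (EJ JG) * gen ES"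
definition ext_tG :: "(ext_gen, 'k::field) free" where "ext_tG = gen ET * gen (EJ JG) - gen ES"
definition ext_Gt :: "(ext_gen, 'k::field) free" where "ext_Gt = gen (EJ JG) * gen ET - gen ES"
definition ext_sGi :: "(ext_gen, 'k::field) free" where "ext_sGi = gen ES * gen (EJ JGi) - gen ET"
definition ext_Gis :: "(ext_gen, 'k::field) free" where "ext_Gis = gen (EJ JGi) * gen ES - gen ET"
definition ext_tGi :: "(ext_gen, 'k::field) free" where "ext_tGi = gen ET * gen (EJ JGi) - gen (EJ JGi) * gen ET"
definition ext_sA1 :: "(ext_gen, 'k::field) free" where "ext_sA1 = gen ES * gen (EJ JA1) - emb (jordan_conj JA1) * gen ES"
definition ext_sA2 :: "(ext_gen, 'k::field) free" where "ext_sA2 = gen ES * gen (EJ JA2) - emb (jordan_conj JA2) * gen ES"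
text \<open>\<open>ext_A1s\<close> and \<open>ext_A2s\<close> move \<open>s\<close> to the left, by
  \<open>a s = s b\<close> with \<open>b\<close> the preimage of \<open>a\<close> under conjugation.
  The constants 1/2 and 3/8 are those of the inverse automorphism.\<close>

definition ext_A1s :: "(ext_gen, 'k::field) free" where "ext_A1s = gen (EJ JA1) * gen ES - gen ES * (gen (EJ JA1) - cst (1 / 2) * (1 - gen (EJ JG)))"
definition ext_A2s :: "(ext_gen, 'k::field) free" where "ext_A2s = gen (EJ JA2) * gen ES - gen ES * (gen (EJ JA2) - cst (1 / 2) * gen (EJ JA1) + cst (3 / 8) * (1 - gen (EJ JG)))"
definition ext_A1t :: "(ext_gen, 'k::field) free" where "ext_A1t = gen (EJ JA1) * gen ET - gen ET * emb (jordan_conj JA1)"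
definition ext_A2t :: "(ext_gen, 'k::field) free" where "ext_A2t = gen (EJ JA2) * gen ET - gen ET * emb (jordan_conj JA2)"

lemmas ext_base_defs = ext_st_def ext_ts_def ext_ss_def ext_tt_def ext_sG_def ext_tG_def ext_Gt_def ext_sGi_def ext_Gis_def ext_tGi_def ext_sA1_def ext_sA2_def
lemmas ext_poly_defs = ext_base_defs ext_A1s_def ext_A2s_def ext_A1t_def ext_A2t_def jordan_conj_defs jordan_poly_defs

text \<open>A stock of identities from which certificates are built. That they hold in the extension
  is \<open>theta_rels\<close>.\<close>

definition ext_rels :: "'k::field \<Rightarrow> (ext_gen, 'k) free set" where
  "ext_rels lam = emb ` jordan_lam_rels lam \<union> {ext_st, ext_ts, ext_ss, ext_tt, ext_sG, ext_tG, ext_Gt, ext_sGi, ext_Gis, ext_tGi, ext_sA1, ext_sA2}"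

lemma ext_Idl_emb: "p \<in> rel_ideal (jordan_lam_rels lam) \<Longrightarrow> emb p \<in> rel_ideal (ext_rels lam)"
  by (rule Idl_subst) (auto simp: ext_rels_def)

lemma ext_Idl_base:
  "ext_st \<in> rel_ideal (ext_rels lam)"
  "ext_ts \<in> rel_ideal (ext_rels lam)"
  "ext_ss \<in> rel_ideal (ext_rels lam)"
  "ext_tt \<in> rel_ideal (ext_rels lam)"
  "ext_sG \<in> rel_ideal (ext_rels lam)"
  "ext_tG \<in> rel_ideal (ext_rels lam)"
  "ext_Gt \<in> rel_ideal (ext_rels lam)"
  "ext_sGi \<in> rel_ideal (ext_rels lam)"
  "ext_Gis \<in> rel_ideal (ext_rels lam)"
  "ext_tGi \<in> rel_ideal (ext_rels lam)"
  "ext_sA1 \<in> rel_ideal (ext_rels lam)"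
  "ext_sA2 \<in> rel_ideal (ext_rels lam)"
  by (rule Idl_base, simp add: ext_rels_def)+

lemma ext_A1s_Idl:
  fixes lam :: "'k::field_char_0"
  shows "(ext_A1s :: (ext_gen, 'k) free) \<in> rel_ideal (ext_rels lam)" (is "_ \<in> ?I")
proof (rule Idl_certificate)
  show "tm (-1 / 2) [] ext_sG [] + tm (-1) [] ext_sA1 [] \<in> ?I"
    by (intro Idl_add Idl_mult ext_Idl_base)
qed (simp only: ext_poly_defs expand_substs, simp only: expand_words;
    rule poly_mapping_eqI; simp only: lookup_words; simp add: field_simps)

lemma ext_A2s_Idl:
  fixes lam :: "'k::field_char_0"
  shows "(ext_A2s :: (ext_gen, 'k) free) \<in> rel_ideal (ext_rels lam)" (is "_ \<in> ?I")
proof (rule Idl_certificate)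
  show "tm (1 / 8) [] ext_sG [] + tm (-1) [] ext_sA2 [] + tm (-1 / 2) [] ext_A1s [] \<in> ?I"
    by (intro Idl_add Idl_mult ext_A1s_Idl ext_Idl_base)
qed (simp only: ext_poly_defs expand_substs, simp only: expand_words;
    rule poly_mapping_eqI; simp only: lookup_words; simp add: field_simps)

lemma ext_A1t_Idl:
  fixes lam :: "'k::field_char_0"
  shows "(ext_A1t :: (ext_gen, 'k) free) \<in> rel_ideal (ext_rels lam)" (is "_ \<in> ?I")
proof (rule Idl_certificate)
  show "tm 1 [ET, EJ JA1] ext_st [] + tm (-1 / 2) [ET, EJ JG] ext_st [] + tm (-1) [] ext_ts [EJ JA1, ET] +
      tm (1 / 2) [ET] ext_st [] + tm 1 [ET] ext_sA1 [ET] \<in> ?I"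
    by (intro Idl_add Idl_mult ext_Idl_base)
qed (simp only: ext_poly_defs expand_substs, simp only: expand_words;
    rule poly_mapping_eqI; simp only: lookup_words; simp add: field_simps)

lemma ext_A2t_Idl:
  fixes lam :: "'k::field_char_0"
  shows "(ext_A2t :: (ext_gen, 'k) free) \<in> rel_ideal (ext_rels lam)" (is "_ \<in> ?I")
proof (rule Idl_certificate)
  show "tm (1 / 2) [ET, EJ JA1] ext_st [] + tm 1 [ET, EJ JA2] ext_st [] + tm (1 / 8) [ET, EJ JG] ext_st [] +
      tm (-1) [] ext_ts [EJ JA2, ET] + tm (-1 / 8) [ET] ext_st [] + tm 1 [ET] ext_sA2 [ET] \<in> ?I"
    by (intro Idl_add Idl_mult ext_Idl_base)
qed (simp only: ext_poly_defs expand_substs, simp only: expand_words;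
    rule poly_mapping_eqI; simp only: lookup_words; simp add: field_simps)

lemmas ext_Idl = jordan_lam_Idls[THEN ext_Idl_emb] ext_Idl_base ext_A1s_Idl ext_A2s_Idl ext_A1t_Idl ext_A2t_Idl

text \<open>The formulas for \<open>a1\<close> and \<open>a2\<close> solved for \<open>x\<close> and
  \<open>y\<close>, followed by \<open>K = x T\<close> and \<open>Y = y T\<close>.\<close>

definition ohn_to_ext :: "'k::field \<Rightarrow> 'k \<Rightarrow> ohn_gen \<Rightarrow> (ext_gen, 'k) free" where
  "ohn_to_ext hbar lam = case_ohn_gen (cst 2 * (gen (EJ JA1) * gen ET))
     (cst (- 4 * hbar) * ((gen (EJ JA2) + cst (1 / 2) * gen (EJ JA1) - cst (lam + 1 / 32) * (1 - gen (EJ JG))) * gen ET))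
     (gen ET) (gen ES)"

lemmas ohn_to_ext_defs = ohn_to_ext_def ohn_gen.case

section \<open>Relations of the Ohn algebra in the quadratic extension\<close>

lemma ohn_to_ext_TTi:
  fixes hbar lam :: "'k::field_char_0"
  shows "subst (ohn_to_ext hbar lam) (ohn_TTi) \<in> rel_ideal (ext_rels lam)" (is "_ \<in> ?I")
proof (rule Idl_certificate)
  show "tm 1 [] ext_ts [] \<in> ?I"
    by (intro Idl_add Idl_mult ext_Idl)
qed (simp only: ohn_poly_defs ohn_to_ext_defs ext_poly_defs expand_substs, simp only: expand_words;
    rule poly_mapping_eqI; simp only: lookup_words; simp add: field_simps)

lemma ohn_to_ext_TiT:
  fixes hbar lam :: "'k::field_char_0"
  shows "subst (ohn_to_ext hbar lam) (ohn_TiT) \<in> rel_ideal (ext_rels lam)" (is "_ \<in> ?I")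
proof (rule Idl_certificate)
  show "tm 1 [] ext_st [] \<in> ?I"
    by (intro Idl_add Idl_mult ext_Idl)
qed (simp only: ohn_poly_defs ohn_to_ext_defs ext_poly_defs expand_substs, simp only: expand_words;
    rule poly_mapping_eqI; simp only: lookup_words; simp add: field_simps)

lemma ohn_to_ext_KT:
  fixes hbar lam :: "'k::field_char_0"
  shows "subst (ohn_to_ext hbar lam) (ohn_KT) \<in> rel_ideal (ext_rels lam)" (is "_ \<in> ?I")
proof (rule Idl_certificate)
  show "tm 2 [EJ JA1] ext_tt [] + tm (-2) [ET] ext_A1t [] + tm (-2) [] ext_tt [EJ JA1] + tm 1 [] ext_tt [EJ JG] +
      tm (-2) [] (emb jordan_GiA1) [] + tm 1 [] (emb jordan_GiG) [] + tm (-2) [] ext_tt [] \<in> ?I"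
    by (intro Idl_add Idl_mult ext_Idl)
qed (simp only: ohn_poly_defs ohn_to_ext_defs ext_poly_defs expand_substs, simp only: expand_words;
    rule poly_mapping_eqI; simp only: lookup_words; simp add: field_simps)

lemma ohn_to_ext_YT:
  fixes hbar lam :: "'k::field_char_0"
  shows "subst (ohn_to_ext hbar lam) (ohn_YT hbar) \<in> rel_ideal (ext_rels lam)" (is "_ \<in> ?I")
proof (rule Idl_certificate)
  show "tm (-hbar) [EJ JA1] ext_tt [] + tm (-4 * hbar) [EJ JA2] ext_tt [] +
      tm (-hbar / 8 - 4 * hbar * lam) [EJ JG] ext_tt [] + tm (3 * hbar) [ET] ext_A1t [] +
      tm (4 * hbar) [ET] ext_A2t [] + tm (hbar / 8 + 4 * hbar * lam) [] ext_tG [ET] +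
      tm (5 * hbar) [] ext_tt [EJ JA1] + tm (4 * hbar) [] ext_tt [EJ JA2] + tm (-hbar) [] ext_tt [EJ JG] +
      tm hbar [] (emb jordan_GiA1) [] + tm (4 * hbar) [] (emb jordan_GiA2) [] +
      tm (-hbar / 8 - 4 * hbar * lam) [] (emb jordan_GGi) [] + tm (-hbar) [] (emb jordan_GiG) [] +
      tm (hbar / 8 + 4 * hbar * lam) [] ext_st [] + tm hbar [] ext_tt [] \<in> ?I"
    by (intro Idl_add Idl_mult ext_Idl)
qed (simp only: ohn_poly_defs ohn_to_ext_defs ext_poly_defs expand_substs, simp only: expand_words;
    rule poly_mapping_eqI; simp only: lookup_words; simp add: field_simps)

text \<open>The counterpart of \<open>jordan_to_ohn_zl\<close>: \<open>jordan_zl lam\<close> enters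
  once, between two factors \<open>T\<close>, for the commutator of \<open>a1\<close> and
  \<open>a2\<close>. None of the other Ohn relations involves it.\<close>

lemma ohn_to_ext_KY:
  fixes hbar lam :: "'k::field_char_0"
  shows "subst (ohn_to_ext hbar lam) (ohn_KY hbar) \<in> rel_ideal (ext_rels lam)" (is "_ \<in> ?I")
proof (rule Idl_certificate)
  show "tm (-8 * hbar) [] ext_A1t [EJ JA2, ET] + tm (-hbar / 4 - 8 * hbar * lam) [EJ JA1] ext_tG [ET] +
      tm (8 * hbar) [EJ JA2, ET] ext_A1t [] + tm (8 * hbar) [EJ JA2] ext_tt [EJ JA1] +
      tm (-4 * hbar) [EJ JA2] ext_tt [EJ JG] + tm (hbar / 4 + 8 * hbar * lam) [] ext_Gt [EJ JA1, ET] +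
      tm (-8 * hbar) [ET] (emb (jordan_zl lam)) [ET] + tm (-4 * hbar) [ET, EJ JA1] ext_A1t [] +
      tm (-4 * hbar) [ET] ext_A1t [EJ JA1] + tm (2 * hbar) [ET, EJ JA1] ext_tG [] +
      tm (-8 * hbar) [ET, EJ JA2] ext_A1t [] + tm (-8 * hbar) [ET] ext_A2t [EJ JA1] +
      tm (4 * hbar) [ET, EJ JA2] ext_tG [] + tm (4 * hbar) [] ext_tG [EJ JA2, ET] +
      tm (8 * hbar * lam) [] ext_tG [EJ JG, ET] + tm (-8 * hbar) [] ext_tt [EJ JA1, EJ JA1] +
      tm (-8 * hbar) [] ext_tt [EJ JA2, EJ JA1] + tm hbar [] ext_tt [EJ JG, EJ JA1] +
      tm (-hbar / 4 - 8 * hbar * lam) [EJ JA1] ext_st [] + tm (-hbar) [EJ JA1] ext_ts [] +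
      tm (-3 * hbar / 4 + 8 * hbar * lam) [EJ JA1] ext_tt [] + tm (-8 * hbar) [] (emb jordan_GiA2) [EJ JA1] +
      tm (-4 * hbar) [EJ JA2] (emb jordan_GiG) [] + tm (-2 * hbar) [EJ JA2] ext_ts [] +
      tm (2 * hbar) [EJ JA2] ext_tt [] + tm (-hbar / 16 - 2 * hbar * lam) [EJ JG] ext_ts [] +
      tm (-hbar / 16 - 2 * hbar * lam) [EJ JG] ext_tt [] + tm hbar [] (emb jordan_GiG) [EJ JA1] +
      tm (-3 * hbar / 4 + 8 * hbar * lam) [ES] ext_A1t [] + tm (2 * hbar) [ES] ext_A2t [] +
      tm (-hbar / 16 + 6 * hbar * lam) [ES] ext_Gt [] + tm (hbar / 4 + 8 * hbar * lam) [] ext_st [EJ JA1] +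
      tm (2 * hbar) [] ext_st [EJ JA2] + tm (5 * hbar / 8 - 4 * hbar * lam) [] ext_st [EJ JG] +
      tm (2 * hbar) [ET] ext_A1s [] + tm (3 * hbar / 4 - 8 * hbar * lam) [ET] ext_A1t [] +
      tm (4 * hbar) [ET] ext_A2s [] + tm (-2 * hbar) [ET] ext_A2t [] +
      tm (-hbar / 16 - 2 * hbar * lam) [] ext_tG [ET] + tm (4 * hbar) [] ext_ts [EJ JA2] +
      tm (-hbar / 2) [] ext_ts [EJ JG] + tm (-5 * hbar / 4 - 8 * hbar * lam) [] ext_tt [EJ JA1] +
      tm (-2 * hbar) [] ext_tt [EJ JA2] + tm (-5 * hbar / 8 + 4 * hbar * lam) [] ext_tt [EJ JG] +
      tm (3 * hbar / 4 - 8 * hbar * lam) [] (emb jordan_GiA1) [] + tm (-2 * hbar) [] (emb jordan_GiA2) [] +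
      tm (-hbar / 16 - 2 * hbar * lam) [] (emb jordan_GGi) [] +
      tm (-5 * hbar / 8 + 4 * hbar * lam) [] (emb jordan_GiG) [] +
      tm (-hbar / 16 + 6 * hbar * lam) [] ext_ss [] + tm (-5 * hbar / 8 + 4 * hbar * lam) [] ext_st [] +
      tm (9 * hbar / 16 + 2 * hbar * lam) [] ext_ts [] + tm (3 * hbar / 4 - 8 * hbar * lam) [] ext_tt [] \<in> ?I"
    by (intro Idl_add Idl_mult ext_Idl)
qed (simp only: ohn_poly_defs ohn_to_ext_defs ext_poly_defs expand_substs, simp only: expand_words;
    rule poly_mapping_eqI; simp only: lookup_words; simp add: field_simps)

section \<open>The composite on the generators of the Jordan type algebra\<close>

lemma jordan_to_ohn_to_ext_JA1:
  fixes hbar lam :: "'k::field_char_0"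
  assumes "hbar \<noteq> 0"
  shows "subst (ohn_to_ext hbar lam) (jordan_to_ohn hbar lam JA1) - gen (EJ JA1) \<in> rel_ideal (ext_rels lam)" (is "_ \<in> ?I")
proof (rule Idl_certificate)
  show "tm 1 [EJ JA1] ext_ts [] \<in> ?I"
    by (intro Idl_add Idl_mult ext_Idl)
qed (simp only: jordan_to_ohn_defs ohn_to_ext_defs ext_poly_defs expand_substs, simp only: expand_words;
    rule poly_mapping_eqI; simp only: lookup_words; simp add: field_simps assms)

lemma jordan_to_ohn_to_ext_JA2:
  fixes hbar lam :: "'k::field_char_0"
  assumes "hbar \<noteq> 0"
  shows "subst (ohn_to_ext hbar lam) (jordan_to_ohn hbar lam JA2) - gen (EJ JA2) \<in> rel_ideal (ext_rels lam)" (is "_ \<in> ?I")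
proof (rule Idl_certificate)
  show "tm 1 [EJ JA2] ext_ts [] + tm (1 / 32 + lam) [EJ JG] ext_ts [] + tm (-1 / 32 - lam) [] ext_ss [] +
      tm (-1 / 32 - lam) [] ext_ts [] \<in> ?I"
    by (intro Idl_add Idl_mult ext_Idl)
qed (simp only: jordan_to_ohn_defs ohn_to_ext_defs ext_poly_defs expand_substs, simp only: expand_words;
    rule poly_mapping_eqI; simp only: lookup_words; simp add: field_simps assms)

lemma jordan_to_ohn_to_ext_JG:
  fixes hbar lam :: "'k::field_char_0"
  assumes "hbar \<noteq> 0"
  shows "subst (ohn_to_ext hbar lam) (jordan_to_ohn hbar lam JG) - gen (EJ JG) \<in> rel_ideal (ext_rels lam)" (is "_ \<in> ?I")
proof (rule Idl_certificate)
  show "tm 1 [] ext_ss [] \<in> ?I"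
    by (intro Idl_add Idl_mult ext_Idl)
qed (simp only: jordan_to_ohn_defs ohn_to_ext_defs ext_poly_defs expand_substs, simp only: expand_words;
    rule poly_mapping_eqI; simp only: lookup_words; simp add: field_simps assms)

lemma jordan_to_ohn_to_ext_JGi:
  fixes hbar lam :: "'k::field_char_0"
  assumes "hbar \<noteq> 0"
  shows "subst (ohn_to_ext hbar lam) (jordan_to_ohn hbar lam JGi) - gen (EJ JGi) \<in> rel_ideal (ext_rels lam)" (is "_ \<in> ?I")
proof (rule Idl_certificate)
  show "tm 1 [] ext_tt [] \<in> ?I"
    by (intro Idl_add Idl_mult ext_Idl)
qed (simp only: jordan_to_ohn_defs ohn_to_ext_defs ext_poly_defs expand_substs, simp only: expand_words;
    rule poly_mapping_eqI; simp only: lookup_words; simp add: field_simps assms)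

section \<open>The ideal of the Jordan type relation\<close>

lemma truncate_jordan_tilde: "module.truncate (jordan_tilde :: ('k::field_char_0, _) hopf) = pres_alg jordan_rels"
  unfolding jordan_tilde_eq by (rule jordan.truncate_pres_hopf)

lemma tensor_jordan_tilde:
  "tensor (jordan_tilde :: ('k::field_char_0, _) hopf) jordan_tilde = tensor (pres_alg jordan_rels) (pres_alg jordan_rels)"
  "tens (jordan_tilde :: ('k::field_char_0, _) hopf) jordan_tilde = tens (pres_alg jordan_rels) (pres_alg jordan_rels)"
  unfolding truncate_jordan_tilde[symmetric] by simp_all

lemma alg_hom_jordan_tilde: "alg_hom (jordan_tilde :: ('k::field_char_0, _) hopf) B = alg_hom (pres_alg jordan_rels) B"
  unfolding truncate_jordan_tilde[symmetric] by simp

lemma k_algebra_jordan_tilde: "k_algebra (jordan_tilde :: ('k::field_char_0, _) hopf)"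
  using k_algebra_truncate[of "jordan_tilde :: ('k, _) hopf"] by (simp add: truncate_jordan_tilde k_algebra_pres_alg)

lemma jordan_ideal_eq: "jordan_ideal lam = Idl\<^bsub>jordan_tilde\<^esub> {pres_class jordan_rels (jordan_zl lam)}"
  by (simp add: jordan_ideal_def jordan_cls_def jordan_zl_def)

lemma jordan_tilde_carrier: "carrier (jordan_tilde :: ('k::field_char_0, _) hopf) = carrier (pres_alg jordan_rels)"
  and jordan_tilde_mult: "a \<otimes>\<^bsub>jordan_tilde\<^esub> b = a \<otimes>\<^bsub>pres_alg jordan_rels\<^esub> (b :: (jordan_gen, 'k::field_char_0) free set)"
  unfolding truncate_jordan_tilde[symmetric] by simp_all

lemma cls_jordan_tilde: "pres_class jordan_rels p \<in> carrier (jordan_tilde :: ('k::field_char_0, _) hopf)"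
  unfolding jordan_tilde_carrier by (rule jordan.cls_closed)

lemma hopf_ideal_jordan_ideal: "hopf_ideal (jordan_ideal lam) (jordan_tilde :: ('k::field_char_0, _) hopf)"
  unfolding jordan_ideal_eq
proof (rule hopf_ideal_genideal)
  let ?z = "pres_class jordan_rels (jordan_zl lam)" and ?I = "Idl\<^bsub>jordan_tilde\<^esub> {pres_class jordan_rels (jordan_zl lam)}"
  have X: "{?z} \<subseteq> carrier jordan_tilde" by (simp add: cls_jordan_tilde)
  interpret JT: k_algebra "jordan_tilde :: ('k, _) hopf" by (rule k_algebra_jordan_tilde)
  interpret I: ideal ?I jordan_tilde by (rule JT.genideal_ideal[OF X])
  have zI: "?z \<in> ?I" using JT.genideal_self[OF X] by simp
  show "hopf_algebra (jordan_tilde :: ('k, _) hopf)" by (rule hopf_algebra_jordan_tilde)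
  show "antipode jordan_tilde \<in> alg_hom (jordan_tilde :: ('k, _) hopf) (op_alg (module.truncate jordan_tilde))"
    unfolding alg_hom_jordan_tilde truncate_jordan_tilde unfolding jordan_tilde_eq by (rule jordan.antipode_hom)
  show "{?z} \<subseteq> carrier jordan_tilde" by (rule X)
  fix x assume "x \<in> {?z}"
  then have x: "x = ?z" by simp
  have "comult jordan_tilde ?z = square_eval jordan_rels (subst jordan_comult_poly (jordan_zl lam))"
    unfolding jordan_tilde_eq by (rule jordan.comult_poly_cls)
  \<comment> \<open>The factor \<open>inr 1\<close> is spelled out so that
    \<open>square_eval_tens\<close> reads both summands as pure tensors, each with one factor in the
    ideal.\<close>
  also have "\<dots> = square_eval jordan_rels (inl (jordan_zl lam) * inr 1 + inl (gen JG * gen JG) * inr (jordan_zl lam))"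
    using square_eval_eqI[OF jordan_comult_zl[of lam]] by simp
  also have "\<dots> = tens jordan_tilde jordan_tilde ?z (pres_class jordan_rels 1) \<oplus>\<^bsub>tensor jordan_tilde jordan_tilde\<^esub>
      tens jordan_tilde jordan_tilde (pres_class jordan_rels (gen JG * gen JG)) ?z"
    unfolding tensor_jordan_tilde square_eval_tens by (rule jordan.T.free_hom_simps(2)[OF square_eval_hom])
  finally have e: "comult jordan_tilde ?z = tens jordan_tilde jordan_tilde ?z (pres_class jordan_rels 1) \<oplus>\<^bsub>tensor jordan_tilde jordan_tilde\<^esub>
      tens jordan_tilde jordan_tilde (pres_class jordan_rels (gen JG * gen JG)) ?z" .
  have "tens jordan_tilde jordan_tilde ?z (pres_class jordan_rels 1) \<in> mixed_tensors jordan_tilde ?I"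
    "tens jordan_tilde jordan_tilde (pres_class jordan_rels (gen JG * gen JG)) ?z \<in> mixed_tensors jordan_tilde ?I"
    by (intro mixed_tensorsI[OF k_algebra_jordan_tilde I.ideal_axioms] zI cls_jordan_tilde)+
  from this[THEN generate.incl, of "add_monoid (tensor jordan_tilde jordan_tilde)"]
  show "comult jordan_tilde x \<in> generate (add_monoid (tensor jordan_tilde jordan_tilde)) (mixed_tensors jordan_tilde ?I)"
    unfolding x e by (metis generate.eng monoid.select_convs(1))
  have "counit jordan_tilde ?z = free_eval base_alg (case_jordan_gen 0 0 1 1) (jordan_zl lam)"
    unfolding jordan_tilde_eq by (rule jordan.counit_cls)
  then show "counit jordan_tilde x = 0" by (simp add: x jordan_zl_eq)
  have "antipode jordan_tilde ?z = pres_class jordan_rels (op_subst jordan_antipode_poly (jordan_zl lam))"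
    unfolding jordan_tilde_eq by (rule jordan.antipode_poly_cls)
  also have "\<dots> = pres_class jordan_rels (- (gen JGi * gen JGi) * jordan_zl lam)"
    using jordan_antipode_zl[of lam] by (simp only: pres_class_eq_iff)
  also have "\<dots> = pres_class jordan_rels (- (gen JGi * gen JGi)) \<otimes>\<^bsub>jordan_tilde\<^esub> ?z"
    unfolding jordan_tilde_mult by (rule jordan.A.free_hom_simps(3)[OF pres_class_hom])
  finally show "antipode jordan_tilde x \<in> ?I"
    using I.I_l_closed[OF zI cls_jordan_tilde] by (simp only: x)
qed

lemma free_hom_eqI:
  assumes B: "k_algebra B" and h: "h \<in> alg_hom free_alg B" and R: "\<And>r. r \<in> R \<Longrightarrow> h r = \<zero>\<^bsub>B\<^esub>"
    and p: "p - q \<in> rel_ideal R"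
  shows "h p = h q"
proof -
  interpret B: k_algebra B by fact
  have "h p \<ominus>\<^bsub>B\<^esub> h q = \<zero>\<^bsub>B\<^esub>"
    using free_hom_Idl_zero[OF B h R p] by (simp add: B.free_hom_simps[OF h])
  then show ?thesis by (simp add: B.free_hom_simps[OF h])
qed

locale jordan_type =
  fixes lam :: "'k::field_char_0"
begin

abbreviation JT :: "('k, (jordan_gen, 'k) free set) hopf" where "JT \<equiv> jordan_tilde"
abbreviation I where "I \<equiv> jordan_ideal lam"
abbreviation Q where "Q \<equiv> alg_quot JT I"
abbreviation \<pi> where "\<pi> \<equiv> \<lambda>a. I +>\<^bsub>JT\<^esub> a"

text \<open>Elements of the quotient are cosets of cosets. Going through both projections at once,
  \<open>q\<close> lets the quotient be handled like an algebra presented by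
  \<open>jordan_lam_rels lam\<close>.\<close>

definition q :: "(jordan_gen, 'k) free \<Rightarrow> (jordan_gen, 'k) free set set" where
  "q p = \<pi> (pres_class jordan_rels p)"

lemma ideal_I: "ideal I JT"
  using hopf_ideal_jordan_ideal[of lam] by (simp add: hopf_ideal_def)

sublocale Q: alg_ideal JT I
  using ideal_I k_algebra_jordan_tilde by (simp add: alg_ideal_def)

lemmas K = k_algebra_jordan_tilde
lemmas KQ = Q.k_algebra_alg_quot

sublocale QQ: k_algebra Q by (rule KQ)

lemma q_hom: "q \<in> alg_hom free_alg Q"
  unfolding q_def[abs_def] using alg_hom_comp[OF pres_class_hom, of \<pi> jordan_rels Q] Q.proj_hom
  by (simp add: alg_hom_jordan_tilde)

lemma q_rels: "r \<in> jordan_lam_rels lam \<Longrightarrow> q r = \<zero>\<^bsub>Q\<^esub>"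
proof -
  assume r: "r \<in> jordan_lam_rels lam"
  have "pres_class jordan_rels r \<in> I"
  proof (cases "r = jordan_zl lam")
    case True
    then show ?thesis unfolding jordan_ideal_eq
      using Q.genideal_self[of "{pres_class jordan_rels (jordan_zl lam)}"] by (simp add: True cls_jordan_tilde)
  next
    case False
    then have "pres_class jordan_rels r = \<zero>\<^bsub>pres_alg jordan_rels\<^esub>"
      using r by (simp add: jordan_lam_rels_def pres_class_eq_zero_iff Idl_base)
    then have "pres_class jordan_rels r = \<zero>\<^bsub>JT\<^esub>" unfolding truncate_jordan_tilde[symmetric] by simp
    then show ?thesis using Q.I.zero_closed by simp
  qed
  then show ?thesis unfolding q_def by (simp add: Q.proj_eq_zero_iff cls_jordan_tilde)
qed

lemma q_eqI: "p - p' \<in> rel_ideal (jordan_lam_rels lam) \<Longrightarrow> q p = q p'"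
  by (rule free_hom_eqI[OF KQ q_hom q_rels])

lemma q_Idl: "p \<in> rel_ideal (jordan_lam_rels lam) \<Longrightarrow> q p = \<zero>\<^bsub>Q\<^esub>"
  by (rule free_hom_Idl_zero[OF KQ q_hom q_rels])

lemma Q_carrier: "a \<in> carrier Q \<longleftrightarrow> (\<exists>p. a = q p)"
  unfolding q_def Q.proj_carrier jordan_tilde_carrier Bex_def pres_alg_carrier by metis

lemmas q_simps = QQ.free_hom_simps[OF q_hom]

context
  fixes B :: "('k, 'b, 'm) module_scheme" and h :: "(jordan_gen, 'k) free \<Rightarrow> 'b"
  assumes B: "k_algebra B" and h: "h \<in> alg_hom free_alg B" and rels: "\<And>r. r \<in> jordan_lam_rels lam \<Longrightarrow> h r = \<zero>\<^bsub>B\<^esub>"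
begin

text \<open>The descent follows the two stages of the quotient: \<open>h\<close> kills the relations
  of \<open>jordan_tilde\<close>, and the map obtained from it kills the class of
  \<open>jordan_zl lam\<close>. Hence \<open>coset_map\<close> is applied twice.\<close>

lemma lift_ideal: "i \<in> I \<Longrightarrow> coset_map h i = \<zero>\<^bsub>B\<^esub>"
  and lift_tilde: "coset_map h \<in> alg_hom JT B" "coset_map h (pres_class jordan_rels p) = h p"
proof -
  have r: "h r = \<zero>\<^bsub>B\<^esub>" if "r \<in> jordan_rels" for r using rels[of r] that by (simp add: jordan_lam_rels_def)
  show hom: "coset_map h \<in> alg_hom JT B" unfolding alg_hom_jordan_tilde by (rule pres_lift_hom[OF B h r])
  show cls: "coset_map h (pres_class jordan_rels p) = h p" for p by (rule pres_lift_class[OF B h r])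
  show "coset_map h i = \<zero>\<^bsub>B\<^esub>" if "i \<in> I"
    using that unfolding jordan_ideal_eq
    by (rule alg_hom_genideal_zero[OF K B hom, rotated 2])
      (auto simp: cls_jordan_tilde cls rels jordan_lam_rels_def)
qed

lemma lift_hom: "coset_map (coset_map h) \<in> alg_hom Q B"
  by (rule Q.coset_map_hom[OF B lift_tilde(1) lift_ideal])

lemma lift_q: "coset_map (coset_map h) (q p) = h p"
  unfolding q_def
  using Q.coset_map_proj[OF B alg_hom_linear[OF lift_tilde(1)] lift_ideal cls_jordan_tilde] by (simp add: lift_tilde(2))

end

subsection \<open>The quadratic extension\<close>

definition \<sigma> where "\<sigma> = coset_map (coset_map (\<lambda>p. q (subst jordan_conj p)))"

lemma conj_hom: "(\<lambda>p. q (subst jordan_conj p)) \<in> alg_hom free_alg Q"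
  by (rule alg_hom_comp[OF subst_hom q_hom])

lemma conj_rels: "r \<in> jordan_lam_rels lam \<Longrightarrow> q (subst jordan_conj r) = \<zero>\<^bsub>Q\<^esub>"
proof -
  assume "r \<in> jordan_lam_rels lam"
  then consider "r = jordan_zl lam" | "r = jordan_GGi" | "r = jordan_GiG" | "r = jordan_GA1" | "r = jordan_GA2"
    by (auto simp: jordan_lam_rels_def jordan_rels_eq)
  then have "subst jordan_conj r \<in> rel_ideal (jordan_lam_rels lam)"
    by cases (simp_all only: jordan_conj_zl jordan_conj_GGi jordan_conj_GiG jordan_conj_GA1 jordan_conj_GA2)
  then show "q (subst jordan_conj r) = \<zero>\<^bsub>Q\<^esub>"
    by (rule q_Idl)
qed

lemma sigma_q: "\<sigma> (q p) = q (subst jordan_conj p)"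
  unfolding \<sigma>_def by (rule lift_q[OF KQ conj_hom conj_rels])

lemma sigma_hom: "\<sigma> \<in> alg_hom Q Q"
  unfolding \<sigma>_def by (rule lift_hom[OF KQ conj_hom conj_rels])

sublocale tw: twisted Q \<sigma> "q (gen JG)"
proof
  show "\<sigma> \<in> alg_hom Q Q" by (rule sigma_hom)
  show "q (gen JG) \<in> carrier Q" by (rule q_simps)
  show "\<sigma> (q (gen JG)) = q (gen JG)" by (simp add: sigma_q jordan_conj_def)
  fix a assume "a \<in> carrier Q"
  then obtain p where a: "a = q p" using Q_carrier by blast
  \<comment> \<open>The identity moves \<open>g\<close> past one factor after the other, so if it
    holds for two elements it holds for their product; generators suffice.\<close>
  have "q (subst jordan_conj (subst jordan_conj p)) \<otimes>\<^bsub>Q\<^esub> q (gen JG) = q (gen JG) \<otimes>\<^bsub>Q\<^esub> q p"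
  proof (induction p rule: free_induct)
    case (gen_mult x p)
    have "q (subst jordan_conj (jordan_conj x) * gen JG) = q (gen JG * gen x)"
      by (rule q_eqI) (cases x; simp only: jordan_conj_conj_JA1 jordan_conj_conj_JA2 jordan_conj_conj_JG jordan_conj_conj_JGi)
    then have "q (subst jordan_conj (jordan_conj x)) \<otimes>\<^bsub>Q\<^esub> q (gen JG) = q (gen JG) \<otimes>\<^bsub>Q\<^esub> q (gen x)"
      by (simp only: q_simps(3))
    then show ?case
      using gen_mult QQ.m_assoc[OF q_simps(1) q_simps(1) q_simps(1)] by (simp add: q_simps(3)) (metis QQ.m_assoc q_simps(1))
  qed (simp_all add: q_simps QQ.l_distr QQ.r_distr QQ.smult_mult_left QQ.smult_mult_right)
  then show "\<sigma> (\<sigma> a) \<otimes>\<^bsub>Q\<^esub> q (gen JG) = q (gen JG) \<otimes>\<^bsub>Q\<^esub> a" by (simp add: a sigma_q)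
qed

abbreviation E where "E \<equiv> twist_ext Q \<sigma> (q (gen JG))"

text \<open>The value of \<open>ES\<close> is \<open>s\<close> itself. Its inverse is
  \<open>g^-1 s\<close>, since \<open>g^-1 s s = g^-1 g = 1\<close>, which explains the value of
  \<open>ET\<close>.\<close>

definition ext_value :: "ext_gen \<Rightarrow> (jordan_gen, 'k) free set set \<times> (jordan_gen, 'k) free set set" where
  "ext_value = case_ext_gen (\<lambda>x. (q (gen x), \<zero>\<^bsub>Q\<^esub>)) (\<zero>\<^bsub>Q\<^esub>, \<one>\<^bsub>Q\<^esub>) (\<zero>\<^bsub>Q\<^esub>, q (gen JGi))"

definition \<theta> where "\<theta> = free_eval E ext_value"

lemmas KE = tw.k_algebra_twist_ext

sublocale EE: k_algebra E by (rule KE)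

lemma ext_value_closed: "ext_value x \<in> carrier E"
  by (cases x) (simp_all add: ext_value_def q_simps(1))

lemma theta_hom: "\<theta> \<in> alg_hom free_alg E"
  unfolding \<theta>_def by (rule EE.free_eval_hom[OF ext_value_closed])

lemma theta_gen: "\<theta> (gen x) = ext_value x"
  unfolding \<theta>_def by (rule EE.free_eval_gen[OF ext_value_closed])

lemma theta_emb: "\<theta> (emb p) = (q p, \<zero>\<^bsub>Q\<^esub>)"
  by (rule EE.alg_hom_free_ext[OF alg_hom_comp[OF subst_hom theta_hom] alg_hom_comp[OF q_hom tw.twist_embed]])
    (simp add: theta_gen ext_value_def)

lemma q_inverse: "q (gen JG) \<otimes>\<^bsub>Q\<^esub> q (gen JGi) = \<one>\<^bsub>Q\<^esub>" "q (gen JGi) \<otimes>\<^bsub>Q\<^esub> q (gen JG) = \<one>\<^bsub>Q\<^esub>"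
proof -
  have "q (gen JG * gen JGi) = q 1" "q (gen JGi * gen JG) = q 1"
    by (rule q_eqI, use jordan_lam_Idls[of lam] in \<open>simp add: jordan_GGi_def jordan_GiG_def\<close>)+
  then show "q (gen JG) \<otimes>\<^bsub>Q\<^esub> q (gen JGi) = \<one>\<^bsub>Q\<^esub>" "q (gen JGi) \<otimes>\<^bsub>Q\<^esub> q (gen JG) = \<one>\<^bsub>Q\<^esub>"
    by (simp_all only: q_simps(3,4))
qed

lemma theta_rels: "r \<in> ext_rels lam \<Longrightarrow> \<theta> r = \<zero>\<^bsub>E\<^esub>"
proof -
  have s: "jordan_conj JG = (gen JG :: (jordan_gen, 'k) free)" "jordan_conj JGi = (gen JGi :: (jordan_gen, 'k) free)"
    by (simp_all add: jordan_conj_def)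
  have eq: "\<theta> (a - b) = \<zero>\<^bsub>E\<^esub>" if "\<theta> a = \<theta> b" for a b
    using that EE.free_hom_simps(1)[OF theta_hom, of b] EE.r_neg[of "\<theta> b"]
    by (simp only: EE.free_hom_simps(7)[OF theta_hom] EE.minus_eq)
  have g: "\<theta> (gen ES) = (\<zero>\<^bsub>Q\<^esub>, \<one>\<^bsub>Q\<^esub>)" "\<theta> (gen ET) = (\<zero>\<^bsub>Q\<^esub>, q (gen JGi))"
    "\<theta> (gen (EJ x)) = (q (gen x), \<zero>\<^bsub>Q\<^esub>)" for x
    by (simp_all add: theta_gen ext_value_def)
  have m: "\<theta> (a * b) = \<theta> a \<otimes>\<^bsub>E\<^esub> \<theta> b" "\<theta> 1 = \<one>\<^bsub>E\<^esub>" for a b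
    by (rule EE.free_hom_simps[OF theta_hom])+
  assume "r \<in> ext_rels lam"
  then consider (emb) p where "p \<in> jordan_lam_rels lam" "r = emb p"
    | (ext) "r \<in> {ext_st, ext_ts, ext_ss, ext_tt, ext_sG, ext_tG, ext_Gt, ext_sGi, ext_Gis, ext_tGi, ext_sA1, ext_sA2}"
    unfolding ext_rels_def by blast
  then show "\<theta> r = \<zero>\<^bsub>E\<^esub>"
  proof cases
    case emb
    then show ?thesis by (simp add: theta_emb q_rels)
  next
    case ext
    then show ?thesis
      by (elim insertE emptyE; hypsubst; unfold ext_base_defs; intro eq)
        (simp_all add: m g theta_emb q_simps(1) q_inverse s sigma_q QQ.m_assoc)
  qed
qed

end

section \<open>The embedding into the Ohn Hopf algebra\<close>

lemma truncate_ohn: "module.truncate (ohn (hbar :: 'k::field_char_0)) = pres_alg (ohn_rels hbar)"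
  unfolding ohn_eq by (rule ohn.truncate_pres_hopf)

lemma ohn_simps:
  fixes hbar :: "'k::field_char_0"
  shows "carrier (ohn hbar) = carrier (pres_alg (ohn_rels hbar))" "a \<otimes>\<^bsub>ohn hbar\<^esub> b = a \<otimes>\<^bsub>pres_alg (ohn_rels hbar)\<^esub> b"
    "a \<oplus>\<^bsub>ohn hbar\<^esub> b = a \<oplus>\<^bsub>pres_alg (ohn_rels hbar)\<^esub> b" "\<one>\<^bsub>ohn hbar\<^esub> = \<one>\<^bsub>pres_alg (ohn_rels hbar)\<^esub>"
    "c \<odot>\<^bsub>ohn hbar\<^esub> a = c \<odot>\<^bsub>pres_alg (ohn_rels hbar)\<^esub> a"
  unfolding truncate_ohn[symmetric] by simp_all

lemma ohn_maps:
  fixes hbar :: "'k::field_char_0"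
  shows "alg_hom A (ohn hbar) = alg_hom A (pres_alg (ohn_rels hbar))"
    "linear_maps (ohn hbar) B = linear_maps (pres_alg (ohn_rels hbar)) B"
    "tensor_map (ohn hbar) (ohn hbar) f g = tensor_map (pres_alg (ohn_rels hbar)) (pres_alg (ohn_rels hbar)) f g"
  unfolding truncate_ohn[symmetric] by simp_all

locale jordan_ohn = jordan_type lam for lam :: "'k::field_char_0" +
  fixes hbar :: 'k
  assumes hbar: "hbar \<noteq> 0"
begin

abbreviation L where "L \<equiv> ohn hbar"
abbreviation LA where "LA \<equiv> pres_alg (ohn_rels hbar)"
abbreviation oc where "oc \<equiv> pres_class (ohn_rels hbar)"

sublocale map: pres_poly_map jordan_rels jordan_comult_poly "case_jordan_gen 0 0 1 1" jordan_antipode_poly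
    "ohn_rels hbar" ohn_comult_poly "case_ohn_gen 0 0 1 1" ohn_antipode_poly "jordan_to_ohn hbar lam"
proof (intro pres_poly_map.intro pres_poly_map_axioms.intro jordan.pres_poly_axioms ohn.pres_poly_axioms)
  fix r :: "(jordan_gen, 'k) free" assume "r \<in> jordan_rels"
  then consider "r = jordan_GGi" | "r = jordan_GiG" | "r = jordan_GA1" | "r = jordan_GA2"
    by (auto simp: jordan_rels_eq)
  then show "subst (jordan_to_ohn hbar lam) r \<in> rel_ideal (ohn_rels hbar)"
    by cases (simp_all only: jordan_to_ohn_GGi[OF hbar] jordan_to_ohn_GiG[OF hbar] jordan_to_ohn_GA1[OF hbar] jordan_to_ohn_GA2[OF hbar])
next
  fix x :: jordan_gen
  show "subst ohn_comult_poly (jordan_to_ohn hbar lam x) - subst (case_sum (\<lambda>y. inl (jordan_to_ohn hbar lam y))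
      (\<lambda>y. inr (jordan_to_ohn hbar lam y))) (jordan_comult_poly x) \<in> rel_ideal (square_rels (ohn_rels hbar))"
    by (cases x; hypsubst; rule jordan_to_ohn_comult_JA1 jordan_to_ohn_comult_JA2 jordan_to_ohn_comult_JG jordan_to_ohn_comult_JGi; rule hbar)
  show "op_subst ohn_antipode_poly (jordan_to_ohn hbar lam x) - subst (jordan_to_ohn hbar lam) (jordan_antipode_poly x)
      \<in> rel_ideal (ohn_rels hbar)"
    by (cases x; hypsubst; rule jordan_to_ohn_antipode_JA1 jordan_to_ohn_antipode_JA2 jordan_to_ohn_antipode_JG jordan_to_ohn_antipode_JGi; rule hbar)
  show "free_eval base_alg (case_ohn_gen 0 0 1 1) (jordan_to_ohn hbar lam x) = case_jordan_gen 0 0 1 1 x"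
    by (cases x) (simp_all add: jordan_to_ohn_def)
qed

lemmas KL = k_algebra_pres_alg[of "ohn_rels hbar"]
lemmas oc_simps = k_algebra.free_hom_simps[OF KL pres_class_hom]

lemma rels_to_ohn: "r \<in> jordan_lam_rels lam \<Longrightarrow> oc (subst (jordan_to_ohn hbar lam) r) = \<zero>\<^bsub>LA\<^esub>"
  using map.rels jordan_to_ohn_zl[OF hbar, of lam] by (auto simp: jordan_lam_rels_def pres_class_eq_zero_iff)

definition f where "f = coset_map map.F"

lemma f_q: "f (q p) = oc (subst (jordan_to_ohn hbar lam) p)"
  unfolding f_def map.F_def by (rule lift_q[OF KL map.poly_hom rels_to_ohn])

lemma f_hom: "f \<in> alg_hom Q LA"
  unfolding f_def map.F_def by (rule lift_hom[OF KL map.poly_hom rels_to_ohn])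

lemma f_proj: "a \<in> carrier JT \<Longrightarrow> f (\<pi> a) = map.F a"
proof -
  assume "a \<in> carrier JT"
  then obtain p where p: "a = pres_class jordan_rels p" unfolding jordan_tilde_carrier pres_alg_carrier by blast
  show ?thesis using f_q[of p] by (simp add: p q_def map.F_class)
qed

lemma jordan_eq: "jordan lam = hopf_quot JT I"
  by (simp add: jordan_def)

lemma truncate_jordan: "module.truncate (jordan lam) = Q"
  unfolding jordan_eq by (rule hopf_quot_simps)

lemma jordan_maps:
  "carrier (jordan lam) = carrier Q" "alg_hom (jordan lam) B = alg_hom Q B" "linear_maps A (jordan lam) = linear_maps A Q"
  unfolding truncate_jordan[symmetric] by simp_all

definition psi where "psi = coset_map (\<lambda>p. \<theta> (subst (ohn_to_ext hbar lam) p))"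

lemma to_ext_hom: "(\<lambda>p. \<theta> (subst (ohn_to_ext hbar lam) p)) \<in> alg_hom free_alg E"
  by (rule alg_hom_comp[OF subst_hom theta_hom])

lemma to_ext_rels: "r \<in> ohn_rels hbar \<Longrightarrow> \<theta> (subst (ohn_to_ext hbar lam) r) = \<zero>\<^bsub>E\<^esub>"
proof -
  assume "r \<in> ohn_rels hbar"
  then consider "r = ohn_TTi" | "r = ohn_TiT" | "r = ohn_KT" | "r = ohn_YT hbar" | "r = ohn_KY hbar"
    by (auto simp: ohn_rels_eq)
  then have "subst (ohn_to_ext hbar lam) r \<in> rel_ideal (ext_rels lam)"
    by cases (simp_all only: ohn_to_ext_TTi ohn_to_ext_TiT ohn_to_ext_KT ohn_to_ext_YT ohn_to_ext_KY)
  then show "\<theta> (subst (ohn_to_ext hbar lam) r) = \<zero>\<^bsub>E\<^esub>"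
    by (rule free_hom_Idl_zero[OF KE theta_hom theta_rels, rotated 1])
qed

lemma psi_hom: "psi \<in> alg_hom LA E"
  unfolding psi_def by (rule pres_lift_hom[OF KE to_ext_hom to_ext_rels])

lemma psi_f: "psi (f (q p)) = (q p, \<zero>\<^bsub>Q\<^esub>)"
proof -
  have "psi (f (q p)) = \<theta> (subst (ohn_to_ext hbar lam) (subst (jordan_to_ohn hbar lam) p))"
    unfolding f_q psi_def by (rule pres_lift_class[OF KE to_ext_hom to_ext_rels])
  also have "\<dots> = \<theta> (emb p)"
  proof (rule EE.alg_hom_free_ext[OF alg_hom_comp[OF subst_hom to_ext_hom] alg_hom_comp[OF subst_hom theta_hom]])
    fix x
    have "subst (ohn_to_ext hbar lam) (jordan_to_ohn hbar lam x) - gen (EJ x) \<in> rel_ideal (ext_rels lam)"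
      by (cases x; hypsubst; rule jordan_to_ohn_to_ext_JA1 jordan_to_ohn_to_ext_JA2 jordan_to_ohn_to_ext_JG jordan_to_ohn_to_ext_JGi; rule hbar)
    from free_hom_eqI[OF KE theta_hom theta_rels this]
    show "\<theta> (subst (ohn_to_ext hbar lam) (subst (jordan_to_ohn hbar lam) (gen x))) = \<theta> (emb (gen x))" by simp
  qed
  finally show ?thesis by (simp add: theta_emb)
qed

sublocale emb: hopf_embedding "jordan lam" L f "\<lambda>b. fst (psi b)"
proof -
  have J: "hopf_algebra (jordan lam)"
    unfolding jordan_eq by (rule hopf_algebra_hopf_quot[OF hopf_ideal_jordan_ideal])
  interpret J: hopf_algebra "jordan lam" by (rule J)
  interpret L: hopf_algebra L by (rule hopf_algebra_ohn)
  have carr: "\<exists>b\<in>carrier JT. a = \<pi> b" if "a \<in> carrier (jordan lam)" for a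
    using that unfolding jordan_maps Q.proj_carrier .
  note H = jordan_tilde_eq[symmetric] ohn_eq[symmetric]
  note hid = hopf_ideal_jordan_ideal[of lam]
  note pl = alg_hom_linear[OF Q.proj_hom] and fl = alg_hom_linear[OF f_hom]
  interpret JT: hopf_algebra JT by (rule hopf_algebra_jordan_tilde)
  show "hopf_embedding (jordan lam) L f (\<lambda>b. fst (psi b))"
  proof (intro hopf_embedding.intro hopf_embedding_axioms.intro J hopf_algebra_ohn)
    show "f \<in> alg_hom (jordan lam) L" unfolding jordan_maps ohn_maps by (rule f_hom)
    \<comment> \<open>Only linearity can be claimed: the first component of \<open>s\<close> is 0,
      while that of \<open>s s\<close> is \<open>g\<close>.\<close>
    show "(\<lambda>b. fst (psi b)) \<in> linear_maps L (jordan lam)"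
      unfolding jordan_maps ohn_maps by (rule linear_maps_comp[OF alg_hom_linear[OF psi_hom] tw.twist_fst_linear])
    show "fst (psi (f a)) = a" if "a \<in> carrier (jordan lam)" for a
      using that psi_f unfolding jordan_maps Q_carrier by auto
    fix a assume "a \<in> carrier (jordan lam)"
    then obtain b where b: "b \<in> carrier JT" "a = \<pi> b" using carr by blast
    have bA: "b \<in> carrier (pres_alg jordan_rels)" using b(1) by (simp add: jordan_tilde_carrier)
    have d: "comult JT b \<in> carrier (tensor JT JT)" by (rule alg_homD(1)[OF JT.comult_hom b(1)])
    have "comult L (f a) = tensor_map LA LA map.F map.F (comult JT b)"
      unfolding b(2) f_proj[OF b(1)] using map.F_comult[OF bA] by (simp only: H)
    also have "\<dots> = tensor_map LA LA (\<lambda>b. f (\<pi> b)) (\<lambda>b. f (\<pi> b)) (comult JT b)"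
      by (rule tensor_map_cong[OF K K KL KL linear_maps_comp[OF pl fl] linear_maps_comp[OF pl fl] _ _ d])
        (simp_all add: f_proj)
    also have "\<dots> = tensor_map LA LA f f (tensor_map Q Q \<pi> \<pi> (comult JT b))"
      by (rule tensor_map_comp[OF K K KQ KQ KL KL pl pl fl fl d, symmetric])
    also have "tensor_map Q Q \<pi> \<pi> (comult JT b) = comult (jordan lam) a"
      unfolding b(2) jordan_eq by (rule comult_hopf_quot[OF hid b(1), symmetric])
    finally show "comult L (f a) = tensor_map L L f f (comult (jordan lam) a)" unfolding ohn_maps .
    show "counit L (f a) = counit (jordan lam) a"
      unfolding b(2) f_proj[OF b(1)] jordan_eq counit_hopf_quot[OF hid b(1)] using map.F_counit[OF bA] by (simp only: H)
    have "antipode JT b \<in> carrier JT" by (rule linear_mapsD(1)[OF JT.antipode_linear b(1)])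
    then show "antipode L (f a) = f (antipode (jordan lam) a)"
      unfolding b(2) f_proj[OF b(1)] jordan_eq antipode_hopf_quot[OF hid b(1)]
      using map.F_antipode[OF bA] by (simp only: H f_proj)
  qed
qed

section \<open>The image as the Hopf subalgebra generated by \<open>x\<close>, \<open>y\<close> and
  \<open>g\<close>\<close>

abbreviation "X \<equiv> {oc (gen OK * gen OTi), oc (gen OY * gen OTi), oc (gen OTi * gen OTi)}"

lemma X_image: "X \<subseteq> f ` carrier (jordan lam)"
proof -
  let ?e = "lam + 1 / 32"
  have img: "oc (subst (jordan_to_ohn hbar lam) p) \<in> f ` carrier (jordan lam)" for p
    unfolding f_q[symmetric] jordan_maps using Q_carrier by blast
  have x: "gen OK * gen OTi = subst (jordan_to_ohn hbar lam) (cst 2 * gen JA1)"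
    by (simp add: jordan_to_ohn_def flip: mult.assoc cst_mult)
  \<comment> \<open>The formula for \<open>a2\<close> solved for \<open>y\<close>, as in
    \<open>ohn_to_ext\<close>; dividing out the coefficient uses that \<open>hbar\<close> is not
    0.\<close>
  have y: "gen OY * gen OTi = subst (jordan_to_ohn hbar lam)
      (cst (- 4 * hbar) * (gen JA2 + cst (1 / 2) * gen JA1 - cst ?e * (1 - gen JG)))"
    by (simp only: jordan_to_ohn_defs subst_simps, simp only: expand_words; rule poly_mapping_eqI;
        simp only: lookup_words; simp add: field_simps hbar)
  have g: "gen OTi * gen OTi = subst (jordan_to_ohn hbar lam) (gen JG)"
    by (simp add: jordan_to_ohn_def)
  show ?thesis
    using img[of "cst 2 * gen JA1"] img[of "gen JG"]
      img[of "cst (- 4 * hbar) * (gen JA2 + cst (1 / 2) * gen JA1 - cst ?e * (1 - gen JG))"]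
    unfolding x[symmetric] y[symmetric] g[symmetric] by blast
qed

text \<open>\<open>X\<close> does not list \<open>g^-1 = T^2\<close>, but a Hopf subalgebra contains
  it as the antipode of \<open>g\<close>. The images of all four generators are linear combinations
  of 1, \<open>x\<close>, \<open>y\<close>, \<open>g\<close> and \<open>g^-1\<close>.\<close>

lemma image_minimal:
  assumes C: "hopf_subalgebra C L" and XC: "X \<subseteq> C"
  shows "f ` carrier (jordan lam) \<subseteq> C"
proof -
  have sr: "subring C L" and sm: "\<And>c b. b \<in> C \<Longrightarrow> c \<odot>\<^bsub>LA\<^esub> b \<in> C" and anti: "\<And>b. b \<in> C \<Longrightarrow> antipode L b \<in> C"
    using C by (auto simp: hopf_subalgebra_def ohn_simps)
  have one: "oc 1 \<in> C" using subringE(3)[OF sr] by (simp add: ohn_simps oc_simps)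
  have add: "oc p \<in> C \<Longrightarrow> oc r \<in> C \<Longrightarrow> oc (p + r) \<in> C" for p r
    using subringE(7)[OF sr] by (simp add: ohn_simps oc_simps)
  have mult: "oc p \<in> C \<Longrightarrow> oc r \<in> C \<Longrightarrow> oc (p * r) \<in> C" for p r
    using subringE(6)[OF sr] by (simp add: ohn_simps oc_simps)
  have smult: "oc p \<in> C \<Longrightarrow> oc (cst c * p) \<in> C" for c p
    using sm by (simp add: oc_simps(8))
  have diff: "oc p \<in> C \<Longrightarrow> oc r \<in> C \<Longrightarrow> oc (p - r) \<in> C" for p r
  proof -
    have "cst (1 + - 1) = cst 1 + (cst (- 1) :: (ohn_gen, 'k) free)" by (rule cst_add)
    then have "(cst (- 1) :: (ohn_gen, 'k) free) = - 1" by (simp add: add_eq_0_iff)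
    then show "oc p \<in> C \<Longrightarrow> oc r \<in> C \<Longrightarrow> oc (p - r) \<in> C"
      using add[OF _ smult[of r "-1"], of p] by simp
  qed
  have X: "oc (gen OK * gen OTi) \<in> C" "oc (gen OY * gen OTi) \<in> C" "oc (gen OTi * gen OTi) \<in> C"
    using XC by auto
  have "antipode L (oc (gen OTi * gen OTi)) = oc (gen OT * gen OT)"
    using ohn.antipode_poly_cls[of hbar "gen OTi * gen OTi"] by (simp add: ohn_eq ohn_antipode_poly_def)
  then have T: "oc (gen OT * gen OT) \<in> C" using anti[OF X(3)] by simp
  have gens: "oc (jordan_to_ohn hbar lam x) \<in> C" for x
    by (cases x; simp only: jordan_to_ohn_defs; intro add diff smult one X T)
  have "oc (subst (jordan_to_ohn hbar lam) p) \<in> C" for p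
    by (induction p rule: free_induct) (simp_all add: one add mult smult gens)
  then show ?thesis unfolding jordan_maps by (auto simp: Q_carrier f_q)
qed

lemma hopf_isomorphic_jordan: "hopf_isomorphic (jordan lam) (hopf_generated L X)"
  by (rule emb.hopf_isomorphic_generated[OF X_image image_minimal])

end

text \<open>The first two conjuncts show that the objects in the third are the intended ones. If
  \<open>ohn hbar\<close> were not a Hopf algebra, it would have no Hopf subalgebras and the hull
  would be an empty intersection; if the ideal were not a Hopf ideal, the structure maps of the
  quotient would lack well-defined values.\<close>

theorem mainTheorem4:
  fixes hbar lam :: "'k::{alg_closed_field, field_char_0}"
  assumes "hbar \<noteq> 0"
  shows "hopf_algebra (ohn hbar) \<and> hopf_ideal (jordan_ideal lam) jordan_tilde \<and>
    hopf_isomorphic (jordan lam)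
      (hopf_generated (ohn hbar)
        {ohn_cls hbar (gen OK * gen OTi), ohn_cls hbar (gen OY * gen OTi), ohn_cls hbar (gen OTi * gen OTi)})"
proof (intro conjI)
  interpret jordan_ohn lam hbar by unfold_locales (rule assms)
  show "hopf_algebra (ohn hbar)" by (rule hopf_algebra_ohn)
  show "hopf_ideal (jordan_ideal lam) jordan_tilde" by (rule hopf_ideal_jordan_ideal)
  show "hopf_isomorphic (jordan lam)
      (hopf_generated (ohn hbar)
        {ohn_cls hbar (gen OK * gen OTi), ohn_cls hbar (gen OY * gen OTi), ohn_cls hbar (gen OTi * gen OTi)})"
    using hopf_isomorphic_jordan by (simp add: ohn_cls_def)
qed

end
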